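(* Fix an o-minimal structure on the real field. Let $f:\mathbb{R}^n \rightarrow \mathbb{R}$ be a locally Lipschitz coercive function that is tame in this structure, and let $\mathcal{M}$ be an iterative method with constant step size that is approximated by subgradient trajectories of $f$. For any bounded set $X_0 \subset \mathbb{R}^n$ and $\epsilon>0$, there exist $\bar{\alpha}, \Delta>0$ such that for all $\alpha\in(0,\bar{\alpha}]$ and all $(x_k)_{k \in \mathbb{N}} \in \mathcal{M}(f,\alpha,X_0,0)$, we have $f(x_k) \leqslant \Delta$ for all $k \in \mathbb{N}$, and there exist a critical value $f^*$ of $f$ and $k_0 \in \mathbb{N}$ such that $|f(x_k) - f^*| \leqslant \epsilon$ for all $k \geqslant k_0$.
   Context: Notation: $\mathbb{N}=\{0,1,2,\ldots\}$; $\langle\cdot,\cdot\rangle$ is an inner product on $\mathbb{R}^n$ with induced norm $\|\cdot\|$; $B(a,r)$ is the closed ball of center $a$ and radius $r>0$; $\lfloor\cdot\rfloor$ is the floor function. A function $f:\mathbb{R}^n\to\mathbb{R}$ is locally Lipschitz if for all $a\in\mathbb{R}^n$ there exist $r>0$ and $L>0$ such that $|f(x)-f(y)|\leqslant L\|x-y\|$ for all $x,y\in B(a,r)$. It is coercive if $\lim_{\|x\|\to\infty} f(x)=\infty$. Clarke subdifferential: for $f$ locally Lipschitz, $\partial f(x) := \{ s \in \mathbb{R}^n : f^\circ(x,d) \geqslant \langle s , d \rangle\ \forall d\in \mathbb{R}^n \}$, where $f^\circ(x,d) := \limsup_{y\to x,\, t\searrow 0} \frac{f(y+td)-f(y)}{t}$.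 A point $x$ is critical if $0\in\partial f(x)$; $v\in\mathbb{R}$ is a critical value if $v=f(x)$ for some critical point $x$. O-minimal structure on the real field: a sequence $S=(S_k)_{k\in\mathbb{N}}$ such that for all $k\in\mathbb{N}$: (1) $S_k$ is a boolean algebra of subsets of $\mathbb{R}^k$ with $\mathbb{R}^k\in S_k$; (2) $S_k$ contains the diagonal $\{(x_1,\ldots,x_k)\in\mathbb{R}^k: x_i=x_j\}$ for $1\leqslant i<j\leqslant k$; (3) if $A\in S_k$ then $A\times\mathbb{R}$ and $\mathbb{R}\times A$ belong to $S_{k+1}$; (4) if $A\in S_{k+1}$ and $\pi:\mathbb{R}^{k+1}\to\mathbb{R}^k$ is the projection onto the first $k$ coordinates, then $\pi(A)\in S_k$; (5) $S_3$ contains the graphs of addition and multiplication; (6) $S_1$ consists exactly of the finite unions of open intervals and singletons. A set $C\subset\mathbb{R}^n$ is tame if $C\cap B(x,r)\in S_n$ for all $x\in\mathbb{R}^n$ and $r>0$; a function $f:\mathbb{R}^n\to\mathbb{R}$ is tame if its graph $\{(x,t)\in\mathbb{R}^{n+1}: f(x)=t\}$ is tame. Iterative method with constant step size: a set-valued mapping $\mathcal{M}$ which, to an objective function $f:\mathbb{R}^n\to\mathbb{R}$, a constant step size $\alpha\in(0,\infty)$, a set $X_0\subset\mathbb{R}^n$ and a natural number $\bar{k}$, associates a set $\mathcal{M}(f,\alpha,X_0,\bar{k})$ of sequences in $\mathbb{R}^n$ whose $\bar{k}$th term is contained in $X_0$. A function $x:[a,b]\to\mathbb{R}^n$ is absolutely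 continuous if for all $\epsilon>0$ there exists $\delta>0$ such that, for any finite collection of disjoint subintervals $[a_1,b_1],\ldots,[a_m,b_m]$ of $[a,b]$ with $\sum_{i=1}^m (b_i-a_i)\leqslant\delta$, we have $\sum_{i=1}^m\|x(b_i)-x(a_i)\|\leqslant\epsilon$. An iterative method $\mathcal{M}$ is approximated by subgradient trajectories of a locally Lipschitz function $f:\mathbb{R}^n\to\mathbb{R}$ (up to a positive multiplicative constant) if there exists $c>0$ such that for any compact sets $X_0,X_1\subset\mathbb{R}^n$, there exists $T>0$ such that for all $\epsilon>0$, there exists $\bar{\alpha}>0$ such that for all $\alpha\in(0,\bar{\alpha}]$, $\bar{k}\in\mathbb{N}$, and $(x_k)_{k\in\mathbb{N}}\in\mathcal{M}(f,\alpha,X_0,\bar{k})$ for which $x_0,\ldots,x_{\bar{k}}\in X_1$, there exists an absolutely continuous function $x:[0,T]\to\mathbb{R}^n$ such that $x'(t)\in -c\,\partial f(x(t))$ for almost every $t\in[0,T]$, $x(0)\in X_0$, and $\|x_k-x((k-\bar{k})\alpha)\|\leqslant\epsilon$ for $k=\bar{k},\ldots,\bar{k}+\lfloor T/\alpha\rfloor$.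
   Formalization: An iterative method is also required to be consistent: a sequence in M(f,α,X,k) whose k'-th term, k' ≥ k, lies in X' belongs to M(f,α,X',k'). Without this the claim fails, e.g. f(x)=x² with M empty for compact X and all sequences with x_k in X otherwise. *)

theory Defs
  imports "HOL-Analysis.Analysis"
begin

section \<open>Arbitrary inner products\<close>

text \<open>The inner product is an explicit parameter, because the Clarke subdifferential depends on
  it and it need not be the standard inner product of \<^typ>\<open>real ^ 'n\<close>. Notions that do not depend
  on the choice of a norm in finite dimension (compactness, boundedness, derivatives, negligible
  sets) are those of the library.\<close>

definition inner_product :: "('a::real_vector \<Rightarrow> 'a \<Rightarrow> real) \<Rightarrow> bool" where
  "inner_product ip \<longleftrightarrow>
     (\<forall>x y. ip x y = ip y x) \<and> (\<forall>y. linear (\<lambda>x. ip x y)) \<and> (\<forall>x. x \<noteq> 0 \<longrightarrow> ip x x > 0)"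

definition ip_norm :: "('a::real_vector \<Rightarrow> 'a \<Rightarrow> real) \<Rightarrow> 'a \<Rightarrow> real" where
  "ip_norm ip x = sqrt (ip x x)"

definition ip_cball :: "('a::real_vector \<Rightarrow> 'a \<Rightarrow> real) \<Rightarrow> 'a \<Rightarrow> real \<Rightarrow> 'a set" where
  "ip_cball ip a r = {x. ip_norm ip (x - a) \<le> r}"

section \<open>Locally Lipschitz and coercive functions\<close>

definition locally_Lipschitz ::
    "('a::real_vector \<Rightarrow> 'a \<Rightarrow> real) \<Rightarrow> ('a \<Rightarrow> real) \<Rightarrow> bool" where
  "locally_Lipschitz ip f \<longleftrightarrow>
     (\<forall>a. \<exists>r>0. \<exists>L>0. \<forall>x\<in>ip_cball ip a r. \<forall>y\<in>ip_cball ip a r.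
        \<bar>f x - f y\<bar> \<le> L * ip_norm ip (x - y))"

definition coercive :: "('a::real_vector \<Rightarrow> 'a \<Rightarrow> real) \<Rightarrow> ('a \<Rightarrow> real) \<Rightarrow> bool" where
  "coercive ip f \<longleftrightarrow> filterlim f at_top (filtercomap (ip_norm ip) at_top)"

section \<open>The Clarke subdifferential\<close>

text \<open>In the upper limit, \<open>y\<close> is allowed to equal \<open>x\<close>. It is taken in the extended reals so that
  it is meaningful for every \<open>f\<close>; it is finite if \<open>f\<close> is locally Lipschitz.\<close>

definition clarke_dderiv :: "(real ^ 'n \<Rightarrow> real) \<Rightarrow> real ^ 'n \<Rightarrow> real ^ 'n \<Rightarrow> ereal" where
  "clarke_dderiv f x d =
     Limsup (nhds x \<times>\<^sub>F at_right 0) (\<lambda>(y, t). ereal ((f (y + t *\<^sub>R d) - f y) / t))"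

definition clarke_subdiff ::
    "(real ^ 'n \<Rightarrow> real ^ 'n \<Rightarrow> real) \<Rightarrow> (real ^ 'n \<Rightarrow> real) \<Rightarrow> real ^ 'n \<Rightarrow> (real ^ 'n) set" where
  "clarke_subdiff ip f x = {s. \<forall>d. clarke_dderiv f x d \<ge> ereal (ip s d)}"

definition critical_point ::
    "(real ^ 'n \<Rightarrow> real ^ 'n \<Rightarrow> real) \<Rightarrow> (real ^ 'n \<Rightarrow> real) \<Rightarrow> real ^ 'n \<Rightarrow> bool" where
  "critical_point ip f x \<longleftrightarrow> 0 \<in> clarke_subdiff ip f x"

definition critical_value ::
    "(real ^ 'n \<Rightarrow> real ^ 'n \<Rightarrow> real) \<Rightarrow> (real ^ 'n \<Rightarrow> real) \<Rightarrow> real \<Rightarrow> bool" where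
  "critical_value ip f v \<longleftrightarrow> (\<exists>x. critical_point ip f x \<and> v = f x)"

section \<open>O-minimal structures and tameness\<close>

text \<open>Since \<open>k\<close> varies inside the definition, the space of real \<open>k\<close>-tuples is represented by the
  lists of length \<open>k\<close>. Open intervals may be unbounded.\<close>

definition o_minimal_structure :: "(nat \<Rightarrow> real list set set) \<Rightarrow> bool" where
  "o_minimal_structure S \<longleftrightarrow>
     (\<forall>k. algebra {xs. length xs = k} (S k)) \<and>
     (\<forall>k i j. i < j \<and> j < k \<longrightarrow> {xs. length xs = k \<and> xs ! i = xs ! j} \<in> S k) \<and>
     (\<forall>k. \<forall>A\<in>S k. {xs @ [t] |xs t. xs \<in> A} \<in> S (Suc k) \<and> {t # xs |t xs. xs \<in> A} \<in> S (Suc k)) \<and>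
     (\<forall>k. \<forall>A\<in>S (Suc k). take k ` A \<in> S k) \<and>
     {[x, y, x + y] |x y. True} \<in> S 3 \<and>
     {[x, y, x * y] |x y. True} \<in> S 3 \<and>
     S 1 = {(\<lambda>x. [x]) ` \<Union>\<J> |\<J>.
              finite \<J> \<and> (\<forall>J\<in>\<J>. (open J \<and> is_interval J) \<or> (\<exists>x. J = {x}))}"

text \<open>For \<open>\<phi>\<close> a coordinate map that identifies the type \<open>'a\<close> with the real \<open>k\<close>-tuples.\<close>

definition tame_set ::
    "(nat \<Rightarrow> real list set set) \<Rightarrow> nat \<Rightarrow> ('a::real_vector \<Rightarrow> real list) \<Rightarrow> ('a \<Rightarrow> 'a \<Rightarrow> real) \<Rightarrow>
     'a set \<Rightarrow> bool" where
  "tame_set S k \<phi> ip C \<longleftrightarrow> (\<forall>x. \<forall>r>0. \<phi> ` (C \<inter> ip_cball ip x r) \<in> S k)"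

text \<open>The list \<open>js\<close> enumerates the index type \<open>'n\<close>, i.e. it fixes the order of the coordinates. The
  graph lives in \<^typ>\<open>real ^ 'n \<times> real\<close>, with the function value as last coordinate and with the
  product inner product; as balls of all inner products are semialgebraic and hence belong to every
  o-minimal structure, another inner product there would give the same notion.\<close>

definition tame_function ::
    "(nat \<Rightarrow> real list set set) \<Rightarrow> 'n list \<Rightarrow> (real ^ 'n \<Rightarrow> real ^ 'n \<Rightarrow> real) \<Rightarrow>
     (real ^ 'n \<Rightarrow> real) \<Rightarrow> bool" where
  "tame_function S js ip f \<longleftrightarrow>
     tame_set S (CARD('n) + 1) (\<lambda>(x, t). map (\<lambda>j. x $ j) js @ [t])
       (\<lambda>(x, t) (y, s). ip x y + t * s) {(x, t). f x = t}"

section \<open>Iterative methods and subgradient trajectories\<close>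

type_synonym 'n iteration =
  "(real ^ 'n \<Rightarrow> real) \<Rightarrow> real \<Rightarrow> (real ^ 'n) set \<Rightarrow> nat \<Rightarrow> (nat \<Rightarrow> real ^ 'n) set"

text \<open>The set \<open>M f \<alpha> X k\<close> consists of the sequences generated by the method (with objective function
  \<open>f\<close> and step size \<open>\<alpha>\<close>) whose \<open>k\<close>th term lies in \<open>X\<close>: the arguments \<open>X\<close> and \<open>k\<close> only localize
  the sequences. This is the content of the second clause: a generated sequence which at a later
  (or the same) index \<open>k'\<close> lies in \<open>X'\<close> is among the sequences associated with \<open>X'\<close> and \<open>k'\<close>.
  Without it, the sets associated with different \<open>X\<close> and \<open>k\<close> would be unrelated, and an assumption
  about compact \<open>X\<close> and finite stretches of indices starting at \<open>k\<close> would say nothing about bounded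
  \<open>X\<close> or about the long-term behaviour of the sequences.\<close>

definition iterative_method :: "'n iteration \<Rightarrow> bool" where
  "iterative_method M \<longleftrightarrow>
     (\<forall>f. \<forall>\<alpha>>0. \<forall>X k. \<forall>x\<in>M f \<alpha> X k.
        x k \<in> X \<and> (\<forall>X' k'. k \<le> k' \<and> x k' \<in> X' \<longrightarrow> x \<in> M f \<alpha> X' k'))"

definition absolutely_continuous_fun ::
    "('a::real_vector \<Rightarrow> 'a \<Rightarrow> real) \<Rightarrow> real \<Rightarrow> real \<Rightarrow> (real \<Rightarrow> 'a) \<Rightarrow> bool" where
  "absolutely_continuous_fun ip a b x \<longleftrightarrow>
     (\<forall>\<epsilon>>0. \<exists>\<delta>>0. \<forall>(m::nat) l u.
        (\<forall>i<m. a \<le> l i \<and> l i \<le> u i \<and> u i \<le> b) \<and>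
        disjoint_family_on (\<lambda>i. {l i..u i}) {..<m} \<and>
        (\<Sum>i<m. u i - l i) \<le> \<delta> \<longrightarrow>
        (\<Sum>i<m. ip_norm ip (x (u i) - x (l i))) \<le> \<epsilon>)"

definition subgradient_trajectory ::
    "(real ^ 'n \<Rightarrow> real ^ 'n \<Rightarrow> real) \<Rightarrow> (real ^ 'n \<Rightarrow> real) \<Rightarrow> real \<Rightarrow> real \<Rightarrow>
     (real \<Rightarrow> real ^ 'n) \<Rightarrow> bool" where
  "subgradient_trajectory ip f c T x \<longleftrightarrow>
     absolutely_continuous_fun ip 0 T x \<and>
     (AE t in lebesgue_on {0..T}.
        \<exists>v. (x has_vector_derivative v) (at t within {0..T}) \<and>
            v \<in> (\<lambda>s. - (c *\<^sub>R s)) ` clarke_subdiff ip f (x t))"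

definition approximated_by_subgradient_trajectories ::
    "(real ^ 'n \<Rightarrow> real ^ 'n \<Rightarrow> real) \<Rightarrow> 'n iteration \<Rightarrow> (real ^ 'n \<Rightarrow> real) \<Rightarrow> bool" where
  "approximated_by_subgradient_trajectories ip M f \<longleftrightarrow>
     (\<exists>c>0. \<forall>X\<^sub>0 X\<^sub>1. compact X\<^sub>0 \<and> compact X\<^sub>1 \<longrightarrow>
        (\<exists>T>0. \<forall>\<epsilon>>0. \<exists>\<alpha>'>0. \<forall>\<alpha>\<in>{0<..\<alpha>'}. \<forall>k'. \<forall>x\<in>M f \<alpha> X\<^sub>0 k'.
           (\<forall>k\<le>k'. x k \<in> X\<^sub>1) \<longrightarrow>
           (\<exists>y. subgradient_trajectory ip f c T y \<and> y 0 \<in> X\<^sub>0 \<and>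
              (\<forall>k\<in>{k'..k' + nat \<lfloor>T / \<alpha>\<rfloor>}.
                 ip_norm ip (x k - y ((real k - real k') * \<alpha>)) \<le> \<epsilon>))))"

end

theory Submission
  imports Defs
begin

text \<open>Two facts about a tame coercive \<open>f\<close> suffice: \<open>f\<close> decreases along subgradient trajectories, at
  a rate bounded below away from critical points, and the noncritical values are dense. Given these,
  fix finitely many noncritical levels with small gaps. Over each block of \<open>\<lfloor>T / \<alpha>\<rfloor>\<close> iterations, the
  values at the iterates cannot rise through a level, and they drop by a definite amount in a gap
  without critical values; so they are eventually trapped in a gap that contains a critical value.

  Both facts are usually derived from Whitney stratifications. Here cell decompositions are replaced
  by Baire category: since definable subsets of the line are finite unions of intervals and points, a
  definable set that is dense in an open set contains an open set, hence if countably many definable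
  sets cover an open set, one of them contains a ball. It follows that definable functions are
  almost linear on suitable balls, and that every definable set is a countable union of definable
  sets along which the upper Clarke derivative in tangent directions is at most the actual rate of
  change of \<open>f\<close> plus \<open>\<eta>\<close>. As a subset of the line has only countably many left-isolated points, almost
  every time of a trajectory is a limit of times at which the trajectory is in the same piece, which
  gives the rate of decrease there. The same pieces, together with definable choice, show that the
  critical values contain no interval.\<close>

section \<open>Definable sets and functions\<close>

text \<open>A subgradient s only bounds the upper Clarke derivative from below, in every direction
  d, by the inner product of s and d. It is therefore used in the direction d = - x'(t) = c s, that
  is, along the trajectory run backwards; this is why left increments occur throughout. The obstacle
  is that a piece of the cover turns this bound into an actual rate only for those small h for which
  x(t - h) lies in the piece, and the trajectory itself is not definable. The way out is the
  straight ray x(t) + h c s: along it the comparison of slopes is a definable condition on h, so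
  once it holds for arbitrarily small h, it holds for all small h. Lipschitz continuity carries the
  estimate from the curve to the ray and back. Linearity is only asked for up to a fixed error
  \<kappa>, and the chain rule up to a fixed error \<eta>, because rational slopes and directions
  then give countable covers to which Baire's theorem applies. The errors are sent to 0 at the very
  end, or compared with a fixed gap.\<close>

locale omin =
  fixes S :: "nat \<Rightarrow> real list set set"
  assumes om: "o_minimal_structure S"
begin

section \<open>Closure properties of definable sets of tuples\<close>

lemma S_algebra: "algebra {xs. length xs = k} (S k)"
  using om unfolding o_minimal_structure_def by (elim conjE) (erule spec)

lemma S_diag_less: "i < j \<Longrightarrow> j < k \<Longrightarrow> {xs. length xs = k \<and> xs ! i = xs ! j} \<in> S k"
  using om unfolding o_minimal_structure_def by (elim conjE) simp

lemma S_snoc: "A \<in> S k \<Longrightarrow> {xs @ [t] |xs t. xs \<in> A} \<in> S (Suc k)"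
  using om unfolding o_minimal_structure_def by (elim conjE) simp

lemma S_Cons: "A \<in> S k \<Longrightarrow> {t # xs |t xs. xs \<in> A} \<in> S (Suc k)"
  using om unfolding o_minimal_structure_def by (elim conjE) simp

lemma S_take_Suc: "A \<in> S (Suc k) \<Longrightarrow> take k ` A \<in> S k"
  using om unfolding o_minimal_structure_def by (elim conjE) simp

lemma S_add: "{[x, y, x + y] |x y. True} \<in> S 3"
  using om unfolding o_minimal_structure_def by (elim conjE) assumption

lemma S_mult: "{[x, y, x * y] |x y. True} \<in> S 3"
  using om unfolding o_minimal_structure_def by (elim conjE) assumption

lemma S1: "S 1 = {(\<lambda>x. [x]) ` \<Union>\<J> |\<J>.
              finite \<J> \<and> (\<forall>J\<in>\<J>. (open J \<and> is_interval J) \<or> (\<exists>x. J = {x}))}"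
  using om unfolding o_minimal_structure_def by (elim conjE) assumption

lemma S_algebra_Un: "S k \<subseteq> Pow {xs. length xs = k} \<and> {} \<in> S k \<and>
    (\<forall>A\<in>S k. {xs. length xs = k} - A \<in> S k) \<and> (\<forall>A\<in>S k. \<forall>B\<in>S k. A \<union> B \<in> S k)"
  using S_algebra[of k] unfolding algebra_iff_Un .

lemma S_length: "A \<in> S k \<Longrightarrow> xs \<in> A \<Longrightarrow> length xs = k"
  using S_algebra_Un[of k] by auto

lemma S_Int: "A \<in> S k \<Longrightarrow> B \<in> S k \<Longrightarrow> A \<inter> B \<in> S k"
  using S_algebra[of k] unfolding algebra_iff_Int by simp

lemma S_Compl: "A \<in> S k \<Longrightarrow> {xs. length xs = k} - A \<in> S k"
  using S_algebra_Un[of k] by simp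

lemma S_full: "{xs. length xs = k} \<in> S k"
  using S_algebra[of k] by (rule algebra.top)

lemma S_diag:
  assumes "i < k" "j < k"
  shows "{xs. length xs = k \<and> xs ! i = xs ! j} \<in> S k"
proof (cases i j rule: linorder_cases)
  case greater
  have "{xs. length xs = k \<and> xs ! i = xs ! j} = {xs. length xs = k \<and> xs ! j = xs ! i}"
    by auto
  then show ?thesis using S_diag_less[OF greater assms(1)] by metis
qed (use S_diag_less assms S_full in auto)

lemma S_prepend: "A \<in> S k \<Longrightarrow> {xs. length xs = m + k \<and> drop m xs \<in> A} \<in> S (m + k)"
proof (induction m)
  case 0
  have "xs \<in> {xs. length xs = 0 + k \<and> drop 0 xs \<in> A} \<longleftrightarrow> xs \<in> A" for xs
    using S_length[OF 0, of xs] by auto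
  then have "{xs. length xs = 0 + k \<and> drop 0 xs \<in> A} = A" by blast
  then show ?case using 0 by simp
next
  case (Suc m)
  let ?B = "{xs. length xs = m + k \<and> drop m xs \<in> A}"
  have "{t # xs |t xs. xs \<in> ?B} \<in> S (Suc (m + k))"
    using Suc by (intro S_Cons) auto
  moreover have "{t # xs |t xs. xs \<in> ?B} = {xs. length xs = Suc m + k \<and> drop (Suc m) xs \<in> A}"
  proof (intro equalityI subsetI)
    fix xs assume *: "xs \<in> {xs. length xs = Suc m + k \<and> drop (Suc m) xs \<in> A}"
    then show "xs \<in> {t # xs |t xs. xs \<in> ?B}" by (cases xs) auto
  qed auto
  ultimately show ?case by simp
qed

lemma S_take: "A \<in> S (k + m) \<Longrightarrow> take k ` A \<in> S k"
proof (induction m arbitrary: A)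
  case 0
  have "take k xs = xs" if "xs \<in> A" for xs
    using S_length[OF 0 that] by simp
  then have "take k ` A = A" by force
  then show ?case using 0 by simp
next
  case (Suc m)
  have "take (k + m) ` A \<in> S (k + m)"
    using Suc.prems by (intro S_take_Suc) auto
  from Suc.IH[OF this] show ?case
    by (simp add: image_image min_def)
qed

lemma S_finite_Int:
  "finite J \<Longrightarrow> (\<And>j. j \<in> J \<Longrightarrow> A j \<in> S k) \<Longrightarrow> {xs. length xs = k \<and> (\<forall>j\<in>J. xs \<in> A j)} \<in> S k"
proof (induction J rule: finite_induct)
  case empty
  then show ?case using S_full by simp
next
  case (insert i J)
  have "{xs. length xs = k \<and> (\<forall>j\<in>insert i J. xs \<in> A j)}
      = A i \<inter> {xs. length xs = k \<and> (\<forall>j\<in>J. xs \<in> A j)}"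
    by auto
  then show ?case using S_Int insert by auto
qed

text \<open>Adjoin to \<open>xs\<close> a block of m further coordinates, force the block to lie in
  \<open>A\<close> and to copy the coordinates selected by \<open>s\<close>, then project it away.
  This covers permutation, repetition and omission of coordinates at once.\<close>

lemma S_reindex:
  assumes A: "A \<in> S m" and s: "\<And>j. j < m \<Longrightarrow> s j < k"
  shows "{xs. length xs = k \<and> map (\<lambda>j. xs ! s j) [0..<m] \<in> A} \<in> S k"
proof -
  let ?B = "{zs. length zs = k + m \<and> drop k zs \<in> A} \<inter>
     {zs. length zs = k + m \<and> (\<forall>j\<in>{..<m}. zs \<in> {zs. length zs = k + m \<and> zs ! (k + j) = zs ! s j})}"
  have "?B \<in> S (k + m)"
    using s by (intro S_Int S_prepend A S_finite_Int S_diag) (auto intro: trans_less_add1)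
  then have "take k ` ?B \<in> S k" by (rule S_take)
  moreover have "take k ` ?B = {xs. length xs = k \<and> map (\<lambda>j. xs ! s j) [0..<m] \<in> A}"
  proof (intro equalityI subsetI)
    fix xs assume "xs \<in> take k ` ?B"
    then obtain zs where zs: "zs \<in> ?B" "xs = take k zs" by blast
    have "map (\<lambda>j. xs ! s j) [0..<m] = drop k zs"
      using zs s by (intro nth_equalityI) auto
    then show "xs \<in> {xs. length xs = k \<and> map (\<lambda>j. xs ! s j) [0..<m] \<in> A}"
      using zs by auto
  next
    fix xs assume xs: "xs \<in> {xs. length xs = k \<and> map (\<lambda>j. xs ! s j) [0..<m] \<in> A}"
    have "xs @ map (\<lambda>j. xs ! s j) [0..<m] \<in> ?B"
      using xs s by (auto simp: nth_append)
    then show "xs \<in> take k ` ?B"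
      using xs by (intro image_eqI[of _ _ "xs @ map (\<lambda>j. xs ! s j) [0..<m]"]) auto
  qed
  ultimately show ?thesis by simp
qed

end

section \<open>Coordinates on Euclidean types\<close>

definition coords :: "'a::euclidean_space list \<Rightarrow> 'a \<Rightarrow> real list" where
  "coords bs x = map (\<lambda>b. x \<bullet> b) bs"

definition is_enum :: "'a::euclidean_space list \<Rightarrow> bool" where
  "is_enum bs \<longleftrightarrow> distinct bs \<and> set bs = Basis"

lemma is_enum_exists: "\<exists>bs::'a::euclidean_space list. is_enum bs"
  unfolding is_enum_def using finite_distinct_list[OF finite_Basis] by blast

lemma length_is_enum: "is_enum (bs::'a::euclidean_space list) \<Longrightarrow> length bs = DIM('a)"
  unfolding is_enum_def by (metis distinct_card)

lemma length_coords [simp]: "length (coords bs x) = length bs"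
  by (simp add: coords_def)

lemma coords_inject: "is_enum bs \<Longrightarrow> coords bs x = coords bs y \<longleftrightarrow> x = y"
  by (auto simp: coords_def is_enum_def intro: euclidean_eqI)

lemma coords_surj:
  fixes bs :: "'a::euclidean_space list"
  assumes "is_enum bs" "length xs = length bs"
  shows "\<exists>x. coords bs x = xs"
proof -
  have d: "distinct bs" "set bs = Basis" using assms by (auto simp: is_enum_def)
  let ?x = "\<Sum>i<length bs. (xs ! i) *\<^sub>R (bs ! i)"
  have "?x \<bullet> (bs ! j) = xs ! j" if j: "j < length bs" for j
  proof -
    have "?x \<bullet> (bs ! j) = (\<Sum>i<length bs. (xs ! i) * (bs ! i \<bullet> bs ! j))"
      by (simp add: inner_sum_left)
    also have "\<dots> = (\<Sum>i<length bs. if i = j then xs ! i else 0)"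
    proof (intro sum.cong refl)
      fix i assume i: "i \<in> {..<length bs}"
      have "bs ! i \<in> Basis" "bs ! j \<in> Basis" using i j d nth_mem by blast+
      then show "(xs ! i) * (bs ! i \<bullet> bs ! j) = (if i = j then xs ! i else 0)"
        using d i j by (auto simp: inner_Basis nth_eq_iff_index_eq)
    qed
    also have "\<dots> = xs ! j" using j by simp
    finally show ?thesis .
  qed
  then have "coords bs ?x = xs"
    using assms by (intro nth_equalityI) (auto simp: coords_def)
  then show ?thesis by blast
qed

text \<open>These are the maps along which \<open>S_reindex\<close> can pull back: projections,
  pairings and their compositions, which is what nested quantifiers over product types
  produce.\<close>

definition coordinate_map :: "('a::euclidean_space \<Rightarrow> 'b::euclidean_space) \<Rightarrow> bool" where
  "coordinate_map L \<longleftrightarrow> (\<forall>b\<in>Basis. \<exists>a\<in>Basis. \<forall>x. L x \<bullet> b = x \<bullet> a)"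

lemma coordinate_map_id: "coordinate_map (\<lambda>x. x)"
  by (auto simp: coordinate_map_def)

lemma coordinate_map_comp:
  "coordinate_map L \<Longrightarrow> coordinate_map M \<Longrightarrow> coordinate_map (\<lambda>x. L (M x))"
  unfolding coordinate_map_def by metis

lemma coordinate_map_fst: "coordinate_map (\<lambda>x. fst x)"
  unfolding coordinate_map_def
proof
  fix b :: 'a assume "b \<in> Basis"
  then show "\<exists>a\<in>Basis. \<forall>x::'a \<times> 'b. fst x \<bullet> b = x \<bullet> a"
    by (intro bexI[of _ "(b, 0)"]) (auto simp: Basis_prod_def)
qed

lemma coordinate_map_snd: "coordinate_map (\<lambda>x. snd x)"
  unfolding coordinate_map_def
proof
  fix b :: 'b assume "b \<in> Basis"
  then show "\<exists>a\<in>Basis. \<forall>x::'a \<times> 'b. snd x \<bullet> b = x \<bullet> a"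
    by (intro bexI[of _ "(0, b)"]) (auto simp: Basis_prod_def)
qed

lemma coordinate_map_Pair:
  assumes "coordinate_map L" "coordinate_map M"
  shows "coordinate_map (\<lambda>x. (L x, M x))"
  using assms unfolding coordinate_map_def Basis_prod_def by (auto simp: inner_Pair)

lemma coordinate_map_inner:
  assumes "coordinate_map L" "b \<in> Basis"
  shows "coordinate_map (\<lambda>x. L x \<bullet> b)"
  using assms unfolding coordinate_map_def by simp

section \<open>A calculus of definable predicates and functions\<close>

context omin
begin

text \<open>No order of the coordinates is singled out; by \<open>S_reindex\<close> one enumeration
  of the basis works if and only if all do (\<open>defpred_enum\<close>).\<close>

definition defpred :: "('a::euclidean_space \<Rightarrow> bool) \<Rightarrow> bool" where
  "defpred P \<longleftrightarrow> (\<exists>bs. is_enum bs \<and> coords bs ` {x. P x} \<in> S DIM('a))"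

definition deffun :: "('a::euclidean_space \<Rightarrow> 'b::euclidean_space) \<Rightarrow> bool" where
  "deffun g \<longleftrightarrow> defpred (\<lambda>p. snd p = g (fst p))"

lemma S_coordinate_vimage:
  fixes L :: "'a::euclidean_space \<Rightarrow> 'b::euclidean_space"
  assumes L: "coordinate_map L" and P: "coords bs ` {y. P y} \<in> S DIM('b)"
    and bs: "is_enum bs" and as: "is_enum as"
  shows "coords as ` {x. P (L x)} \<in> S DIM('a)"
proof -
  have "\<exists>i<DIM('a). \<forall>x. L x \<bullet> (bs ! j) = x \<bullet> (as ! i)" if "j < DIM('b)" for j
  proof -
    have "bs ! j \<in> Basis" using that bs length_is_enum[OF bs]
      by (metis is_enum_def nth_mem)
    then obtain a where "a \<in> Basis" "\<forall>x. L x \<bullet> (bs ! j) = x \<bullet> a"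
      using L unfolding coordinate_map_def by blast
    then show ?thesis
      using as length_is_enum[OF as] by (metis in_set_conv_nth is_enum_def)
  qed
  then obtain s where s: "\<And>j. j < DIM('b) \<Longrightarrow> s j < DIM('a)"
    "\<And>j x. j < DIM('b) \<Longrightarrow> L x \<bullet> (bs ! j) = x \<bullet> (as ! s j)" by metis
  have eq: "map (\<lambda>j. coords as x ! s j) [0..<DIM('b)] = coords bs (L x)" for x
    using s length_is_enum[OF as] length_is_enum[OF bs]
    by (intro nth_equalityI) (auto simp: coords_def)
  have "coords as ` {x. P (L x)}
      = {xs. length xs = DIM('a) \<and> map (\<lambda>j. xs ! s j) [0..<DIM('b)] \<in> coords bs ` {y. P y}}"
  proof (intro equalityI subsetI)
    fix xs assume "xs \<in> coords as ` {x. P (L x)}"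
    then show "xs \<in> {xs. length xs = DIM('a) \<and> map (\<lambda>j. xs ! s j) [0..<DIM('b)] \<in> coords bs ` {y. P y}}"
      using eq length_is_enum[OF as] by auto
  next
    fix xs assume xs: "xs \<in> {xs. length xs = DIM('a) \<and> map (\<lambda>j. xs ! s j) [0..<DIM('b)] \<in> coords bs ` {y. P y}}"
    then obtain x where x: "xs = coords as x"
      using coords_surj[OF as] length_is_enum[OF as] by auto
    then show "xs \<in> coords as ` {x. P (L x)}"
      using xs eq coords_inject[OF bs] by auto
  qed
  then show ?thesis using S_reindex[OF P s(1)] by simp
qed

lemma defpred_enum:
  fixes P :: "'a::euclidean_space \<Rightarrow> bool"
  assumes "defpred P" "is_enum bs"
  shows "coords bs ` {x. P x} \<in> S DIM('a)"
  using assms S_coordinate_vimage[OF coordinate_map_id, of _ P bs] unfolding defpred_def by blast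

lemma defpred_coordinate_vimage: "defpred P \<Longrightarrow> coordinate_map L \<Longrightarrow> defpred (\<lambda>x. P (L x))"
  using S_coordinate_vimage is_enum_exists unfolding defpred_def by metis

lemma defpred_conj: "defpred P \<Longrightarrow> defpred Q \<Longrightarrow> defpred (\<lambda>x. P x \<and> Q x)"
proof -
  assume P: "defpred P" and Q: "defpred Q"
  obtain bs :: "'a list" where bs: "is_enum bs" using is_enum_exists by blast
  have "coords bs ` {x. P x \<and> Q x} = coords bs ` {x. P x} \<inter> coords bs ` {x. Q x}"
    using coords_inject[OF bs] by auto
  then show ?thesis
    using defpred_enum[OF P bs] defpred_enum[OF Q bs] S_Int bs unfolding defpred_def by metis
qed

lemma defpred_not: "defpred P \<Longrightarrow> defpred (\<lambda>x. \<not> P x)"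
proof -
  assume P: "defpred P"
  obtain bs :: "'a list" where bs: "is_enum bs" using is_enum_exists by blast
  have "coords bs ` {x. \<not> P x} = {xs. length xs = DIM('a)} - coords bs ` {x. P x}"
    using coords_inject[OF bs] coords_surj[OF bs] length_is_enum[OF bs] by (force simp: image_iff)
  then show ?thesis
    using defpred_enum[OF P bs] S_Compl bs unfolding defpred_def by metis
qed

text \<open>If the basis of the product type is enumerated with the coordinates of y last, the
  quantifier becomes the projection in \<open>S_take\<close>.\<close>

lemma defpred_ex:
  fixes P :: "'a::euclidean_space \<Rightarrow> 'b::euclidean_space \<Rightarrow> bool"
  assumes "defpred (\<lambda>p. P (fst p) (snd p))"
  shows "defpred (\<lambda>x. \<exists>y. P x y)"
proof -
  obtain as :: "'a list" where as: "is_enum as" using is_enum_exists by blast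
  obtain bs :: "'b list" where bs: "is_enum bs" using is_enum_exists by blast
  let ?cs = "map (\<lambda>a. (a, 0)) as @ map (\<lambda>b. (0, b)) bs"
  have cs: "is_enum ?cs"
    using as bs unfolding is_enum_def
    by (auto simp: distinct_map inj_on_def Basis_prod_def)
  have c: "coords ?cs (x, y) = coords as x @ coords bs y" for x y
    by (simp add: coords_def)
  have "take DIM('a) ` (coords ?cs ` {p. P (fst p) (snd p)}) \<in> S DIM('a)"
    using defpred_enum[OF assms cs] by (intro S_take) simp
  moreover have "take DIM('a) ` (coords ?cs ` {p. P (fst p) (snd p)}) = coords as ` {x. \<exists>y. P x y}"
    using length_is_enum[OF as] c by (force simp: image_image image_iff)
  ultimately show ?thesis using as unfolding defpred_def by auto
qed

lemma defpred_const: "defpred (\<lambda>x::'a::euclidean_space. c)"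
proof -
  obtain bs :: "'a list" where bs: "is_enum bs" using is_enum_exists by blast
  have "coords bs ` UNIV = {xs. length xs = DIM('a)}"
    using coords_surj[OF bs] length_is_enum[OF bs] by (force simp: image_iff)
  then have T: "defpred (\<lambda>x::'a. True)"
    using bs S_full[of "DIM('a)"] unfolding defpred_def by auto
  then show ?thesis using defpred_not[OF T] by (cases c) auto
qed

lemma defpred_disj:
  assumes "defpred P" "defpred Q"
  shows "defpred (\<lambda>x. P x \<or> Q x)"
proof -
  have "defpred (\<lambda>x. \<not> (\<not> P x \<and> \<not> Q x))"
    by (intro defpred_not defpred_conj assms)
  then show ?thesis by simp
qed

lemma defpred_imp:
  assumes "defpred P" "defpred Q"
  shows "defpred (\<lambda>x. P x \<longrightarrow> Q x)"
proof -
  have "defpred (\<lambda>x. \<not> P x \<or> Q x)"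
    by (intro defpred_not defpred_disj assms)
  then show ?thesis by (simp only: imp_conv_disj)
qed

lemma defpred_all:
  assumes "defpred (\<lambda>p. P (fst p) (snd p))"
  shows "defpred (\<lambda>x. \<forall>y. P x y)"
proof -
  have "defpred (\<lambda>x. \<not> (\<exists>y. \<not> P x y))"
    by (intro defpred_not defpred_ex assms)
  then show ?thesis by simp
qed

lemma defpred_finite_all: "finite J \<Longrightarrow> (\<And>j. j \<in> J \<Longrightarrow> defpred (P j)) \<Longrightarrow> defpred (\<lambda>x. \<forall>j\<in>J. P j x)"
  by (induction J rule: finite_induct) (auto intro: defpred_const defpred_conj)

lemma defpred_eq_inner:
  assumes a: "a \<in> Basis" and b: "b \<in> Basis"
  shows "defpred (\<lambda>x::'a::euclidean_space. x \<bullet> a = x \<bullet> b)"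
proof -
  obtain bs :: "'a list" where bs: "is_enum bs" using is_enum_exists by blast
  obtain i j where i: "i < length bs" "bs ! i = a" and j: "j < length bs" "bs ! j = b"
    using a b bs by (metis in_set_conv_nth is_enum_def)
  have "coords bs ` {x. x \<bullet> a = x \<bullet> b} = {xs. length xs = DIM('a) \<and> xs ! i = xs ! j}"
  proof (intro equalityI subsetI)
    fix xs :: "real list" assume "xs \<in> {xs. length xs = DIM('a) \<and> xs ! i = xs ! j}"
    then show "xs \<in> coords bs ` {x. x \<bullet> a = x \<bullet> b}"
      using coords_surj[OF bs, of xs] length_is_enum[OF bs] i j by (auto simp: coords_def)
  qed (use i j length_is_enum[OF bs] in \<open>auto simp: coords_def\<close>)
  then show ?thesis
    using S_diag i j bs length_is_enum[OF bs] unfolding defpred_def by auto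
qed

lemma defpred_eq_coordinate:
  fixes L M :: "'a::euclidean_space \<Rightarrow> 'b::euclidean_space"
  assumes "coordinate_map L" "coordinate_map M"
  shows "defpred (\<lambda>x. L x = M x)"
proof -
  have "defpred (\<lambda>x. L x \<bullet> b = M x \<bullet> b)" if "b \<in> Basis" for b
  proof -
    have "coordinate_map (\<lambda>x. L x \<bullet> b)" "coordinate_map (\<lambda>x. M x \<bullet> b)"
      using assms that by (auto intro: coordinate_map_inner)
    then obtain a a' where "a \<in> Basis" "a' \<in> Basis"
      "\<And>x. L x \<bullet> b = x \<bullet> a" "\<And>x. M x \<bullet> b = x \<bullet> a'"
      unfolding coordinate_map_def by auto
    then show ?thesis using defpred_eq_inner[of a a'] by simp
  qed
  then have "defpred (\<lambda>x. \<forall>b\<in>Basis. L x \<bullet> b = M x \<bullet> b)"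
    by (intro defpred_finite_all) auto
  then show ?thesis by (simp flip: euclidean_eq_iff)
qed

lemma deffun_coordinate: "coordinate_map L \<Longrightarrow> deffun L"
  unfolding deffun_def
  by (intro defpred_eq_coordinate coordinate_map_snd coordinate_map_comp[of L fst] coordinate_map_fst)

text \<open>Substitution is a quantifier over the value,
  \<open>\<exists>y. y = g x \<and> P y\<close>, so the graph of g is all that has to be
  known.\<close>

lemma defpred_compose:
  assumes P: "defpred P" and g: "deffun g"
  shows "defpred (\<lambda>x. P (g x))"
proof -
  have "defpred (\<lambda>x. \<exists>y. y = g x \<and> P y)"
    using g by (intro defpred_ex defpred_conj defpred_coordinate_vimage[OF P coordinate_map_snd]) (simp add: deffun_def)
  then show ?thesis by simp
qed

lemma deffun_compose:
  assumes h: "deffun h" and g: "deffun g"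
  shows "deffun (\<lambda>x. h (g x))"
proof -
  have "defpred (\<lambda>p. \<exists>y. y = g (fst p) \<and> snd p = h y)"
  proof (intro defpred_ex defpred_conj)
    show "defpred (\<lambda>p. snd p = g (fst (fst p)))"
      using defpred_coordinate_vimage[OF g[unfolded deffun_def], of "\<lambda>p. (fst (fst p), snd p)"]
      by (simp add: coordinate_map_Pair coordinate_map_snd coordinate_map_comp[of fst fst] coordinate_map_fst)
    show "defpred (\<lambda>p. snd (fst p) = h (snd p))"
      using defpred_coordinate_vimage[OF h[unfolded deffun_def], of "\<lambda>p. (snd p, snd (fst p))"]
      by (simp add: coordinate_map_Pair coordinate_map_snd coordinate_map_comp[of snd fst] coordinate_map_fst)
  qed
  then show ?thesis by (simp add: deffun_def)
qed

lemma deffun_id: "deffun (\<lambda>x. x)"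
  by (intro deffun_coordinate coordinate_map_id)

lemma deffun_fst: "deffun g \<Longrightarrow> deffun (\<lambda>x. fst (g x))"
  by (rule deffun_compose[OF deffun_coordinate[OF coordinate_map_fst]])

lemma deffun_snd: "deffun g \<Longrightarrow> deffun (\<lambda>x. snd (g x))"
  by (rule deffun_compose[OF deffun_coordinate[OF coordinate_map_snd]])

lemma deffun_inner_Basis: "deffun g \<Longrightarrow> b \<in> Basis \<Longrightarrow> deffun (\<lambda>x. g x \<bullet> b)"
  by (rule deffun_compose[OF deffun_coordinate[OF coordinate_map_inner[OF coordinate_map_id]]])

lemma deffun_Pair:
  assumes g: "deffun g" and h: "deffun h"
  shows "deffun (\<lambda>x. (g x, h x))"
proof -
  have "defpred (\<lambda>p. fst (snd p) = g (fst p) \<and> snd (snd p) = h (fst p))"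
  proof (rule defpred_conj)
    show "defpred (\<lambda>p. fst (snd p) = g (fst p))"
      using defpred_coordinate_vimage[OF g[unfolded deffun_def], of "\<lambda>p. (fst p, fst (snd p))"]
      by (simp add: coordinate_map_Pair coordinate_map_fst coordinate_map_comp[of fst snd] coordinate_map_snd)
    show "defpred (\<lambda>p. snd (snd p) = h (fst p))"
      using defpred_coordinate_vimage[OF h[unfolded deffun_def], of "\<lambda>p. (fst p, snd (snd p))"]
      by (simp add: coordinate_map_Pair coordinate_map_fst coordinate_map_comp[of snd snd] coordinate_map_snd)
  qed
  moreover have "(fst (snd p) = g (fst p) \<and> snd (snd p) = h (fst p)) = (snd p = (g (fst p), h (fst p)))"
    for p :: "'a \<times> 'b \<times> 'c"
    by (cases p) auto
  ultimately show ?thesis unfolding deffun_def by simp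
qed

lemma defpred_eq:
  fixes g h :: "'a::euclidean_space \<Rightarrow> 'b::euclidean_space"
  assumes "deffun g" "deffun h"
  shows "defpred (\<lambda>x. g x = h x)"
  using defpred_compose[OF defpred_eq_coordinate[OF coordinate_map_fst coordinate_map_snd] deffun_Pair[OF assms]]
  by simp

lemma is_enum_real: "is_enum [1::real]"
  by (simp add: is_enum_def)

lemma defpred_real_iff: "defpred (P::real \<Rightarrow> bool) \<longleftrightarrow> (\<lambda>x. [x]) ` {x. P x} \<in> S 1"
  using defpred_enum[OF _ is_enum_real, of P] is_enum_real
  unfolding defpred_def by (auto simp: coords_def)

lemma defpred_real:
  fixes P :: "real \<Rightarrow> bool"
  shows "defpred P \<longleftrightarrow> (\<exists>\<J>. finite \<J> \<and> (\<forall>J\<in>\<J>. (open J \<and> is_interval J) \<or> (\<exists>x. J = {x})) \<and> {x. P x} = \<Union>\<J>)"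
proof -
  have "inj (\<lambda>x::real. [x])" by (auto intro: injI)
  then have "(\<lambda>x. [x]) ` {x. P x} = (\<lambda>x. [x]) ` A \<longleftrightarrow> {x. P x} = A" for A
    by (simp add: inj_image_eq_iff)
  then show ?thesis unfolding defpred_real_iff S1 by auto
qed

lemma deffun_const: "deffun (\<lambda>x::'a::euclidean_space. c::'b::euclidean_space)"
proof -
  have r: "defpred (\<lambda>t::real. t = r)" for r
    unfolding defpred_real by (rule exI[of _ "{{r}}"]) auto
  have "defpred (\<lambda>p::'a \<times> 'b. snd p \<bullet> b = c \<bullet> b)" if "b \<in> Basis" for b
    by (rule defpred_compose[OF r deffun_inner_Basis[OF deffun_snd[OF deffun_id] that]])
  then have "defpred (\<lambda>p::'a \<times> 'b. \<forall>b\<in>Basis. snd p \<bullet> b = c \<bullet> b)"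
    by (intro defpred_finite_all) auto
  then show ?thesis unfolding deffun_def by (simp flip: euclidean_eq_iff)
qed

lemma is_enum_real3: "is_enum [(1::real, 0::real, 0::real), (0, 1, 0), (0, 0, 1)]"
  by (auto simp: is_enum_def Basis_prod_def zero_prod_def)

lemma defpred_S3:
  assumes "{[x, y, z] |x y z. P x y z} \<in> S 3"
  shows "defpred (\<lambda>(x, y, z). P x y z)"
proof -
  let ?bs = "[(1::real, 0::real, 0::real), (0, 1, 0), (0, 0, 1)]"
  have c: "coords ?bs ` {p. case p of (x, y, z) \<Rightarrow> P x y z} = {[x, y, z] |x y z. P x y z}"
    by (force simp: coords_def image_iff)
  have d: "DIM(real \<times> real \<times> real) = 3" by simp
  have "coords ?bs ` {p. case p of (x, y, z) \<Rightarrow> P x y z} \<in> S DIM(real \<times> real \<times> real)"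
    unfolding c d by (rule assms)
  then show ?thesis
    unfolding defpred_def by (intro exI[of _ ?bs] conjI is_enum_real3)
qed

lemma deffun_add_real:
  fixes g h :: "'a::euclidean_space \<Rightarrow> real"
  assumes g: "deffun g" and h: "deffun h"
  shows "deffun (\<lambda>x. g x + h x)"
proof -
  have a: "{[x, y, z] |x y z. z = x + y} \<in> S 3"
    using S_add by simp
  have b: "deffun (\<lambda>p. (g (fst p), h (fst p), snd p))"
    by (intro deffun_Pair deffun_compose[OF g] deffun_compose[OF h] deffun_fst deffun_snd deffun_id)
  show ?thesis
    using defpred_compose[OF defpred_S3[OF a] b] unfolding deffun_def by simp
qed

lemma deffun_mult:
  fixes g h :: "'a::euclidean_space \<Rightarrow> real"
  assumes g: "deffun g" and h: "deffun h"
  shows "deffun (\<lambda>x. g x * h x)"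
proof -
  have a: "{[x, y, z] |x y z. z = x * y} \<in> S 3"
    using S_mult by simp
  have b: "deffun (\<lambda>p. (g (fst p), h (fst p), snd p))"
    by (intro deffun_Pair deffun_compose[OF g] deffun_compose[OF h] deffun_fst deffun_snd deffun_id)
  show ?thesis
    using defpred_compose[OF defpred_S3[OF a] b] unfolding deffun_def by simp
qed

lemma deffun_sum_real:
  fixes g :: "'i \<Rightarrow> 'a::euclidean_space \<Rightarrow> real"
  shows "(\<And>i. i \<in> I \<Longrightarrow> deffun (g i)) \<Longrightarrow> deffun (\<lambda>x. \<Sum>i\<in>I. g i x)"
  by (induction I rule: infinite_finite_induct) (auto intro: deffun_const deffun_add_real)

lemma deffun_componentwise:
  fixes g :: "'a::euclidean_space \<Rightarrow> 'b::euclidean_space"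
  assumes "\<And>b. b \<in> Basis \<Longrightarrow> deffun (\<lambda>x. g x \<bullet> b)"
  shows "deffun g"
proof -
  have "defpred (\<lambda>p::'a \<times> 'b. \<forall>b\<in>Basis. snd p \<bullet> b = g (fst p) \<bullet> b)"
    by (intro defpred_finite_all defpred_eq deffun_inner_Basis deffun_snd deffun_id
        deffun_compose[OF assms] deffun_fst finite_Basis)
  then show ?thesis unfolding deffun_def by (simp flip: euclidean_eq_iff)
qed

lemma deffun_add:
  fixes g h :: "'a::euclidean_space \<Rightarrow> 'b::euclidean_space"
  shows "deffun g \<Longrightarrow> deffun h \<Longrightarrow> deffun (\<lambda>x. g x + h x)"
  by (rule deffun_componentwise) (simp add: inner_add_left deffun_add_real deffun_inner_Basis)

lemma deffun_scaleR:
  fixes h :: "'a::euclidean_space \<Rightarrow> 'b::euclidean_space"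
  shows "deffun g \<Longrightarrow> deffun h \<Longrightarrow> deffun (\<lambda>x. g x *\<^sub>R h x)"
  by (rule deffun_componentwise) (simp add: deffun_mult deffun_inner_Basis)

lemma deffun_uminus:
  fixes g :: "'a::euclidean_space \<Rightarrow> 'b::euclidean_space"
  shows "deffun g \<Longrightarrow> deffun (\<lambda>x. - g x)"
  using deffun_scaleR[OF deffun_const[of "-1"], of g] by simp

lemma deffun_diff:
  fixes g h :: "'a::euclidean_space \<Rightarrow> 'b::euclidean_space"
  shows "deffun g \<Longrightarrow> deffun h \<Longrightarrow> deffun (\<lambda>x. g x - h x)"
  using deffun_add[OF _ deffun_uminus, of g h] by simp

lemma deffun_inner:
  fixes g h :: "'a::euclidean_space \<Rightarrow> 'b::euclidean_space"
  assumes "deffun g" "deffun h"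
  shows "deffun (\<lambda>x. g x \<bullet> h x)"
proof -
  have "deffun (\<lambda>x. \<Sum>b\<in>Basis. (g x \<bullet> b) * (h x \<bullet> b))"
    using assms by (intro deffun_sum_real deffun_mult deffun_inner_Basis)
  then show ?thesis by (simp flip: euclidean_inner)
qed

lemma defpred_le:
  fixes g h :: "'a::euclidean_space \<Rightarrow> real"
  assumes "deffun g" "deffun h"
  shows "defpred (\<lambda>x. g x \<le> h x)"
proof -
  \<comment> \<open>The order enters through \<open>S 1\<close>: the closed half-line is a point
    together with an open ray.\<close>
  have "defpred (\<lambda>t::real. 0 \<le> t)"
    unfolding defpred_real by (rule exI[of _ "{{0}, {0<..}}"]) (auto simp: is_interval_def)
  from defpred_compose[OF this deffun_diff[OF assms(2,1)]] show ?thesis by simp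
qed

lemma defpred_less:
  fixes g h :: "'a::euclidean_space \<Rightarrow> real"
  assumes "deffun g" "deffun h"
  shows "defpred (\<lambda>x. g x < h x)"
  using defpred_not[OF defpred_le[OF assms(2,1)]] by (simp add: not_le)

lemma deffun_norm:
  fixes g :: "'a::euclidean_space \<Rightarrow> 'b::euclidean_space"
  assumes "deffun g"
  shows "deffun (\<lambda>x. norm (g x))"
proof -
  have "defpred (\<lambda>p::'a \<times> real. 0 \<le> snd p \<and> snd p * snd p = g (fst p) \<bullet> g (fst p))"
    by (intro defpred_conj defpred_le defpred_eq deffun_mult deffun_inner deffun_snd deffun_const deffun_id
        deffun_compose[OF assms] deffun_fst)
  moreover have "(0 \<le> t \<and> t * t = y \<bullet> y) = (t = norm y)" for t :: real and y :: 'b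
    by (metis dot_square_norm norm_ge_zero power2_eq_square power2_eq_iff_nonneg)
  ultimately show ?thesis unfolding deffun_def by simp
qed

lemma deffun_abs: "deffun (g :: 'a::euclidean_space \<Rightarrow> real) \<Longrightarrow> deffun (\<lambda>x. \<bar>g x\<bar>)"
  using deffun_norm[of g] by simp

lemma defpred_Ball: "defpred (\<lambda>p. snd p \<in> A (fst p) \<longrightarrow> P (fst p) (snd p)) \<Longrightarrow> defpred (\<lambda>x. \<forall>y\<in>A x. P x y)"
  using defpred_all[of "\<lambda>x y. y \<in> A x \<longrightarrow> P x y"] by (simp add: Ball_def)

lemma defpred_Bex: "defpred (\<lambda>p. snd p \<in> A (fst p) \<and> P (fst p) (snd p)) \<Longrightarrow> defpred (\<lambda>x. \<exists>y\<in>A x. P x y)"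
  using defpred_ex[of "\<lambda>x y. y \<in> A x \<and> P x y"] by (simp add: Bex_def)

lemma defpred_iff: "defpred P \<Longrightarrow> defpred Q \<Longrightarrow> defpred (\<lambda>x. P x \<longleftrightarrow> Q x)"
  using defpred_conj[OF defpred_imp[of P Q] defpred_imp[of Q P]] by (simp add: iff_conv_conj_imp)

abbreviation defset :: "'a::euclidean_space set \<Rightarrow> bool" where
  "defset A \<equiv> defpred (\<lambda>x. x \<in> A)"

lemma defpred_mem: "defset A \<Longrightarrow> deffun g \<Longrightarrow> defpred (\<lambda>x. g x \<in> A)"
  by (rule defpred_compose)

text \<open>The rules mirror the syntax of first-order formulas over the ordered field, so
  definability goals are decomposed structurally down to the given definable functions and
  sets.\<close>

lemmas defpred_logic = defpred_conj defpred_disj defpred_imp defpred_not defpred_const defpred_iff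
lemmas defpred_intros = defpred_logic defpred_Ball defpred_Bex defpred_all defpred_ex defpred_eq defpred_le defpred_less
  deffun_norm deffun_abs deffun_inner deffun_mult deffun_scaleR deffun_diff deffun_add deffun_uminus deffun_Pair
  deffun_fst deffun_snd deffun_const deffun_id

end

section \<open>Definable sets and Baire category\<close>

text \<open>Otherwise the complements of the closures of \<open>A k \<inter> W\<close> would be
  countably many dense open sets, and some point of W would lie in all of them. Density in an open
  set is all that category gives; \<open>defpred_dense_cylinder\<close> turns it into
  interior.\<close>

lemma Baire_cover:
  fixes W :: "'a::euclidean_space set"
  assumes "open W" "W \<noteq> {}" "countable K" "W \<subseteq> (\<Union>k\<in>K. A k)"
  shows "\<exists>k\<in>K. \<exists>V. open V \<and> V \<noteq> {} \<and> V \<subseteq> W \<and> V \<subseteq> closure (A k)"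
proof (rule ccontr)
  assume none: "\<not> ?thesis"
  have dense: "closure (- closure (A k \<inter> W)) = UNIV" if "k \<in> K" for k
  proof (rule ccontr)
    assume "closure (- closure (A k \<inter> W)) \<noteq> UNIV"
    then have "interior (closure (A k \<inter> W)) \<noteq> {}" (is "?V \<noteq> {}")
      by (auto simp: closure_complement)
    moreover have "?V \<subseteq> closure W"
      by (meson closure_mono inf_le2 interior_subset order_trans)
    ultimately have "?V \<inter> W \<noteq> {}"
      by (metis open_Int_closure_eq_empty open_interior inf.absorb1)
    moreover have "?V \<inter> W \<subseteq> closure (A k)"
      by (meson closure_mono inf_le1 interior_subset order_trans)
    ultimately show False
      using none that assms(1) by (metis inf_le2 open_Int open_interior)
  qed
  have "UNIV \<subseteq> closure (\<Inter>((\<lambda>k. - closure (A k \<inter> W)) ` K))"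
    using assms(3) dense by (intro Baire) auto
  then have "W \<inter> \<Inter>((\<lambda>k. - closure (A k \<inter> W)) ` K) \<noteq> {}"
    using assms(1,2) open_Int_closure_eq_empty by fastforce
  then obtain x where x: "x \<in> W" "\<And>k. k \<in> K \<Longrightarrow> x \<notin> closure (A k \<inter> W)" by blast
  moreover obtain k where "k \<in> K" "x \<in> A k" using x(1) assms(4) by blast
  ultimately show False using closure_subset by blast
qed

text \<open>Instead of projecting to coordinate subspaces, points are compared by the coordinates in \<open>I\<close>, so
  that inductions on the dimension stay within one type.\<close>

definition agree :: "'a::euclidean_space set \<Rightarrow> 'a \<Rightarrow> 'a \<Rightarrow> bool" where
  "agree I x y \<longleftrightarrow> (\<forall>i\<in>I. x \<bullet> i = y \<bullet> i)"

definition set_coord :: "'a::euclidean_space \<Rightarrow> 'a \<Rightarrow> real \<Rightarrow> 'a" where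
  "set_coord x i t = x + (t - x \<bullet> i) *\<^sub>R i"

lemma set_coord_inner: "i \<in> Basis \<Longrightarrow> j \<in> Basis \<Longrightarrow> set_coord x i t \<bullet> j = (if i = j then t else x \<bullet> j)"
  by (simp add: set_coord_def inner_add_left inner_Basis)

lemma set_coord_set_coord: "i \<in> Basis \<Longrightarrow> set_coord (set_coord x i s) i t = set_coord x i t"
  by (rule euclidean_eqI) (simp add: set_coord_inner)

lemma set_coord_same: "i \<in> Basis \<Longrightarrow> set_coord x i (x \<bullet> i) = x"
  by (simp add: set_coord_def)

lemma continuous_set_coord: "continuous_on UNIV (\<lambda>x. set_coord x i t)"
  unfolding set_coord_def by (intro continuous_intros)

text \<open>For \<open>I = Basis\<close> every set qualifies, for \<open>I = {}\<close> only the
  empty set and the whole space; these are the two ends of the induction in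
  \<open>defpred_dense_cylinder\<close>.\<close>

definition cylinder :: "'a::euclidean_space set \<Rightarrow> 'a set \<Rightarrow> bool" where
  "cylinder I A \<longleftrightarrow> (\<forall>x\<in>A. \<forall>y. agree I x y \<longrightarrow> y \<in> A)"

text \<open>Real induction. By continuity the times at which the bound holds form a compact set, and
  its largest element must be b, since the local hypothesis would push an earlier one to the right.
  The hypothesis is a one-sided comparison for all small h, the form that definability
  supplies.\<close>

lemma creeping:
  fixes F :: "real \<Rightarrow> real"
  assumes "a \<le> b" "continuous_on {a..b} F"
    and loc: "\<And>t. a \<le> t \<Longrightarrow> t < b \<Longrightarrow> \<forall>\<^sub>F h in at_right 0. F t + q * h \<le> F (t + h)"
  shows "q * (b - a) \<le> F b - F a"
proof -
  let ?T = "{a..b} \<inter> (\<lambda>t. F t - q * t) -` {F a - q * a..}"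
  have "closed ?T"
    by (intro continuous_closed_preimage continuous_intros assms(2))
  moreover have "bounded ?T" by (rule bounded_subset[of "{a..b}"]) auto
  ultimately have "compact ?T" by (simp add: compact_eq_bounded_closed)
  moreover have "a \<in> ?T" using assms(1) by simp
  ultimately obtain c where c: "c \<in> ?T" "\<And>t. t \<in> ?T \<Longrightarrow> t \<le> c"
    using compact_attains_sup[of ?T] by blast
  have "c = b"
  proof (rule ccontr)
    assume "c \<noteq> b"
    then have cb: "a \<le> c" "c < b" using c by auto
    have "\<forall>\<^sub>F h in at_right (0::real). h < b - c"
      using cb by (intro eventually_at_rightI[of 0 "b - c"]) auto
    with loc[OF cb] have "\<forall>\<^sub>F h in at_right 0. F c + q * h \<le> F (c + h) \<and> h < b - c \<and> 0 < h"
      by (intro eventually_conj eventually_at_right_less) auto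
    then obtain h where "F c + q * h \<le> F (c + h)" "h < b - c" "0 < h"
      using eventually_happens'[OF trivial_limit_at_right_real] by blast
    then have "c + h \<in> ?T" using c(1) by (simp add: algebra_simps)
    then show False using c(2) \<open>0 < h\<close> by fastforce
  qed
  then show ?thesis using c(1) by (simp add: algebra_simps)
qed

lemma creeping_left:
  fixes F :: "real \<Rightarrow> real"
  assumes "a \<le> b" "continuous_on {a..b} F"
    and loc: "\<And>t. a < t \<Longrightarrow> t \<le> b \<Longrightarrow> \<forall>\<^sub>F h in at_right 0. F t + q * h \<le> F (t - h)"
  shows "q * (b - a) \<le> F a - F b"
proof -
  have "continuous_on {-b..-a} (\<lambda>t. F (- t))"
    by (intro continuous_on_compose2[OF assms(2)] continuous_intros) auto
  from creeping[OF _ this, of q] assms(1) loc show ?thesis by fastforce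
qed

section \<open>From density to interior for definable sets\<close>

context omin
begin

text \<open>A definable property of a real variable cannot oscillate: an interval that meets every
  (a, b) contains some (a, c), and only finitely many intervals and points are involved. Most uses
  of o-minimality below are instances of this dichotomy, often in the form that the failure of a
  bound is the opposite bound for all small h.\<close>

lemma defpred_eventually:
  fixes P :: "real \<Rightarrow> bool"
  assumes "defpred P"
  shows "(\<forall>\<^sub>F t in at_right a. P t) \<or> (\<forall>\<^sub>F t in at_right a. \<not> P t)"
proof -
  obtain \<J> where J: "finite \<J>" "\<forall>J\<in>\<J>. (open J \<and> is_interval J) \<or> (\<exists>x. J = {x})" "{x. P x} = \<Union>\<J>"
    using assms unfolding defpred_real by blast
  have P: "P t \<longleftrightarrow> (\<exists>J\<in>\<J>. t \<in> J)" for t using J(3) by blast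
  have one: "(\<forall>\<^sub>F t in at_right a. t \<in> J) \<or> (\<forall>\<^sub>F t in at_right a. t \<notin> J)" if "J \<in> \<J>" for J
  proof (rule disjCI)
    have "(open J \<and> is_interval J) \<or> (\<exists>x. J = {x})" using J(2) that by blast
    then have iv: "is_interval J" by (elim disjE exE) (simp, simp add: is_interval_def)
    assume "\<not> (\<forall>\<^sub>F t in at_right a. t \<notin> J)"
    then have freq: "\<exists>t\<in>J. a < t \<and> t < b" if "a < b" for b
      using that unfolding eventually_at_right[OF that] by blast
    obtain b where b: "b \<in> J" "a < b" using freq[of "a + 1"] by auto
    have "t \<in> J" if t: "a < t" "t < b" for t
    proof -
      obtain s where "s \<in> J" "a < s" "s < t" using freq[OF t(1)] by blast
      then show ?thesis using iv b t unfolding is_interval_1 by (meson less_imp_le)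
    qed
    then show "\<forall>\<^sub>F t in at_right a. t \<in> J"
      using b(2) by (intro eventually_at_rightI[of a b]) auto
  qed
  show ?thesis
  proof (cases "\<exists>J\<in>\<J>. \<forall>\<^sub>F t in at_right a. t \<in> J")
    case True
    then show ?thesis unfolding P by (auto elim: eventually_mono)
  next
    case False
    then have "\<forall>\<^sub>F t in at_right a. \<forall>J\<in>\<J>. t \<notin> J"
      using one J(1) by (intro eventually_ball_finite) auto
    then show ?thesis unfolding P by auto
  qed
qed

text \<open>An infinite union of finitely many points and open intervals has a nonempty open member.
  Rational endpoints keep the possibilities countable, as Baire's theorem requires.\<close>

lemma defpred_infinite:
  fixes P :: "real \<Rightarrow> bool"
  assumes "defpred P" "infinite {t. P t}"
  shows "\<exists>p\<in>\<rat>. \<exists>q\<in>\<rat>. p < q \<and> (\<forall>t. p < t \<and> t < q \<longrightarrow> P t)"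
proof -
  obtain \<J> where J: "finite \<J>" "\<forall>J\<in>\<J>. (open J \<and> is_interval J) \<or> (\<exists>x. J = {x})" "{x. P x} = \<Union>\<J>"
    using assms unfolding defpred_real by blast
  obtain J where "J \<in> \<J>" "infinite J"
    using J(1,3) assms(2) by (metis finite_Union)
  then have "open J" using J(2) by force
  obtain t where "t \<in> J" using \<open>infinite J\<close> by fastforce
  then obtain e where e: "e > 0" "ball t e \<subseteq> J" using \<open>open J\<close> open_contains_ball by blast
  obtain p where p: "p \<in> \<rat>" "t - e < p" "p < t" using Rats_dense_in_real[of "t - e" t] e by auto
  obtain q where q: "q \<in> \<rat>" "t < q" "q < t + e" using Rats_dense_in_real[of t "t + e"] e by auto
  have "s \<in> ball t e" if "p < s" "s < q" for s using that p q by (auto simp: dist_real_def)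
  then have "P s" if "p < s" "s < q" for s using that e(2) \<open>J \<in> \<J>\<close> J(3) by blast
  then show ?thesis using p q by (intro bexI[of _ p] bexI[of _ q]) auto
qed

lemma defpred_split_interval:
  fixes P :: "real \<Rightarrow> bool"
  assumes "defpred P" "a < b"
  shows "\<exists>p\<in>\<rat>. \<exists>q\<in>\<rat>. a < p \<and> p < q \<and> q < b \<and>
    ((\<forall>t. p < t \<and> t < q \<longrightarrow> P t) \<or> (\<forall>t. p < t \<and> t < q \<longrightarrow> \<not> P t))"
proof -
  have "\<exists>c>a. (\<forall>t. a < t \<and> t < c \<longrightarrow> P t) \<or> (\<forall>t. a < t \<and> t < c \<longrightarrow> \<not> P t)"
    using defpred_eventually[OF assms(1), of a] unfolding eventually_at_right_field by auto
  then obtain c where c: "c > a" "(\<forall>t. a < t \<and> t < c \<longrightarrow> P t) \<or> (\<forall>t. a < t \<and> t < c \<longrightarrow> \<not> P t)"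
    by blast
  obtain p where p: "p \<in> \<rat>" "a < p" "p < min b c" using Rats_dense_in_real[of a "min b c"] assms(2) c(1) by auto
  obtain q where q: "q \<in> \<rat>" "p < q" "q < min b c" using Rats_dense_in_real[of p "min b c"] p by auto
  show ?thesis using c(2) p q by (intro bexI[of _ p] bexI[of _ q]) auto
qed

lemma deffun_set_coord: "deffun g \<Longrightarrow> deffun h \<Longrightarrow> deffun (\<lambda>x. set_coord (g x) i (h x))"
  unfolding set_coord_def by (intro defpred_intros)

text \<open>On each line in direction i, membership in \<open>A\<close> is constant on some rational
  interval. For one triple (p, q, c), the points whose line has the value c on (p, q) are dense in
  an open set; they form a cylinder over one coordinate fewer and so contain an open set by
  induction. There membership in \<open>A\<close> is constantly c, and density of \<open>A\<close>
  rules out \<open>c = False\<close>.\<close>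

lemma defpred_dense_cylinder:
  fixes A :: "'a::euclidean_space set"
  assumes "finite I" "I \<subseteq> Basis" "defset A" "cylinder I A" "open W" "W \<noteq> {}" "W \<subseteq> closure A"
  shows "\<exists>V. open V \<and> V \<noteq> {} \<and> V \<subseteq> W \<and> V \<subseteq> A"
  using assms
proof (induction I arbitrary: A W rule: finite_induct)
  case empty
  then have "A \<noteq> {}" by auto
  then have "A = UNIV" using empty by (auto simp: cylinder_def agree_def)
  then show ?case using empty by blast
next
  case (insert i I)
  have i: "i \<in> Basis" using insert by auto
  obtain w where "w \<in> W" using insert.prems by blast
  then obtain a b where ab: "w \<in> box a b" "box a b \<subseteq> W"
    using open_contains_box[OF insert.prems(4)] by metis
  let ?K = "{(p, q, c::bool). p \<in> \<rat> \<and> q \<in> \<rat> \<and> a \<bullet> i < p \<and> p < q \<and> q < b \<bullet> i}"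
  let ?B = "\<lambda>(p, q, c). {x. \<forall>t. p < t \<and> t < q \<longrightarrow> (set_coord x i t \<in> A) = c}"
  have "countable (\<rat> \<times> \<rat> \<times> (UNIV :: bool set))"
    by (intro countable_SIGMA countable_rat) auto
  then have "countable ?K" by (rule countable_subset[rotated]) auto
  have "box a b \<subseteq> (\<Union>k\<in>?K. ?B k)"
  proof
    fix x assume x: "x \<in> box a b"
    have "defpred (\<lambda>t. set_coord x i t \<in> A)"
      by (intro defpred_mem[OF insert.prems(2)] deffun_set_coord deffun_const deffun_id)
    moreover have "a \<bullet> i < b \<bullet> i" using ab(1) i by (force simp: mem_box)
    ultimately obtain p q where "p \<in> \<rat>" "q \<in> \<rat>" "a \<bullet> i < p" "p < q" "q < b \<bullet> i"
      "(\<forall>t. p < t \<and> t < q \<longrightarrow> set_coord x i t \<in> A) \<or> (\<forall>t. p < t \<and> t < q \<longrightarrow> set_coord x i t \<notin> A)"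
      using defpred_split_interval[of "\<lambda>t. set_coord x i t \<in> A" "a \<bullet> i" "b \<bullet> i"] by metis
    then show "x \<in> (\<Union>k\<in>?K. ?B k)"
      by (elim disjE) (auto intro!: bexI[of _ "(p, q, True)"] bexI[of _ "(p, q, False)"])
  qed
  moreover have "box a b \<noteq> {}" using ab by blast
  ultimately obtain k V where k: "k \<in> ?K" and V: "open V" "V \<noteq> {}" "V \<subseteq> box a b" "V \<subseteq> closure (?B k)"
    using Baire_cover[OF open_box[of a b] _ \<open>countable ?K\<close>, of ?B] by blast
  obtain p q c where kk: "k = (p, q, c)" by (cases k)
  have pq: "a \<bullet> i < p" "p < q" "q < b \<bullet> i" using k kk by auto
  have "defset (?B k)"
    unfolding kk by (simp, intro defpred_intros defpred_mem[OF insert.prems(2)] deffun_set_coord)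
  moreover have "cylinder I (?B k)"
  proof -
    have "set_coord x i t \<in> A \<longleftrightarrow> set_coord y i t \<in> A" if "agree I x y" for x y t
    proof -
      have "agree (insert i I) (set_coord x i t) (set_coord y i t)" "agree (insert i I) (set_coord y i t) (set_coord x i t)"
        using that insert.prems(1) by (auto simp: agree_def set_coord_inner subset_iff)
      then show ?thesis using insert.prems(3) unfolding cylinder_def by blast
    qed
    then show ?thesis unfolding kk cylinder_def by (simp only: mem_Collect_eq prod.case) blast
  qed
  ultimately obtain V' where V': "open V'" "V' \<noteq> {}" "V' \<subseteq> V" "V' \<subseteq> ?B k"
    using insert.IH[of "?B k" V] V insert.prems(1) by blast
  obtain x0 where x0: "x0 \<in> V'" using V' by blast
  \<comment> \<open>Points of \<open>V'\<close> only give information about their lines. So take all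
    points with i-th coordinate in (p, q) whose line meets \<open>V'\<close> at the height of
    \<open>x0\<close>; this set is open, and on it membership in \<open>A\<close> is known.\<close>
  let ?U = "{y. set_coord y i (x0 \<bullet> i) \<in> V'} \<inter> {y. p < y \<bullet> i \<and> y \<bullet> i < q}"
  have "open ?U"
  proof (intro open_Int)
    show "open {y. set_coord y i (x0 \<bullet> i) \<in> V'}"
      using open_vimage[OF V'(1) continuous_set_coord] by (simp add: vimage_def)
    show "open {y. p < y \<bullet> i \<and> y \<bullet> i < q}"
      by (intro open_Collect_conj open_Collect_less continuous_intros)
  qed
  have "set_coord x0 i ((p + q) / 2) \<in> ?U"
    using x0 pq i by (auto simp: set_coord_set_coord set_coord_same set_coord_inner field_simps)
  then have "?U \<noteq> {}" by blast
  have "?U \<subseteq> box a b"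
  proof
    fix y assume y: "y \<in> ?U"
    then have u: "set_coord y i (x0 \<bullet> i) \<in> box a b" using V' V by auto
    show "y \<in> box a b"
      unfolding mem_box
    proof
      fix j :: 'a assume j: "j \<in> Basis"
      have "a \<bullet> j < set_coord y i (x0 \<bullet> i) \<bullet> j" "set_coord y i (x0 \<bullet> i) \<bullet> j < b \<bullet> j"
        using u j unfolding mem_box by blast+
      then show "a \<bullet> j < y \<bullet> j \<and> y \<bullet> j < b \<bullet> j"
        using y pq set_coord_inner[OF i j, of y "x0 \<bullet> i"] by (cases "i = j") auto
    qed
  qed
  then have UW: "?U \<subseteq> W" using ab by blast
  have c: "(y \<in> A) = c" if "y \<in> ?U" for y
  proof -
    have "set_coord y i (x0 \<bullet> i) \<in> ?B k" using that V' by blast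
    then have "(set_coord (set_coord y i (x0 \<bullet> i)) i (y \<bullet> i) \<in> A) = c"
      using that kk by auto
    then show ?thesis using i by (simp add: set_coord_set_coord set_coord_same)
  qed
  have c
  proof (rule ccontr)
    assume "\<not> c"
    then have "?U \<inter> A = {}" using c by blast
    then have "?U \<inter> closure A = {}" using \<open>open ?U\<close> open_Int_closure_eq_empty by blast
    then show False using UW insert.prems(6) \<open>?U \<noteq> {}\<close> by blast
  qed
  then show ?case using c UW \<open>open ?U\<close> \<open>?U \<noteq> {}\<close> by blast
qed

lemma defset_Baire:
  fixes W :: "'a::euclidean_space set"
  assumes "open W" "W \<noteq> {}" "countable K" "W \<subseteq> (\<Union>k\<in>K. A k)" "\<And>k. k \<in> K \<Longrightarrow> defset (A k)"
  shows "\<exists>k\<in>K. \<exists>V. open V \<and> V \<noteq> {} \<and> V \<subseteq> W \<and> V \<subseteq> A k"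
proof -
  obtain k V where k: "k \<in> K" and V: "open V" "V \<noteq> {}" "V \<subseteq> W" "V \<subseteq> closure (A k)"
    using Baire_cover[OF assms(1-4)] by blast
  have "cylinder Basis (A k)"
    by (auto simp: cylinder_def agree_def simp flip: euclidean_eq_iff)
  then show ?thesis
    using defpred_dense_cylinder[OF finite_Basis order_refl assms(5)[OF k] _ V(1,2,4)] k V(3) by blast
qed

lemma defpred_Baire:
  fixes W :: "'a::euclidean_space set"
  assumes "open W" "W \<noteq> {}" "countable K" "\<And>x. x \<in> W \<Longrightarrow> \<exists>k\<in>K. P k x" "\<And>k. k \<in> K \<Longrightarrow> defpred (P k)"
  obtains k V where "k \<in> K" "open V" "V \<noteq> {}" "V \<subseteq> W" "\<And>x. x \<in> V \<Longrightarrow> P k x"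
  using defset_Baire[OF assms(1-3), of "\<lambda>k. {x. P k x}"] assms(4,5) by fastforce

lemma defpred_Baire2:
  fixes W :: "'a::euclidean_space set"
  assumes "open W" "W \<noteq> {}" "\<And>x. x \<in> W \<Longrightarrow> P x \<or> Q x" "defpred P" "defpred Q"
  shows "\<exists>V. open V \<and> V \<noteq> {} \<and> V \<subseteq> W \<and> ((\<forall>x\<in>V. P x) \<or> (\<forall>x\<in>V. Q x))"
proof -
  obtain b V where "open V" "V \<noteq> {}" "V \<subseteq> W" "\<And>x. x \<in> V \<Longrightarrow> if b then P x else Q x"
  proof (rule defpred_Baire[OF assms(1,2), of "UNIV :: bool set" "\<lambda>b x. if b then P x else Q x"])
    show "\<exists>b\<in>UNIV. if b then P x else Q x" if "x \<in> W" for x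
      using assms(3)[OF that] by (auto intro: exI[of _ True] exI[of _ False])
    show "defpred (\<lambda>x. if b then P x else Q x)" for b using assms(4,5) by (cases b) auto
  qed auto
  then show ?thesis by (cases b) auto
qed

end

section \<open>Generic linearity of definable functions\<close>

lemma creeping_segment:
  fixes F :: "'a::real_normed_vector \<Rightarrow> real"
  assumes "convex V" "continuous_on V F" "u \<in> V" "u + t *\<^sub>R e \<in> V" "0 \<le> t"
    and loc: "\<And>w. w \<in> V \<Longrightarrow> \<forall>\<^sub>F h in at_right 0. F w + q * h \<le> F (w + h *\<^sub>R e)"
  shows "q * t \<le> F (u + t *\<^sub>R e) - F u"
proof -
  have V: "u + s *\<^sub>R e \<in> V" if "0 \<le> s" "s \<le> t" for s
  proof (cases "t = 0")
    case False
    then have "u + s *\<^sub>R e = (1 - s / t) *\<^sub>R u + (s / t) *\<^sub>R (u + t *\<^sub>R e)"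
      by (simp add: algebra_simps)
    then show ?thesis
      using that False assms(1,3,4) by (simp add: convexD_alt)
  qed (use that assms in auto)
  have "q * (t - 0) \<le> F (u + t *\<^sub>R e) - F (u + 0 *\<^sub>R e)"
  proof (rule creeping)
    show "continuous_on {0..t} (\<lambda>s. F (u + s *\<^sub>R e))"
      by (intro continuous_on_compose2[OF assms(2)] continuous_intros) (auto intro: V)
    show "\<forall>\<^sub>F h in at_right 0. F (u + s *\<^sub>R e) + q * h \<le> F (u + (s + h) *\<^sub>R e)" if "0 \<le> s" "s < t" for s
      using loc[OF V[of s]] that by (simp add: scaleR_left_distrib add.assoc)
  qed (use assms in auto)
  then show ?thesis by simp
qed

context omin
begin

text \<open>Each quantifier nests the variables in one more pair; this rule applies a known binary
  predicate to any projections of the resulting tuple.\<close>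

lemma defpred_rearrange: "defpred (\<lambda>p. P (fst p) (snd p)) \<Longrightarrow> deffun g \<Longrightarrow> deffun h \<Longrightarrow> defpred (\<lambda>x. P (g x) (h x))"
  using defpred_compose[of "\<lambda>p. P (fst p) (snd p)" "\<lambda>x. (g x, h x)"] by (simp add: deffun_Pair)

lemma defpred_eventually_right:
  assumes "defpred (\<lambda>p. P (fst p) (snd p))"
  shows "defpred (\<lambda>x. \<forall>\<^sub>F h in at_right (0::real). P x h)"
  unfolding eventually_at_right_field by (intro defpred_intros defpred_rearrange[OF assms])

text \<open>For fixed e, values near a common rational give small oscillation on a smaller open set.
  To obtain one open set for all e, use that continuity at a point is definable, so that it holds or
  fails throughout some open set. Failing throughout would, by Baire's theorem again, mean
  oscillation above a fixed 1 / Suc n throughout an open set.\<close>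

lemma generic_continuity:
  fixes F :: "'a::euclidean_space \<Rightarrow> real"
  assumes F: "deffun F" and W: "open W" "W \<noteq> {}"
  obtains V where "open V" "V \<noteq> {}" "V \<subseteq> W" "continuous_on V F"
proof -
  define osc where "osc e u \<longleftrightarrow> (\<exists>d>0. \<forall>x y. norm (x - u) < d \<and> norm (y - u) < d \<longrightarrow> \<bar>F x - F y\<bar> \<le> e)" for e u
  have dosc: "defpred (\<lambda>p. osc (fst p) (snd p))"
    unfolding osc_def by (intro defpred_intros deffun_compose[OF F])
  have osc: "\<exists>V. open V \<and> V \<noteq> {} \<and> V \<subseteq> W \<and> (\<forall>u\<in>V. osc e u)" if W: "open W" "W \<noteq> {}" and e: "e > 0" for W e
  proof -
    have "\<exists>r\<in>\<rat>. \<bar>F x - r\<bar> \<le> e / 2" for x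
    proof -
      obtain r where "r \<in> \<rat>" "F x - e / 2 < r" "r < F x + e / 2"
        using Rats_dense_in_real[of "F x - e / 2" "F x + e / 2"] e by auto
      moreover from this have "\<bar>F x - r\<bar> \<le> e / 2" by linarith
      ultimately show ?thesis by blast
    qed
    then obtain r V where V: "open V" "V \<noteq> {}" "V \<subseteq> W" "\<And>x. x \<in> V \<Longrightarrow> \<bar>F x - r\<bar> \<le> e / 2"
    proof (rule defpred_Baire[OF W countable_rat])
      show "defpred (\<lambda>x. \<bar>F x - r\<bar> \<le> e / 2)" for r by (intro defpred_intros F)
    qed auto
    have "osc e u" if u: "u \<in> V" for u
    proof -
      obtain d where d: "d > 0" "ball u d \<subseteq> V" using V(1) u open_contains_ball by blast
      have "\<bar>F x - F y\<bar> \<le> e" if "norm (x - u) < d" "norm (y - u) < d" for x y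
      proof -
        have "x \<in> V" "y \<in> V" using that d by (auto simp: dist_norm norm_minus_commute subset_iff)
        then show ?thesis using V(4)[of x] V(4)[of y] by linarith
      qed
      then show ?thesis using d(1) unfolding osc_def by blast
    qed
    then show ?thesis using V by blast
  qed
  have "\<exists>V. open V \<and> V \<noteq> {} \<and> V \<subseteq> W \<and> ((\<forall>x\<in>V. \<forall>e>0. osc e x) \<or> (\<forall>x\<in>V. \<not> (\<forall>e>0. osc e x)))"
    by (intro defpred_Baire2 W defpred_intros defpred_rearrange[OF dosc]) auto
  then obtain V where V: "open V" "V \<noteq> {}" "V \<subseteq> W"
    "(\<forall>x\<in>V. \<forall>e>0. osc e x) \<or> (\<forall>x\<in>V. \<not> (\<forall>e>0. osc e x))" by blast
  have "\<forall>x\<in>V. \<forall>e>0. osc e x"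
  proof (rule ccontr)
    assume "\<not> ?thesis"
    then have bad: "\<exists>e>0. \<not> osc e x" if "x \<in> V" for x using V(4) that by blast
    have "\<exists>n\<in>UNIV. \<not> osc (1 / Suc n) x" if x: "x \<in> V" for x
    proof -
      obtain e where e: "e > 0" "\<not> osc e x" using bad[OF x] by blast
      obtain n where "1 / Suc n < e" using nat_approx_posE[OF e(1)] by blast
      then have "\<not> osc (1 / Suc n) x" using e(2) unfolding osc_def by (meson less_imp_le order_trans)
      then show ?thesis by blast
    qed
    then obtain n V' where V': "open V'" "V' \<noteq> {}" "V' \<subseteq> V" "\<And>x. x \<in> V' \<Longrightarrow> \<not> osc (1 / Suc n) x"
    proof (rule defpred_Baire[OF V(1,2) countableI_type])
      show "defpred (\<lambda>x. \<not> osc (1 / Suc n) x)" for n :: nat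
        by (intro defpred_intros defpred_rearrange[OF dosc])
    qed auto
    then show False using osc[OF V'(1,2), of "1 / Suc n"] by fastforce
  qed
  then have "isCont F x" if "x \<in> V" for x
  proof -
    have "\<exists>d>0. \<forall>y. norm (y - x) < d \<longrightarrow> norm (F y - F x) < e" if "e > 0" for e
    proof -
      obtain d where "d > 0" "\<And>y z. norm (y - x) < d \<Longrightarrow> norm (z - x) < d \<Longrightarrow> \<bar>F y - F z\<bar> \<le> e / 2"
        using \<open>\<forall>x\<in>V. \<forall>e>0. osc e x\<close> \<open>x \<in> V\<close> \<open>e > 0\<close> unfolding osc_def by (meson half_gt_zero)
      then show ?thesis using \<open>e > 0\<close> by (intro exI[of _ d]) (fastforce dest: spec[of _ x])
    qed
    then show ?thesis unfolding isCont_def LIM_eq by blast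
  qed
  then show ?thesis by (intro that[OF V(1-3)] continuous_at_imp_continuous_on) auto
qed

text \<open>Every point has a right slope in direction e, possibly infinite: the supremum of the r
  with \<open>P r u\<close>. By \<open>notP\<close>, every r above it is an upper bound for small
  increments. Baire's theorem fixes a rational approximation of the slope on an open set, and
  creeping integrates both bounds along segments in direction e.\<close>

lemma generic_slope:
  fixes F :: "'a::euclidean_space \<Rightarrow> real"
  assumes F: "deffun F" and W: "open W" "W \<noteq> {}" and \<kappa>: "\<kappa> > 0"
  obtains V \<nu> where "open V" "V \<noteq> {}" "V \<subseteq> W"
    "\<And>u t. u \<in> V \<Longrightarrow> u + t *\<^sub>R e \<in> V \<Longrightarrow> 0 \<le> t \<Longrightarrow> \<bar>F (u + t *\<^sub>R e) - F u - \<nu> * t\<bar> \<le> \<kappa> * t"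
proof -
  define P where "P r u \<longleftrightarrow> (\<forall>\<^sub>F h in at_right 0. F u + r * h \<le> F (u + h *\<^sub>R e))" for r u
  have dP: "defpred (\<lambda>p. P (fst p) (snd p))"
    unfolding P_def by (intro defpred_eventually_right defpred_intros deffun_compose[OF F])
  have mono: "P r u" if "P s u" "r \<le> s" for r s u
    using that(1) eventually_at_right_less[of "0::real"] unfolding P_def
    by eventually_elim (use that(2) in \<open>meson add_left_mono less_imp_le mult_right_mono order_trans\<close>)
  have notP: "\<forall>\<^sub>F h in at_right 0. - F u + (- r) * h \<le> - F (u + h *\<^sub>R e)" if "\<not> P r u" for r u
  proof -
    have "defpred (\<lambda>h. F u + r * h \<le> F (u + h *\<^sub>R e))"
      by (intro defpred_intros deffun_compose[OF F])
    from defpred_eventually[OF this, of 0] that have "\<forall>\<^sub>F h in at_right 0. \<not> F u + r * h \<le> F (u + h *\<^sub>R e)"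
      unfolding P_def by blast
    then show ?thesis by eventually_elim simp
  qed
  \<comment> \<open>\<open>None\<close> stands for slope plus or minus infinity,
    \<open>Some \<nu>\<close> for a slope within \<kappa> of \<nu>.\<close>
  define Q where "Q k u = (case k of None \<Rightarrow> (\<forall>r. P r u) \<or> (\<forall>r. \<not> P r u)
     | Some \<nu> \<Rightarrow> P (\<nu> - \<kappa>) u \<and> \<not> P (\<nu> + \<kappa>) u)" for k u
  have dQ: "defpred (Q k)" for k
    unfolding Q_def by (cases k; simp; intro defpred_intros defpred_rearrange[OF dP])
  have Q: "\<exists>k\<in>insert None (Some ` \<rat>). Q k u" for u
  proof (cases "(\<forall>r. P r u) \<or> (\<forall>r. \<not> P r u)")
    case False
    then obtain r s where rs: "P r u" "\<not> P s u" by blast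
    let ?s = "Sup {r. P r u}"
    have bdd: "bdd_above {r. P r u}"
      using mono[of _ u s] rs(2) by (intro bdd_aboveI[of _ s]) (metis linorder_le_cases mem_Collect_eq)
    obtain \<nu> where \<nu>: "\<nu> \<in> \<rat>" "?s - \<kappa> < \<nu>" "\<nu> < ?s + \<kappa>"
      using Rats_dense_in_real[of "?s - \<kappa>" "?s + \<kappa>"] \<kappa> by auto
    have "\<not> P (\<nu> + \<kappa>) u"
    proof
      assume "P (\<nu> + \<kappa>) u"
      then have "\<nu> + \<kappa> \<le> ?s" using bdd by (intro cSup_upper) auto
      then show False using \<nu> by simp
    qed
    moreover have "P (\<nu> - \<kappa>) u"
    proof -
      have "\<nu> - \<kappa> < ?s" using \<nu> by simp
      then obtain q where "P q u" "\<nu> - \<kappa> < q"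
        using less_cSup_iff[OF _ bdd, of "\<nu> - \<kappa>"] rs(1) by blast
      then show ?thesis using mono by simp
    qed
    ultimately show ?thesis using \<nu>(1) by (auto simp: Q_def)
  qed (simp add: Q_def)
  obtain W1 where W1: "open W1" "W1 \<noteq> {}" "W1 \<subseteq> W" "continuous_on W1 F"
    using generic_continuity[OF F W] .
  obtain k W2 where k: "k \<in> insert None (Some ` \<rat>)" and W2: "open W2" "W2 \<noteq> {}" "W2 \<subseteq> W1" "\<And>x. x \<in> W2 \<Longrightarrow> Q k x"
    by (rule defpred_Baire[OF W1(1,2), of "insert None (Some ` \<rat>)" Q]) (use Q dQ countable_rat in auto)
  have cont: "continuous_on V F" "continuous_on V (\<lambda>x. - F x)" if "V \<subseteq> W2" for V
    using W1(4) W2(3) that by (auto intro!: continuous_on_minus intro: continuous_on_subset)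
  have up: "q * t \<le> F (u + t *\<^sub>R e) - F u"
    if "convex V" "V \<subseteq> W2" "u \<in> V" "u + t *\<^sub>R e \<in> V" "0 \<le> t" "\<And>x. x \<in> V \<Longrightarrow> P q x" for V u t q
    using creeping_segment[OF that(1) cont(1)[OF that(2)] that(3-5)] that(6) unfolding P_def by blast
  have down: "F (u + t *\<^sub>R e) - F u \<le> q * t"
    if "convex V" "V \<subseteq> W2" "u \<in> V" "u + t *\<^sub>R e \<in> V" "0 \<le> t" "\<And>x. x \<in> V \<Longrightarrow> \<not> P q x" for V u t q
    using creeping_segment[OF that(1) cont(2)[OF that(2)] that(3-5), of "-q"] notP[OF that(6)] by fastforce
  have "k \<noteq> None"
  proof
    assume "k = None"
    then have "\<exists>V. open V \<and> V \<noteq> {} \<and> V \<subseteq> W2 \<and> ((\<forall>x\<in>V. \<forall>r. P r x) \<or> (\<forall>x\<in>V. \<forall>r. \<not> P r x))"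
      using W2(4) unfolding Q_def
      by (intro defpred_Baire2 W2 defpred_intros defpred_rearrange[OF dP]) auto
    then obtain V where V: "open V" "V \<noteq> {}" "V \<subseteq> W2" "(\<forall>x\<in>V. \<forall>r. P r x) \<or> (\<forall>x\<in>V. \<forall>r. \<not> P r x)"
      by blast
    then obtain x d where x: "x \<in> V" and d: "d > 0" "ball x d \<subseteq> V"
      using open_contains_ball by blast
    define t where "t = d / (2 * (norm e + 1))"
    have t: "t > 0" using d by (auto simp: t_def intro!: divide_pos_pos add_nonneg_pos)
    have "norm (t *\<^sub>R e) = (d / 2) * (norm e / (norm e + 1))"
      using t d by (simp add: t_def)
    also have "\<dots> \<le> (d / 2) * 1"
      using d by (intro mult_left_mono) (auto simp: divide_le_eq_1 add_nonneg_pos)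
    also have "\<dots> < d" using d by simp
    finally have xt: "x + t *\<^sub>R e \<in> ball x d" by (simp add: dist_norm)
    have bV: "ball x d \<subseteq> W2" using d V by blast
    \<comment> \<open>The increment over this single step contradicts both kinds of infinite slope:
      it would be at least \<open>?D + 1\<close>, or at most \<open>?D - 1\<close>.\<close>
    let ?D = "F (x + t *\<^sub>R e) - F x"
    from V(4) show False
    proof
      assume "\<forall>x\<in>V. \<forall>r. P r x"
      then have "((?D + 1) / t) * t \<le> ?D"
        using t d xt bV by (intro up[of "ball x d"]) auto
      then show False using t by simp
    next
      assume "\<forall>x\<in>V. \<forall>r. \<not> P r x"
      then have "?D \<le> ((?D - 1) / t) * t"
        using t d xt bV by (intro down[of "ball x d"]) auto
      then show False using t by simp
    qed
  qed
  then obtain \<nu> where \<nu>: "k = Some \<nu>" by blast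
  obtain x d where x: "x \<in> W2" and d: "d > 0" "ball x d \<subseteq> W2"
    using W2 open_contains_ball by blast
  have "\<bar>F (u + t *\<^sub>R e) - F u - \<nu> * t\<bar> \<le> \<kappa> * t"
    if "u \<in> ball x d" "u + t *\<^sub>R e \<in> ball x d" "0 \<le> t" for u t
  proof -
    have "P (\<nu> - \<kappa>) y" "\<not> P (\<nu> + \<kappa>) y" if "y \<in> ball x d" for y
      using W2(4)[of y] d that unfolding \<nu> Q_def by auto
    then have "(\<nu> - \<kappa>) * t \<le> F (u + t *\<^sub>R e) - F u" "F (u + t *\<^sub>R e) - F u \<le> (\<nu> + \<kappa>) * t"
      using that d by (auto intro!: up[of "ball x d"] down[of "ball x d"])
    then show ?thesis by (simp add: algebra_simps abs_le_iff)
  qed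
  then show ?thesis using that[of "ball x d" \<nu>] d W2 W1 by auto
qed

lemma generic_slopes:
  fixes F :: "'a::euclidean_space \<Rightarrow> real"
  assumes "finite J" and F: "deffun F" and W: "open W" "W \<noteq> {}" and \<kappa>: "\<kappa> > 0"
  shows "\<exists>V \<nu>. open V \<and> V \<noteq> {} \<and> V \<subseteq> W \<and> (\<forall>e\<in>J. \<forall>u t. u \<in> V \<and> u + t *\<^sub>R e \<in> V \<and> 0 \<le> t \<longrightarrow>
    \<bar>F (u + t *\<^sub>R e) - F u - \<nu> e * t\<bar> \<le> \<kappa> * t)"
  using assms(1)
proof (induction J rule: finite_induct)
  case empty
  then show ?case using W by blast
next
  case (insert e J)
  then obtain V \<nu> where V: "open V" "V \<noteq> {}" "V \<subseteq> W" "\<forall>e\<in>J. \<forall>u t. u \<in> V \<and> u + t *\<^sub>R e \<in> V \<and> 0 \<le> t \<longrightarrow>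
    \<bar>F (u + t *\<^sub>R e) - F u - \<nu> e * t\<bar> \<le> \<kappa> * t" by blast
  obtain V' n where V': "open V'" "V' \<noteq> {}" "V' \<subseteq> V"
    "\<And>u t. u \<in> V' \<Longrightarrow> u + t *\<^sub>R e \<in> V' \<Longrightarrow> 0 \<le> t \<Longrightarrow> \<bar>F (u + t *\<^sub>R e) - F u - n * t\<bar> \<le> \<kappa> * t"
    using generic_slope[OF F V(1,2) \<kappa>] by metis
  have "\<bar>F (u + t *\<^sub>R i) - F u - (\<nu>(e := n)) i * t\<bar> \<le> \<kappa> * t"
    if "i \<in> insert e J" "u \<in> V'" "u + t *\<^sub>R i \<in> V'" "0 \<le> t" for i u t
  proof (cases "i = e")
    case False
    then have "i \<in> J" "u \<in> V" "u + t *\<^sub>R i \<in> V" using that V'(3) by auto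
    then show ?thesis using V(4) that(4) False by simp
  qed (use that V'(4) in auto)
  then show ?case using V' V(3) by (intro exI[of _ V'] exI[of _ "\<nu>(e := n)"]) auto
qed

text \<open>Within a box one can pass from u to u' along coordinate directions without leaving it.
  Each direction contributes an error of at most its share \<kappa> / DIM('a) times the distance, as
  no coordinate of u' - u exceeds the norm.\<close>

lemma generic_linear:
  fixes F :: "'a::euclidean_space \<Rightarrow> real"
  assumes F: "deffun F" and W: "open W" "W \<noteq> {}" and \<kappa>: "\<kappa> > 0"
  obtains V n where "open V" "V \<noteq> {}" "V \<subseteq> W"
    "\<And>u u'. u \<in> V \<Longrightarrow> u' \<in> V \<Longrightarrow> \<bar>F u' - F u - n \<bullet> (u' - u)\<bar> \<le> \<kappa> * norm (u' - u)"
proof -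
  let ?\<kappa> = "\<kappa> / DIM('a)"
  have k: "?\<kappa> > 0" using \<kappa> by simp
  obtain V \<nu> where V: "open V" "V \<noteq> {}" "V \<subseteq> W"
    and \<nu>: "\<And>e u t. e \<in> Basis \<Longrightarrow> u \<in> V \<Longrightarrow> u + t *\<^sub>R e \<in> V \<Longrightarrow> 0 \<le> t \<Longrightarrow>
    \<bar>F (u + t *\<^sub>R e) - F u - \<nu> e * t\<bar> \<le> ?\<kappa> * t"
    using generic_slopes[OF finite_Basis F W k] by blast
  have \<nu>': "\<bar>F (u + t *\<^sub>R e) - F u - \<nu> e * t\<bar> \<le> ?\<kappa> * \<bar>t\<bar>"
    if "e \<in> Basis" "u \<in> V" "u + t *\<^sub>R e \<in> V" for e u t
  proof (cases "0 \<le> t")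
    case False
    then show ?thesis
      using \<nu>[of e "u + t *\<^sub>R e" "-t"] that by (simp add: abs_minus_commute)
  qed (use \<nu> that in auto)
  obtain w where w: "w \<in> V" using V(2) by auto
  obtain a b where ab: "w \<in> box a b" "box a b \<subseteq> V"
    using open_contains_box[OF V(1) w] by metis
  have path: "abs (F u' - F u - (\<Sum>e\<in>J. \<nu> e * ((u' - u) \<bullet> e))) \<le> ?\<kappa> * (\<Sum>e\<in>J. abs ((u' - u) \<bullet> e))"
    if "finite J" "J \<subseteq> Basis" "u \<in> box a b" "u' \<in> box a b" "\<And>e. e \<in> Basis - J \<Longrightarrow> u \<bullet> e = u' \<bullet> e" for J :: "'a set" and u u' :: 'a
    using that
  proof (induction J arbitrary: u rule: finite_induct)
    case empty
    have "u = u'" by (rule euclidean_eqI) (simp add: empty.prems(4))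
    then show ?case by simp
  next
    case (insert i J)
    have i: "i \<in> Basis" using insert.prems by simp
    let ?m = "set_coord u i (u' \<bullet> i)"
    have m: "?m = u + ((u' - u) \<bullet> i) *\<^sub>R i" by (simp add: set_coord_def inner_diff_left)
    have mi: "?m \<bullet> e = (if i = e then u' \<bullet> e else u \<bullet> e)" if "e \<in> Basis" for e
      using set_coord_inner[OF i that] by auto
    have mb: "?m \<in> box a b"
      unfolding mem_box
    proof
      fix e :: 'a assume e: "e \<in> Basis"
      have "a \<bullet> e < u \<bullet> e \<and> u \<bullet> e < b \<bullet> e" "a \<bullet> e < u' \<bullet> e \<and> u' \<bullet> e < b \<bullet> e"
        using insert.prems(2,3) e unfolding mem_box by blast+
      then show "a \<bullet> e < ?m \<bullet> e \<and> ?m \<bullet> e < b \<bullet> e"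
        unfolding mi[OF e] by simp
    qed
    have "abs (F u' - F ?m - (\<Sum>e\<in>J. \<nu> e * ((u' - ?m) \<bullet> e))) \<le> ?\<kappa> * (\<Sum>e\<in>J. abs ((u' - ?m) \<bullet> e))"
    proof (rule insert.IH[OF _ mb insert.prems(3)])
      show "J \<subseteq> Basis" using insert.prems(1) by simp
      show "?m \<bullet> e = u' \<bullet> e" if "e \<in> Basis - J" for e
        using that insert.prems(4)[of e] mi[of e] by (cases "i = e") simp_all
    qed
    moreover have "(u' - ?m) \<bullet> e = (u' - u) \<bullet> e" if "e \<in> J" for e
    proof -
      have "e \<in> Basis" "e \<noteq> i" using that insert.hyps(2) insert.prems(1) by auto
      then show ?thesis using mi[of e] by (simp add: inner_diff_left)
    qed
    ultimately have 1: "abs (F u' - F ?m - (\<Sum>e\<in>J. \<nu> e * ((u' - u) \<bullet> e))) \<le> ?\<kappa> * (\<Sum>e\<in>J. abs ((u' - u) \<bullet> e))"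
      by simp
    have 2: "\<bar>F ?m - F u - \<nu> i * ((u' - u) \<bullet> i)\<bar> \<le> ?\<kappa> * \<bar>(u' - u) \<bullet> i\<bar>"
      using \<nu>'[OF i, of u "(u' - u) \<bullet> i"] insert.prems(2) mb ab(2) unfolding m by blast
    have "abs (F u' - F u - (\<nu> i * ((u' - u) \<bullet> i) + (\<Sum>e\<in>J. \<nu> e * ((u' - u) \<bullet> e))))
        \<le> ?\<kappa> * abs ((u' - u) \<bullet> i) + ?\<kappa> * (\<Sum>e\<in>J. abs ((u' - u) \<bullet> e))"
      using 1 2 by linarith
    then show ?case
      unfolding sum.insert[OF insert.hyps] distrib_left .
  qed
  have "\<bar>F u' - F u - (\<Sum>e\<in>Basis. \<nu> e *\<^sub>R e) \<bullet> (u' - u)\<bar> \<le> \<kappa> * norm (u' - u)"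
    if u: "u \<in> box a b" "u' \<in> box a b" for u u'
  proof -
    have "abs (F u' - F u - (\<Sum>e\<in>Basis. \<nu> e * ((u' - u) \<bullet> e))) \<le> ?\<kappa> * (\<Sum>e\<in>Basis. abs ((u' - u) \<bullet> e))"
      using u by (intro path) auto
    also have "\<dots> \<le> ?\<kappa> * (\<Sum>e\<in>(Basis::'a set). norm (u' - u))"
      using k by (intro mult_left_mono sum_mono Basis_le_norm) auto
    also have "\<dots> = \<kappa> * norm (u' - u)" by simp
    moreover have "(\<Sum>e\<in>Basis. \<nu> e *\<^sub>R e) \<bullet> (u' - u) = (\<Sum>e\<in>Basis. \<nu> e * ((u' - u) \<bullet> e))"
      unfolding inner_sum_left inner_scaleR_left by (simp add: inner_commute)
    ultimately show ?thesis by simp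
  qed
  moreover have "box a b \<noteq> {}" using ab by blast
  ultimately show ?thesis
    using that[of "box a b" "\<Sum>e\<in>Basis. \<nu> e *\<^sub>R e"] ab V by (meson open_box order_trans)
qed

lemma generic_linear_vec:
  fixes F :: "'a::euclidean_space \<Rightarrow> 'b::euclidean_space"
  assumes F: "deffun F" and W: "open W" "W \<noteq> {}" and \<kappa>: "\<kappa> > 0"
  obtains V N where "open V" "V \<noteq> {}" "V \<subseteq> W" "bounded_linear N"
    "\<And>u u'. u \<in> V \<Longrightarrow> u' \<in> V \<Longrightarrow> norm (F u' - F u - N (u' - u)) \<le> \<kappa> * norm (u' - u)"
proof -
  let ?\<kappa> = "\<kappa> / DIM('b)"
  have k: "?\<kappa> > 0" using \<kappa> by simp
  have "\<exists>V n. open V \<and> V \<noteq> {} \<and> V \<subseteq> W \<and> (\<forall>b\<in>J. \<forall>u\<in>V. \<forall>u'\<in>V.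
    \<bar>F u' \<bullet> b - F u \<bullet> b - n b \<bullet> (u' - u)\<bar> \<le> ?\<kappa> * norm (u' - u))" if "finite J" "J \<subseteq> Basis" for J
    using that
  proof (induction J rule: finite_induct)
    case empty
    then show ?case using W by blast
  next
    case (insert b J)
    then obtain V n where V: "open V" "V \<noteq> {}" "V \<subseteq> W" "\<forall>b\<in>J. \<forall>u\<in>V. \<forall>u'\<in>V.
      \<bar>F u' \<bullet> b - F u \<bullet> b - n b \<bullet> (u' - u)\<bar> \<le> ?\<kappa> * norm (u' - u)" by auto
    have "deffun (\<lambda>u. F u \<bullet> b)" using F insert.prems by (intro deffun_inner_Basis) auto
    then obtain V' m where V': "open V'" "V' \<noteq> {}" "V' \<subseteq> V"
      "\<And>u u'. u \<in> V' \<Longrightarrow> u' \<in> V' \<Longrightarrow> \<bar>F u' \<bullet> b - F u \<bullet> b - m \<bullet> (u' - u)\<bar> \<le> ?\<kappa> * norm (u' - u)"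
      using generic_linear[OF _ V(1,2) k] by metis
    have "\<bar>F u' \<bullet> i - F u \<bullet> i - (n(b := m)) i \<bullet> (u' - u)\<bar> \<le> ?\<kappa> * norm (u' - u)"
      if "i \<in> insert b J" "u \<in> V'" "u' \<in> V'" for i u u'
      using that V'(3) V'(4)[of u u'] V(4) by (cases "i = b") auto
    then show ?case using V' V(3) by (intro exI[of _ V'] exI[of _ "n(b := m)"]) auto
  qed
  from this[OF finite_Basis order_refl] obtain V n where V: "open V" "V \<noteq> {}" "V \<subseteq> W"
    and n: "\<And>b u u'. b \<in> Basis \<Longrightarrow> u \<in> V \<Longrightarrow> u' \<in> V \<Longrightarrow>
      \<bar>F u' \<bullet> b - F u \<bullet> b - n b \<bullet> (u' - u)\<bar> \<le> ?\<kappa> * norm (u' - u)" by blast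
  let ?N = "\<lambda>x. \<Sum>b\<in>Basis. (n b \<bullet> x) *\<^sub>R b"
  have "norm (F u' - F u - ?N (u' - u)) \<le> \<kappa> * norm (u' - u)" if "u \<in> V" "u' \<in> V" for u u'
  proof -
    have "norm (F u' - F u - ?N (u' - u)) \<le> (\<Sum>b\<in>Basis. \<bar>(F u' - F u - ?N (u' - u)) \<bullet> b\<bar>)"
      by (rule norm_le_l1)
    also have "\<dots> \<le> (\<Sum>b\<in>(Basis::'b set). ?\<kappa> * norm (u' - u))"
      using n[OF _ that] by (intro sum_mono) (simp add: inner_diff_left)
    finally show ?thesis by simp
  qed
  moreover have "bounded_linear ?N"
    by (intro bounded_linear_sum bounded_linear_scaleR_const bounded_linear_inner_right)
  ultimately show ?thesis by (intro that[OF V, of ?N]) auto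
qed

section \<open>Definable choice and vanishing slopes\<close>
lemma deffun_ex1:
  fixes R :: "'a::euclidean_space \<Rightarrow> 'b::euclidean_space \<Rightarrow> bool"
  assumes "defpred (\<lambda>p. R (fst p) (snd p))" "\<And>x. \<exists>!y. R x y"
  obtains h where "deffun h" "\<And>x. R x (h x)"
proof
  let ?h = "\<lambda>x. THE y. R x y"
  show R: "R x (?h x)" for x by (rule theI'[OF assms(2)])
  have "(snd p = ?h (fst p)) = R (fst p) (snd p)" for p
    using R assms(2) by metis
  then show "deffun ?h" using assms(1) unfolding deffun_def by simp
qed

text \<open>A definable witness has to be described uniquely. If the infimum a is attained, take it;
  otherwise, since definable sets do not oscillate, the set contains an interval to the right of a,
  and the midpoint of the longest such interval (a, b) is taken. The bound B keeps a and b
  finite.\<close>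

lemma definable_choice_real:
  fixes Z :: "'a::euclidean_space \<Rightarrow> real \<Rightarrow> bool"
  assumes Z: "defpred (\<lambda>p. Z (fst p) (snd p))" and B: "\<And>x t. Z x t \<Longrightarrow> \<bar>t\<bar> \<le> B"
  obtains h where "deffun h" "\<And>x t. Z x t \<Longrightarrow> Z x (h x)"
proof -
  define inf where "inf x a \<longleftrightarrow> (\<forall>t. Z x t \<longrightarrow> a \<le> t) \<and> (\<forall>r>a. \<exists>t. Z x t \<and> t < r)" for x a
  define gap where "gap x a b \<longleftrightarrow> a < b \<and> (\<forall>t. a < t \<and> t < b \<longrightarrow> Z x t) \<and> (\<forall>r>b. \<exists>t. a < t \<and> t < r \<and> \<not> Z x t)" for x a b
  \<comment> \<open>The value 0 is a default where there is nothing to choose; \<open>y + y\<close>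
    expresses the midpoint by addition alone.\<close>
  define R where "R x y \<longleftrightarrow> (if \<exists>t. Z x t then (\<exists>a. inf x a \<and> (if Z x a then y = a else
     (\<exists>b. gap x a b \<and> y + y = a + b))) else y = 0)" for x y
  have dinf: "defpred (\<lambda>p. inf (fst p) (snd p))"
    unfolding inf_def by (intro defpred_intros defpred_rearrange[OF Z])
  have dgap: "defpred (\<lambda>p. gap (fst p) (fst (snd p)) (snd (snd p)))"
    unfolding gap_def by (intro defpred_intros defpred_rearrange[OF Z])
  have dgap': "defpred (\<lambda>x. gap (f x) (g x) (h x))" if "deffun f" "deffun g" "deffun h"
    for f :: "'c::euclidean_space \<Rightarrow> 'a" and g h
    using defpred_compose[OF dgap deffun_Pair[OF that(1) deffun_Pair[OF that(2,3)]]] by simp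
  have R': "R x y \<longleftrightarrow> ((\<exists>t. Z x t) \<longrightarrow> (\<exists>a. inf x a \<and> (Z x a \<longrightarrow> y = a) \<and> (\<not> Z x a \<longrightarrow>
     (\<exists>b. gap x a b \<and> y + y = a + b)))) \<and> ((\<exists>t. Z x t) \<or> y = 0)" for x y
    unfolding R_def by auto
  have dR: "defpred (\<lambda>p. R (fst p) (snd p))"
    unfolding R' by (intro defpred_intros defpred_rearrange[OF Z] defpred_rearrange[OF dinf] dgap')
  have inf_unique: "a = a'" if "inf x a" "inf x a'" for x a a'
    using that unfolding inf_def by (meson not_less_iff_gr_or_eq not_le)
  have gap_unique: "b = b'" if "gap x a b" "gap x a b'" for x a b b'
    using that unfolding gap_def by (meson not_less_iff_gr_or_eq)
  have inf_ex: "inf x (Inf {t. Z x t})" if "Z x t" for x t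
  proof -
    have bdd: "bdd_below {t. Z x t}" using B by (intro bdd_belowI[of _ "- B"]) (fastforce simp: abs_le_iff)
    show ?thesis
      unfolding inf_def
      using cInf_lower[OF _ bdd] cInf_less_iff[OF _ bdd] that by auto
  qed
  have gap_ex: "\<exists>b. gap x a b" if "Z x t" "inf x a" "\<not> Z x a" for x t a
  proof -
    have "defpred (Z x)" using defpred_rearrange[OF Z deffun_const deffun_id] .
    then have "(\<forall>\<^sub>F t in at_right a. Z x t) \<or> (\<forall>\<^sub>F t in at_right a. \<not> Z x t)"
      by (rule defpred_eventually)
    moreover have "\<not> (\<forall>\<^sub>F t in at_right a. \<not> Z x t)"
      using that(2,3) unfolding inf_def eventually_at_right_field by (metis le_less)
    ultimately obtain c where c: "c > a" "\<And>t. a < t \<Longrightarrow> t < c \<Longrightarrow> Z x t"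
      unfolding eventually_at_right_field by blast
    let ?C = "{c. a < c \<and> (\<forall>t. a < t \<and> t < c \<longrightarrow> Z x t)}"
    have CB: "c \<le> B" if "c \<in> ?C" for c
    proof (rule ccontr)
      assume "\<not> c \<le> B"
      then have "max a B < c" using that by simp
      then obtain t where "max a B < t" "t < c" using dense by blast
      moreover from this have "Z x t" using that by simp
      ultimately show False using B[of x t] by auto
    qed
    then have bdd: "bdd_above ?C" by (intro bdd_aboveI[of _ B]) auto
    have cC: "c \<in> ?C" using c by auto
    have "gap x a (Sup ?C)"
      unfolding gap_def
    proof (intro conjI allI impI)
      show "a < Sup ?C" using cSup_upper[OF cC bdd] c(1) by linarith
      show "Z x t" if "a < t \<and> t < Sup ?C" for t
      proof -
        have "\<exists>c\<in>?C. t < c" using less_cSup_iff[OF _ bdd, of t] cC that by blast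
        then show ?thesis using that by blast
      qed
      show "\<exists>t. a < t \<and> t < r \<and> \<not> Z x t" if "Sup ?C < r" for r
      proof (rule ccontr)
        assume "\<not> ?thesis"
        then have "r \<in> ?C" using that \<open>a < Sup ?C\<close> by auto
        then show False using cSup_upper[OF _ bdd, of r] that by linarith
      qed
    qed
    then show ?thesis by blast
  qed
  have ex: "\<exists>y. R x y" for x
  proof (cases "\<exists>t. Z x t")
    case True
    then obtain t where t: "Z x t" by blast
    let ?a = "Inf {t. Z x t}"
    show ?thesis
    proof (cases "Z x ?a")
      case False
      then obtain b where "gap x ?a b" using gap_ex[OF t inf_ex[OF t]] by blast
      then show ?thesis
        using inf_ex[OF t] t False unfolding R_def by (intro exI[of _ "(?a + b) / 2"]) auto
    qed (use inf_ex[OF t] t in \<open>auto simp: R_def\<close>)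
  qed (simp add: R_def)
  have unique: "y = y'" if yy: "R x y" "R x y'" for x y y'
  proof (cases "\<exists>t. Z x t")
    case True
    then have R: "\<exists>a. inf x a \<and> (Z x a \<longrightarrow> y = a) \<and> (\<not> Z x a \<longrightarrow> (\<exists>b. gap x a b \<and> y + y = a + b))"
      if "R x y" for y
      using that unfolding R' by blast
    obtain a where a: "inf x a" "Z x a \<longrightarrow> y = a" "\<not> Z x a \<longrightarrow> (\<exists>b. gap x a b \<and> y + y = a + b)"
      using R[OF yy(1)] by blast
    obtain a' where a': "inf x a'" "Z x a' \<longrightarrow> y' = a'" "\<not> Z x a' \<longrightarrow> (\<exists>b. gap x a' b \<and> y' + y' = a' + b)"
      using R[OF yy(2)] by blast
    have aa: "a' = a" using inf_unique a(1) a'(1) by blast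
    show ?thesis
    proof (cases "Z x a")
      case False
      then obtain b b' where b: "gap x a b" "y + y = a + b" "gap x a b'" "y' + y' = a + b'"
        using a a' unfolding aa by blast
      then have "b = b'" using gap_unique by blast
      then show ?thesis using b by simp
    qed (use a a' aa in auto)
  qed (use that in \<open>auto simp: R_def\<close>)
  obtain h where h: "deffun h" "\<And>x. R x (h x)"
    using deffun_ex1[OF dR] ex unique by metis
  have "Z x (h x)" if Zxt: "Z x t" for x t
  proof -
    obtain a where a: "inf x a" "Z x a \<longrightarrow> h x = a" "\<not> Z x a \<longrightarrow> (\<exists>b. gap x a b \<and> h x + h x = a + b)"
      using h(2)[of x] Zxt unfolding R' by blast
    show ?thesis
    proof (cases "Z x a")
      case False
      then obtain b where "gap x a b" "h x + h x = a + b" using a by auto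
      then show ?thesis unfolding gap_def by auto
    qed (use a in auto)
  qed
  then show ?thesis using that h(1) by blast
qed

text \<open>The coordinates of the witness are fixed one at a time: \<open>sel J\<close> restricts
  the relation so that witnesses survive but agree in the coordinates in J. For
  \<open>J = Basis\<close> the witness is unique.\<close>

lemma definable_choice:
  fixes Z :: "'a::euclidean_space \<Rightarrow> 'b::euclidean_space \<Rightarrow> bool"
  assumes Z: "defpred (\<lambda>p. Z (fst p) (snd p))" and B: "\<And>x y. Z x y \<Longrightarrow> norm y \<le> B"
  obtains h where "deffun h" "\<And>x y. Z x y \<Longrightarrow> Z x (h x)"
proof -
  define sel where "sel J Z' \<longleftrightarrow> defpred (\<lambda>p. Z' (fst p) (snd p)) \<and> (\<forall>x y. Z' x y \<longrightarrow> Z x y) \<and>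
     (\<forall>x y. Z x y \<longrightarrow> (\<exists>y. Z' x y)) \<and> (\<forall>x y y'. Z' x y \<longrightarrow> Z' x y' \<longrightarrow> (\<forall>j\<in>J. y \<bullet> j = y' \<bullet> j))" for J Z'
  have "\<exists>Z'. sel J Z'" if "finite J" "J \<subseteq> Basis" for J
    using that
  proof (induction J rule: finite_induct)
    case empty
    then show ?case using Z unfolding sel_def by (intro exI[of _ Z]) auto
  next
    case (insert j J)
    then obtain Z' where "sel J Z'" by auto
    then have Z': "defpred (\<lambda>p. Z' (fst p) (snd p))" "\<And>x y. Z' x y \<Longrightarrow> Z x y"
      "\<And>x y. Z x y \<Longrightarrow> \<exists>y. Z' x y" "\<And>x y y'. Z' x y \<Longrightarrow> Z' x y' \<Longrightarrow> (\<forall>j\<in>J. y \<bullet> j = y' \<bullet> j)"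
      unfolding sel_def by blast+
    let ?Y = "\<lambda>x t. \<exists>y. Z' x y \<and> y \<bullet> j = t"
    have "defpred (\<lambda>p. ?Y (fst p) (snd p))" by (intro defpred_intros defpred_rearrange[OF Z'(1)])
    moreover have "\<bar>t\<bar> \<le> B" if "?Y x t" for x t
      using that B Z'(2) insert.prems Basis_le_norm[of j] by (metis insert_subset order_trans)
    ultimately obtain h where h: "deffun h" "\<And>x t. ?Y x t \<Longrightarrow> ?Y x (h x)"
      using definable_choice_real[of ?Y B] by blast
    let ?Z = "\<lambda>x y. Z' x y \<and> y \<bullet> j = h x"
    have "sel (insert j J) ?Z"
      unfolding sel_def
    proof (intro conjI allI impI)
      show "defpred (\<lambda>p. ?Z (fst p) (snd p))"
        by (intro defpred_intros defpred_rearrange[OF Z'(1)] deffun_compose[OF h(1)])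
      show "Z x y" if "?Z x y" for x y using that Z'(2) by blast
      show "\<exists>y. ?Z x y" if "Z x y" for x y
        using Z'(3)[OF that] h(2)[of x] by blast
      show "\<forall>i\<in>insert j J. y \<bullet> i = y' \<bullet> i" if "?Z x y" "?Z x y'" for x y y'
        using that Z'(4)[of x y y'] by simp
    qed
    then show ?case by blast
  qed
  from this[OF finite_Basis order_refl] obtain Z' where "sel Basis Z'" by blast
  then have Z': "defpred (\<lambda>p. Z' (fst p) (snd p))"
    "\<And>x y. Z' x y \<Longrightarrow> Z x y" "\<And>x y. Z x y \<Longrightarrow> \<exists>y. Z' x y" "\<And>x y y'. Z' x y \<Longrightarrow> Z' x y' \<Longrightarrow> y = y'"
    unfolding sel_def by (blast intro: euclidean_eqI)+
  let ?R = "\<lambda>x y. Z' x y \<or> \<not> (\<exists>y. Z' x y) \<and> y = 0"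
  have dR: "defpred (\<lambda>p. ?R (fst p) (snd p))" by (intro defpred_intros defpred_rearrange[OF Z'(1)])
  have "\<exists>!y. ?R x y" for x using Z'(4) by blast
  then obtain h where h: "deffun h" "\<And>x. ?R x (h x)" using deffun_ex1[OF dR] by blast
  have "Z x (h x)" if "Z x y" for x y
    using h(2)[of x] Z'(2,3) that by blast
  then show ?thesis using that h(1) by blast
qed

text \<open>The threshold below which \<open>P x\<close> is constant depends on x; Baire's theorem
  over the thresholds 1 / Suc n and the two truth values makes both uniform on an open set.\<close>

lemma generic_eventually:
  fixes P :: "'a::euclidean_space \<Rightarrow> real \<Rightarrow> bool"
  assumes P: "defpred (\<lambda>p. P (fst p) (snd p))" and W: "open W" "W \<noteq> {}"
  obtains V s where "open V" "V \<noteq> {}" "V \<subseteq> W" "s > 0"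
    "(\<forall>x\<in>V. \<forall>t. 0 < t \<and> t < s \<longrightarrow> P x t) \<or> (\<forall>x\<in>V. \<forall>t. 0 < t \<and> t < s \<longrightarrow> \<not> P x t)"
proof -
  let ?Q = "\<lambda>(n::nat, c) x. \<forall>t. 0 < t \<and> t < 1 / Suc n \<longrightarrow> (P x t \<longleftrightarrow> c)"
  have Q: "\<exists>k\<in>UNIV. ?Q k x" for x
  proof -
    have dP: "defpred (P x)" using defpred_rearrange[OF P deffun_const deffun_id] .
    have "\<exists>c. \<forall>\<^sub>F t in at_right 0. P x t \<longleftrightarrow> c"
      using defpred_eventually[OF dP, of 0]
    proof
      assume "\<forall>\<^sub>F t in at_right 0. P x t"
      then show ?thesis by (intro exI[of _ True]) simp
    next
      assume "\<forall>\<^sub>F t in at_right 0. \<not> P x t"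
      then show ?thesis by (intro exI[of _ False]) simp
    qed
    then obtain c d where d: "d > 0" "\<And>t. 0 < t \<Longrightarrow> t < d \<Longrightarrow> P x t \<longleftrightarrow> c"
      unfolding eventually_at_right_field by blast
    obtain n where n: "1 / Suc n < d" using nat_approx_posE[OF d(1)] by blast
    have "?Q (n, c) x"
      unfolding prod.case
    proof (intro allI impI)
      fix t assume "0 < t \<and> t < 1 / Suc n"
      then show "P x t = c" using n by (intro d(2)) auto
    qed
    then show ?thesis by (rule bexI) simp
  qed
  have dQ: "defpred (?Q k)" for k
  proof (cases k)
    case (Pair n c)
    show ?thesis unfolding Pair prod.case by (intro defpred_intros defpred_rearrange[OF P])
  qed
  obtain k V where V: "open V" "V \<noteq> {}" "V \<subseteq> W" "\<And>x. x \<in> V \<Longrightarrow> ?Q k x"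
    by (rule defpred_Baire[OF W countableI_type Q dQ]) (rule that)
  obtain n c where k: "k = (n, c)" by (cases k)
  have "(\<forall>x\<in>V. \<forall>t. 0 < t \<and> t < 1 / Suc n \<longrightarrow> P x t) \<or> (\<forall>x\<in>V. \<forall>t. 0 < t \<and> t < 1 / Suc n \<longrightarrow> \<not> P x t)"
    using V(4) unfolding k prod.case by (cases c) simp_all
  then show ?thesis by (intro that[OF V(1-3), of "1 / Suc n"]) auto
qed

text \<open>Functions of \<open>(\<tau>, s)\<close> that tend to \<open>0\<close> with \<open>s\<close> have small slopes in \<open>\<tau>\<close>, uniformly for small
  \<open>s\<close>: a slope of at least \<open>\<kappa>\<close> on a fixed interval would contradict the convergence.\<close>

lemma vanishing_slope_half:
  fixes \<zeta> :: "real \<times> real \<Rightarrow> real"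
  assumes z: "deffun \<zeta>" and W: "open W" "W \<noteq> {}"
    and small: "\<And>\<tau> s. \<tau> \<in> W \<Longrightarrow> 0 < s \<Longrightarrow> \<bar>\<zeta> (\<tau>, s)\<bar> \<le> s" and \<kappa>: "\<kappa> > 0"
  obtains V \<sigma> where "open V" "V \<noteq> {}" "V \<subseteq> W" "\<sigma> > 0"
    "\<And>\<tau> \<tau>' s. \<tau> \<in> V \<Longrightarrow> \<tau>' \<in> V \<Longrightarrow> \<tau> \<le> \<tau>' \<Longrightarrow> 0 < s \<Longrightarrow> s < \<sigma> \<Longrightarrow> \<zeta> (\<tau>', s) - \<zeta> (\<tau>, s) \<le> \<kappa> * (\<tau>' - \<tau>)"
proof -
  define C where "C \<tau> s \<longleftrightarrow> (\<forall>e>0. \<exists>d>0. \<forall>t. \<bar>t - \<tau>\<bar> < d \<longrightarrow> \<bar>\<zeta> (t, s) - \<zeta> (\<tau>, s)\<bar> < e)" for \<tau> s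
  have dC: "defpred (\<lambda>p. C (fst p) (snd p))"
    unfolding C_def by (intro defpred_intros deffun_compose[OF z])
  have CI: "C \<tau> s \<longleftrightarrow> isCont (\<lambda>t. \<zeta> (t, s)) \<tau>" for \<tau> s
    unfolding C_def continuous_at_eps_delta by (simp add: dist_real_def)
  define U where "U \<tau> s \<longleftrightarrow> (\<forall>\<^sub>F h in at_right 0. \<zeta> (\<tau>, s) + \<kappa> * h \<le> \<zeta> (\<tau> + h, s))" for \<tau> s
  have dU: "defpred (\<lambda>p. U (fst p) (snd p))"
    unfolding U_def by (intro defpred_eventually_right defpred_intros deffun_compose[OF z])
  obtain V1 s1 where V1: "open V1" "V1 \<noteq> {}" "V1 \<subseteq> W" "s1 > 0"
    "(\<forall>x\<in>V1. \<forall>t. 0 < t \<and> t < s1 \<longrightarrow> C x t) \<or> (\<forall>x\<in>V1. \<forall>t. 0 < t \<and> t < s1 \<longrightarrow> \<not> C x t)"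
    by (rule generic_eventually[OF dC W]) (rule that)
  \<comment> \<open>Otherwise continuity in \<tau> would fail on all of \<open>V1\<close> for every
    small s, in particular at height s1 / 2, whereas the slice at that height is continuous on some
    open set.\<close>
  have C: "C x t" if "x \<in> V1" "0 < t" "t < s1" for x t
  proof (rule ccontr)
    assume "\<not> C x t"
    then have n: "\<not> C y (s1 / 2)" if "y \<in> V1" for y
      using that V1(4,5) \<open>x \<in> V1\<close> \<open>0 < t\<close> \<open>t < s1\<close> by auto
    have "deffun (\<lambda>\<tau>. \<zeta> (\<tau>, s1 / 2))" by (intro deffun_compose[OF z] defpred_intros)
    then obtain V where V: "open V" "V \<noteq> {}" "V \<subseteq> V1" "continuous_on V (\<lambda>\<tau>. \<zeta> (\<tau>, s1 / 2))"
      using generic_continuity[OF _ V1(1,2)] by metis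
    then obtain y where "y \<in> V" by blast
    then have "C y (s1 / 2)" using V unfolding CI by (simp add: continuous_on_eq_continuous_at)
    then show False using n V(3) \<open>y \<in> V\<close> by blast
  qed
  obtain V2 s2 where V2: "open V2" "V2 \<noteq> {}" "V2 \<subseteq> V1" "s2 > 0"
    "(\<forall>x\<in>V2. \<forall>t. 0 < t \<and> t < s2 \<longrightarrow> U x t) \<or> (\<forall>x\<in>V2. \<forall>t. 0 < t \<and> t < s2 \<longrightarrow> \<not> U x t)"
    by (rule generic_eventually[OF dU V1(1,2)]) (rule that)
  obtain x d where x: "x \<in> V2" and d: "d > 0" "ball x d \<subseteq> V2"
    using V2(1,2) open_contains_ball by blast
  let ?\<sigma> = "min s1 s2"
  have cont: "continuous_on (ball x d) (\<lambda>\<tau>. \<zeta> (\<tau>, s))" if "0 < s" "s < s1" for s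
    using C[of _ s] that d V2(3) unfolding CI by (intro continuous_at_imp_continuous_on) auto
  have nU: "\<not> U y t" if y: "y \<in> ball x d" "0 < t" "t < s2" for y t
  proof
    assume "U y t"
    then have U: "U y t" if "y \<in> ball x d" "0 < t" "t < s2" for y t
      using that y d V2(5) by blast
    \<comment> \<open>Slope \<kappa> over the length d / 2 forces a rise of \<kappa> * (d / 2), but
      two values of modulus at most s differ by at most 2 * s, which is no more than half of
      that.\<close>
    define s where "s = min (?\<sigma> / 2) (\<kappa> * (d / 2) / 4)"
    have s: "0 < s" "s < s1" "s < s2" using V1(4) V2(4) d(1) \<kappa> by (auto simp: s_def min_def)
    have bW: "ball x d \<subseteq> W" using d(2) V2(3) V1(3) by blast
    have xd: "x + (d / 2) *\<^sub>R 1 \<in> ball x d" "x \<in> ball x d" using d(1) by (auto simp: dist_real_def)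
    have "\<kappa> * (d / 2) \<le> \<zeta> (x + (d / 2) *\<^sub>R 1, s) - \<zeta> (x, s)"
      using creeping_segment[of "ball x d" "\<lambda>\<tau>. \<zeta> (\<tau>, s)" x "d / 2" 1 \<kappa>] cont[OF s(1,2)] xd d(1) U[OF _ s(1,3)]
      unfolding U_def by simp
    moreover have "\<bar>\<zeta> (x + (d / 2) *\<^sub>R 1, s)\<bar> \<le> s" "\<bar>\<zeta> (x, s)\<bar> \<le> s"
      by (intro small subsetD[OF bW] xd s(1))+
    moreover have "2 * s \<le> \<kappa> * (d / 2) / 2" by (simp add: s_def min_def)
    moreover have "\<kappa> * (d / 2) > 0" using d \<kappa> by simp
    ultimately show False by linarith
  qed
  have "\<zeta> (\<tau>', s) - \<zeta> (\<tau>, s) \<le> \<kappa> * (\<tau>' - \<tau>)"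
    if t: "\<tau> \<in> ball x d" "\<tau>' \<in> ball x d" "\<tau> \<le> \<tau>'" "0 < s" "s < ?\<sigma>" for \<tau> \<tau>' s
  proof -
    have "\<forall>\<^sub>F h in at_right 0. - \<zeta> (y, s) + (- \<kappa>) * h \<le> - \<zeta> (y + h *\<^sub>R 1, s)" if y: "y \<in> ball x d" for y
    proof -
      have "defpred (\<lambda>h. \<zeta> (y, s) + \<kappa> * h \<le> \<zeta> (y + h, s))"
        by (intro defpred_intros deffun_compose[OF z])
      from defpred_eventually[OF this, of 0] nU[OF y t(4)] t(5)
      have "\<forall>\<^sub>F h in at_right 0. \<not> \<zeta> (y, s) + \<kappa> * h \<le> \<zeta> (y + h, s)"
        unfolding U_def by simp
      then show ?thesis by eventually_elim simp
    qed
    then have "(- \<kappa>) * (\<tau>' - \<tau>) \<le> - \<zeta> (\<tau> + (\<tau>' - \<tau>) *\<^sub>R 1, s) - - \<zeta> (\<tau>, s)"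
      using cont[of s] t by (intro creeping_segment[of "ball x d"] continuous_on_minus) auto
    then show ?thesis by simp
  qed
  moreover have "x \<in> ball x d" using d by simp
  ultimately show ?thesis
    using d V2(3,4) V1(3,4) by (intro that[of "ball x d" ?\<sigma>]) auto
qed

lemma vanishing_slope:
  fixes \<zeta> :: "real \<times> real \<Rightarrow> real"
  assumes z: "deffun \<zeta>" and W: "open W" "W \<noteq> {}"
    and small: "\<And>\<tau> s. \<tau> \<in> W \<Longrightarrow> 0 < s \<Longrightarrow> \<bar>\<zeta> (\<tau>, s)\<bar> \<le> s" and \<kappa>: "\<kappa> > 0"
  obtains V \<sigma> where "open V" "V \<noteq> {}" "V \<subseteq> W" "\<sigma> > 0"
    "\<And>\<tau> \<tau>' s. \<tau> \<in> V \<Longrightarrow> \<tau>' \<in> V \<Longrightarrow> 0 < s \<Longrightarrow> s < \<sigma> \<Longrightarrow> \<bar>\<zeta> (\<tau>', s) - \<zeta> (\<tau>, s)\<bar> \<le> \<kappa> * \<bar>\<tau>' - \<tau>\<bar>"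
proof -
  obtain V1 s1 where V1: "open V1" "V1 \<noteq> {}" "V1 \<subseteq> W" "s1 > 0"
    "\<And>\<tau> \<tau>' s. \<tau> \<in> V1 \<Longrightarrow> \<tau>' \<in> V1 \<Longrightarrow> \<tau> \<le> \<tau>' \<Longrightarrow> 0 < s \<Longrightarrow> s < s1 \<Longrightarrow> \<zeta> (\<tau>', s) - \<zeta> (\<tau>, s) \<le> \<kappa> * (\<tau>' - \<tau>)"
    by (rule vanishing_slope_half[OF z W _ \<kappa>], rule small, assumption+, rule that)
  have z': "deffun (\<lambda>p. - \<zeta> p)" by (intro defpred_intros z)
  have small': "\<bar>- \<zeta> (\<tau>, s)\<bar> \<le> s" if "\<tau> \<in> V1" "0 < s" for \<tau> s
    using small[of \<tau> s] that V1(3) by auto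
  obtain V2 s2 where V2: "open V2" "V2 \<noteq> {}" "V2 \<subseteq> V1" "s2 > 0"
    "\<And>\<tau> \<tau>' s. \<tau> \<in> V2 \<Longrightarrow> \<tau>' \<in> V2 \<Longrightarrow> \<tau> \<le> \<tau>' \<Longrightarrow> 0 < s \<Longrightarrow> s < s2 \<Longrightarrow> - \<zeta> (\<tau>', s) - - \<zeta> (\<tau>, s) \<le> \<kappa> * (\<tau>' - \<tau>)"
    by (rule vanishing_slope_half[OF z' V1(1,2) _ \<kappa>], rule small', assumption+, rule that)
  have ord: "\<bar>\<zeta> (\<tau>', s) - \<zeta> (\<tau>, s)\<bar> \<le> \<kappa> * \<bar>\<tau>' - \<tau>\<bar>"
    if "\<tau> \<in> V2" "\<tau>' \<in> V2" "0 < s" "s < min s1 s2" "\<tau> \<le> \<tau>'" for \<tau> \<tau>' s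
  proof -
    have "\<tau> \<in> V1" "\<tau>' \<in> V1" using that(1,2) V2(3) by auto
    then show ?thesis using V1(5)[of \<tau> \<tau>' s] V2(5)[of \<tau> \<tau>' s] that by simp
  qed
  have "\<bar>\<zeta> (\<tau>', s) - \<zeta> (\<tau>, s)\<bar> \<le> \<kappa> * \<bar>\<tau>' - \<tau>\<bar>"
    if "\<tau> \<in> V2" "\<tau>' \<in> V2" "0 < s" "s < min s1 s2" for \<tau> \<tau>' s
  proof (cases "\<tau> \<le> \<tau>'")
    case True
    then show ?thesis using ord that by blast
  next
    case False
    then have "\<tau>' \<le> \<tau>" by simp
    then show ?thesis using ord[OF that(2,1,3,4)] by (simp add: abs_minus_commute)
  qed
  then show ?thesis using V2 V1(3,4) by (intro that[of V2 "min s1 s2"]) auto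
qed

lemma vanishing_slope_vec:
  fixes \<zeta> :: "real \<times> real \<Rightarrow> 'b::euclidean_space"
  assumes z: "deffun \<zeta>" and W: "open W" "W \<noteq> {}"
    and small: "\<And>\<tau> s. \<tau> \<in> W \<Longrightarrow> 0 < s \<Longrightarrow> norm (\<zeta> (\<tau>, s)) \<le> s" and \<kappa>: "\<kappa> > 0"
  obtains V \<sigma> where "open V" "V \<noteq> {}" "V \<subseteq> W" "\<sigma> > 0"
    "\<And>\<tau> \<tau>' s. \<tau> \<in> V \<Longrightarrow> \<tau>' \<in> V \<Longrightarrow> 0 < s \<Longrightarrow> s < \<sigma> \<Longrightarrow> norm (\<zeta> (\<tau>', s) - \<zeta> (\<tau>, s)) \<le> \<kappa> * \<bar>\<tau>' - \<tau>\<bar>"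
proof -
  let ?\<kappa> = "\<kappa> / DIM('b)"
  have k: "?\<kappa> > 0" using \<kappa> by simp
  define ok where "ok J V \<sigma> \<longleftrightarrow> open V \<and> V \<noteq> {} \<and> V \<subseteq> W \<and> \<sigma> > 0 \<and> (\<forall>b\<in>J. \<forall>\<tau>\<in>V. \<forall>\<tau>'\<in>V. \<forall>s. 0 < s \<and> s < \<sigma> \<longrightarrow>
     \<bar>\<zeta> (\<tau>', s) \<bullet> b - \<zeta> (\<tau>, s) \<bullet> b\<bar> \<le> ?\<kappa> * \<bar>\<tau>' - \<tau>\<bar>)" for J V and \<sigma> :: real
  have "\<exists>V \<sigma>. ok J V \<sigma>" if "finite J" "J \<subseteq> Basis" for J
    using that
  proof (induction J rule: finite_induct)
    case empty
    then show ?case unfolding ok_def using W by (intro exI[of _ W] exI[of _ 1]) auto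
  next
    case (insert b J)
    then obtain V \<sigma> where ok: "ok J V \<sigma>" by auto
    then have V: "open V" "V \<noteq> {}" "V \<subseteq> W" "\<sigma> > 0" unfolding ok_def by auto
    have b: "b \<in> Basis" using insert.prems by simp
    have zb: "deffun (\<lambda>p. \<zeta> p \<bullet> b)" by (intro deffun_inner_Basis z b)
    have sb: "\<bar>\<zeta> (\<tau>, s) \<bullet> b\<bar> \<le> s" if "\<tau> \<in> V" "0 < s" for \<tau> s
      using small[of \<tau> s] that V(3) Basis_le_norm[OF b, of "\<zeta> (\<tau>, s)"] by auto
    obtain V' \<sigma>' where V': "open V'" "V' \<noteq> {}" "V' \<subseteq> V" "\<sigma>' > 0"
      "\<And>\<tau> \<tau>' s. \<tau> \<in> V' \<Longrightarrow> \<tau>' \<in> V' \<Longrightarrow> 0 < s \<Longrightarrow> s < \<sigma>' \<Longrightarrow> \<bar>\<zeta> (\<tau>', s) \<bullet> b - \<zeta> (\<tau>, s) \<bullet> b\<bar> \<le> ?\<kappa> * \<bar>\<tau>' - \<tau>\<bar>"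
      by (rule vanishing_slope[OF zb V(1,2) _ k], rule sb, assumption+, rule that)
    have "ok (insert b J) V' (min \<sigma> \<sigma>')"
      unfolding ok_def
    proof (intro conjI ballI allI impI)
      fix c \<tau> \<tau>' s assume *: "c \<in> insert b J" "\<tau> \<in> V'" "\<tau>' \<in> V'" "0 < s \<and> s < min \<sigma> \<sigma>'"
      show "\<bar>\<zeta> (\<tau>', s) \<bullet> c - \<zeta> (\<tau>, s) \<bullet> c\<bar> \<le> ?\<kappa> * \<bar>\<tau>' - \<tau>\<bar>"
      proof (cases "c = b")
        case True
        then show ?thesis using V'(5)[of \<tau> \<tau>' s] * by simp
      next
        case False
        then have "c \<in> J" "\<tau> \<in> V" "\<tau>' \<in> V" "0 < s \<and> s < \<sigma>" using * V'(3) by auto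
        then show ?thesis using ok unfolding ok_def by blast
      qed
    qed (use V V' in auto)
    then show ?case by blast
  qed
  from this[OF finite_Basis order_refl] obtain V \<sigma> where "ok Basis V \<sigma>" by blast
  then have V: "open V" "V \<noteq> {}" "V \<subseteq> W" "\<sigma> > 0"
    and ok: "\<And>b \<tau> \<tau>' s. b \<in> Basis \<Longrightarrow> \<tau> \<in> V \<Longrightarrow> \<tau>' \<in> V \<Longrightarrow> 0 < s \<Longrightarrow> s < \<sigma> \<Longrightarrow>
     \<bar>\<zeta> (\<tau>', s) \<bullet> b - \<zeta> (\<tau>, s) \<bullet> b\<bar> \<le> ?\<kappa> * \<bar>\<tau>' - \<tau>\<bar>"
    unfolding ok_def by blast+
  have "norm (\<zeta> (\<tau>', s) - \<zeta> (\<tau>, s)) \<le> \<kappa> * \<bar>\<tau>' - \<tau>\<bar>"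
    if t: "\<tau> \<in> V" "\<tau>' \<in> V" "0 < s" "s < \<sigma>" for \<tau> \<tau>' s
  proof -
    have "norm (\<zeta> (\<tau>', s) - \<zeta> (\<tau>, s)) \<le> (\<Sum>b\<in>Basis. \<bar>(\<zeta> (\<tau>', s) - \<zeta> (\<tau>, s)) \<bullet> b\<bar>)"
      by (rule norm_le_l1)
    also have "\<dots> \<le> (\<Sum>b\<in>(Basis::'b set). ?\<kappa> * \<bar>\<tau>' - \<tau>\<bar>)"
      using ok[OF _ t] by (intro sum_mono) (simp add: inner_diff_left)
    finally show ?thesis by simp
  qed
  then show ?thesis by (intro that[OF V]) auto
qed

end

section \<open>Clarke derivatives of definable Lipschitz functions\<close>

lemma le_of_small_perturbation:
  fixes a b m r :: real
  assumes "r > 0" "\<And>d. 0 < d \<Longrightarrow> d < r \<Longrightarrow> a \<le> b + m * d"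
  shows "a \<le> b"
proof (rule tendsto_lowerbound)
  show "((\<lambda>d. b + m * d) \<longlongrightarrow> b) (at_right 0)"
    by (auto intro!: tendsto_eq_intros)
  show "\<forall>\<^sub>F d in at_right 0. a \<le> b + m * d"
    using assms by (intro eventually_at_rightI[of 0 r]) auto
qed simp

locale definable_lipschitz = omin S for S +
  fixes g :: "'a::euclidean_space \<Rightarrow> real" and L :: real
  assumes deffun_g: "deffun g" and lip: "\<bar>g x - g y\<bar> \<le> L * norm (x - y)" and L_pos: "0 < L"
begin

text \<open>The upper Clarke derivative of \<open>g\<close> at \<open>x\<close> in direction \<open>d\<close> is at least \<open>q\<close>.\<close>

definition clarke_ge :: "'a \<Rightarrow> 'a \<Rightarrow> real \<Rightarrow> bool" where
  "clarke_ge x d q \<longleftrightarrow> (\<forall>\<delta>>0. \<exists>z t. norm (z - x) < \<delta> \<and> 0 < t \<and> t < \<delta> \<and> g z + (q - \<delta>) * t \<le> g (z + t *\<^sub>R d))"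

text \<open>The vector \<open>v\<close> is tangent to \<open>A\<close> at \<open>x\<close>, along points at which \<open>g\<close> grows at most at rate \<open>p\<close>.\<close>

definition tangent_le :: "'a set \<Rightarrow> 'a \<Rightarrow> 'a \<Rightarrow> real \<Rightarrow> bool" where
  "tangent_le A x v p \<longleftrightarrow> (\<forall>\<delta>>0. \<exists>y\<in>A. \<exists>h. 0 < h \<and> h < \<delta> \<and> norm (y - x - h *\<^sub>R v) \<le> \<delta> * h \<and> g y - g x \<le> (p + \<delta>) * h)"

text \<open>At bad points the chain rule along \<open>A\<close> fails by at least \<open>\<eta>\<close>.\<close>

definition bad :: "real \<Rightarrow> real \<Rightarrow> 'a set \<Rightarrow> 'a set" where
  "bad \<eta> K A = {x \<in> A. \<exists>v p. norm v \<le> K \<and> clarke_ge x v (p + \<eta>) \<and> tangent_le A x v p}"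

text \<open>An o-minimal substitute for a right derivative of at least q: since the condition on h
  is definable, its failure means the strict opposite inequality for all small h.\<close>

definition steep :: "'a \<Rightarrow> real \<Rightarrow> 'a \<Rightarrow> bool" where
  "steep v q z \<longleftrightarrow> (\<forall>\<^sub>F h in at_right 0. g z + q * h \<le> g (z + h *\<^sub>R v))"

lemma defpred_clarke_ge: "deffun e \<Longrightarrow> deffun d \<Longrightarrow> deffun q \<Longrightarrow> defpred (\<lambda>x. clarke_ge (e x) (d x) (q x))"
proof -
  have "defpred (\<lambda>p. clarke_ge (fst p) (fst (snd p)) (snd (snd p)))"
    unfolding clarke_ge_def by (intro defpred_intros deffun_compose[OF deffun_g])
  from defpred_compose[OF this] show "deffun e \<Longrightarrow> deffun d \<Longrightarrow> deffun q \<Longrightarrow> defpred (\<lambda>x. clarke_ge (e x) (d x) (q x))"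
    by (fastforce intro: deffun_Pair)
qed

lemma defset_bad:
  assumes "defset A"
  shows "defset (bad \<eta> K A)"
  unfolding bad_def tangent_le_def mem_Collect_eq
  by (intro defpred_intros defpred_clarke_ge deffun_compose[OF deffun_g] defpred_mem[OF assms])

lemma defpred_steep: "deffun e \<Longrightarrow> defpred (\<lambda>x. steep v q (e x))"
proof -
  have "defpred (steep v q)"
    unfolding steep_def by (intro defpred_eventually_right defpred_intros deffun_compose[OF deffun_g])
  then show "deffun e \<Longrightarrow> defpred (\<lambda>x. steep v q (e x))" by (rule defpred_compose)
qed

lemma bad_mono: "A \<subseteq> B \<Longrightarrow> bad \<eta> K A \<subseteq> bad \<eta> K B"
  unfolding bad_def tangent_le_def by blast

lemma continuous_on_g: "continuous_on X g"
proof -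
  have "L-lipschitz_on X g"
    using lip L_pos by (intro lipschitz_onI) (auto simp: dist_norm)
  then show ?thesis by (rule lipschitz_on_continuous_on)
qed

lemma clarke_ge_mono: "clarke_ge x d q \<Longrightarrow> q' \<le> q \<Longrightarrow> clarke_ge x d q'"
  unfolding clarke_ge_def by (meson add_left_mono diff_right_mono less_imp_le mult_right_mono order_trans)

lemma clarke_ge_perturb:
  assumes "clarke_ge x d q" "L * norm (d - d') \<le> e"
  shows "clarke_ge x d' (q - e)"
  unfolding clarke_ge_def
proof (intro allI impI)
  fix \<delta> :: real assume "\<delta> > 0"
  then obtain z t where z: "norm (z - x) < \<delta>" "0 < t" "t < \<delta>" "g z + (q - \<delta>) * t \<le> g (z + t *\<^sub>R d)"
    using assms(1) unfolding clarke_ge_def by blast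
  have "g (z + t *\<^sub>R d) - g (z + t *\<^sub>R d') \<le> L * norm ((z + t *\<^sub>R d) - (z + t *\<^sub>R d'))"
    using lip[of "z + t *\<^sub>R d" "z + t *\<^sub>R d'"] by linarith
  also have "(z + t *\<^sub>R d) - (z + t *\<^sub>R d') = t *\<^sub>R (d - d')" by (simp add: algebra_simps)
  also have "L * norm (t *\<^sub>R (d - d')) = t * (L * norm (d - d'))" using z(2) by simp
  also have "\<dots> \<le> t * e" using assms(2) z(2) by simp
  finally have "g z + (q - e - \<delta>) * t \<le> g (z + t *\<^sub>R d')"
    using z(4) by (simp add: algebra_simps)
  then show "\<exists>z t. norm (z - x) < \<delta> \<and> 0 < t \<and> t < \<delta> \<and> g z + (q - e - \<delta>) * t \<le> g (z + t *\<^sub>R d')"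
    using z by blast
qed

text \<open>A mean value argument: if g were nowhere steep on the segment from z to z + t v,
  creeping applied to -g would bound the increment by q * t, less than what the Clarke condition
  guarantees.\<close>

lemma clarke_ge_steep:
  assumes c: "clarke_ge x v q'" and q: "q < q'" and s: "s > 0"
  shows "\<exists>z. norm (z - x) < s \<and> steep v q z"
proof -
  \<comment> \<open>The first bound keeps the segment within s of x, the second keeps q' - \<delta>
    above q.\<close>
  define \<delta> where "\<delta> = min (s / (2 * (1 + norm v))) ((q' - q) / 2)"
  have \<delta>: "\<delta> \<le> s / (2 * (1 + norm v))" "\<delta> \<le> (q' - q) / 2" unfolding \<delta>_def by (rule min.cobounded1, rule min.cobounded2)
  have "0 < 1 + norm v" by (simp add: add_pos_nonneg)
  then have d: "\<delta> > 0" using q s by (simp add: \<delta>_def)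
  then obtain z t where z: "norm (z - x) < \<delta>" "0 < t" "t < \<delta>" "g z + (q' - \<delta>) * t \<le> g (z + t *\<^sub>R v)"
    using c unfolding clarke_ge_def by blast
  have "\<exists>\<tau>. 0 \<le> \<tau> \<and> \<tau> < t \<and> steep v q (z + \<tau> *\<^sub>R v)"
  proof (rule ccontr)
    assume none: "\<not> ?thesis"
    have "(- q) * (t - 0) \<le> - g (z + t *\<^sub>R v) - - g (z + 0 *\<^sub>R v)"
    proof (rule creeping)
      show "continuous_on {0..t} (\<lambda>\<tau>. - g (z + \<tau> *\<^sub>R v))"
        by (intro continuous_intros continuous_on_compose2[OF continuous_on_g[of UNIV]]) auto
      fix \<tau> assume "0 \<le> \<tau>" "\<tau> < t"
      then have "\<not> steep v q (z + \<tau> *\<^sub>R v)" using none by blast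
      moreover have "defpred (\<lambda>h. g (z + \<tau> *\<^sub>R v) + q * h \<le> g (z + \<tau> *\<^sub>R v + h *\<^sub>R v))"
        by (intro defpred_intros deffun_compose[OF deffun_g])
      ultimately have "\<forall>\<^sub>F h in at_right 0. \<not> g (z + \<tau> *\<^sub>R v) + q * h \<le> g (z + \<tau> *\<^sub>R v + h *\<^sub>R v)"
        unfolding steep_def using defpred_eventually by blast
      then show "\<forall>\<^sub>F h in at_right 0. - g (z + \<tau> *\<^sub>R v) + (- q) * h \<le> - g (z + (\<tau> + h) *\<^sub>R v)"
        by eventually_elim (simp add: scaleR_left_distrib add.assoc)
    qed (use z in auto)
    then have "g (z + t *\<^sub>R v) \<le> g z + q * t" by simp
    then have "(q' - \<delta>) * t \<le> q * t" using z(4) by linarith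
    then have "q' - \<delta> \<le> q" using z(2) by simp
    then have "q' - q \<le> (q' - q) / 2" using \<delta>(2) by simp
    then show False using q by simp
  qed
  then obtain \<tau> where \<tau>: "0 \<le> \<tau>" "\<tau> < t" "steep v q (z + \<tau> *\<^sub>R v)" by blast
  have "norm (z + \<tau> *\<^sub>R v - x) \<le> norm (z - x) + \<tau> * norm v"
    using norm_triangle_ineq[of "z - x" "\<tau> *\<^sub>R v"] \<tau>(1) by (simp add: algebra_simps)
  also have "\<dots> \<le> norm (z - x) + \<delta> * norm v"
    using \<tau> z(3) by (intro add_left_mono mult_right_mono) auto
  also have "\<dots> < \<delta> * (1 + norm v)"
    using z(1) by (simp add: algebra_simps)
  also have "\<dots> \<le> (s / (2 * (1 + norm v))) * (1 + norm v)"
    using \<delta>(1) by (intro mult_right_mono) auto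
  also have "\<dots> \<le> s"
    using s \<open>0 < 1 + norm v\<close> by (simp add: field_simps)
  finally show ?thesis using \<tau>(3) by blast
qed

text \<open>Choose points at which \<open>g\<close> is steep in direction \<open>v\<close>, at distance less than \<open>s\<close> from the
  points \<open>\<Phi> u\<close>. Along a segment the offsets have small slope for small \<open>s\<close>, so \<open>g\<close> is steep along
  the shifted curve, and then also along the limit curve \<open>\<Phi>\<close>.\<close>

lemma steep_limit:
  fixes \<Phi> :: "'a \<Rightarrow> 'a"
  assumes P: "deffun \<Phi>" and W: "open W" "W \<noteq> {}" and \<kappa>: "\<kappa> > 0"
    and N: "\<And>u t. u \<in> W \<Longrightarrow> u + t *\<^sub>R w \<in> W \<Longrightarrow> 0 \<le> t \<Longrightarrow> norm (\<Phi> (u + t *\<^sub>R w) - \<Phi> u - t *\<^sub>R v) \<le> \<kappa> * t"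
    and G: "\<And>u t. u \<in> W \<Longrightarrow> u + t *\<^sub>R w \<in> W \<Longrightarrow> 0 \<le> t \<Longrightarrow> g (\<Phi> (u + t *\<^sub>R w)) - g (\<Phi> u) \<le> (p + \<kappa>) * t"
    and D: "\<And>u s. u \<in> W \<Longrightarrow> s > 0 \<Longrightarrow> \<exists>z. norm (z - \<Phi> u) < s \<and> steep v q z"
  shows "q \<le> p + \<kappa> + 2 * L * \<kappa>"
proof -
  obtain u0 where u0: "u0 \<in> W" using W by blast
  define J where "J = {t. u0 + t *\<^sub>R w \<in> W}"
  define u where "u t = \<Phi> (u0 + t *\<^sub>R w)" for t
  have du: "deffun u" unfolding u_def by (intro deffun_compose[OF P] defpred_intros)
  have J: "open J" "J \<noteq> {}"
  proof -
    have "continuous_on UNIV (\<lambda>t. u0 + t *\<^sub>R w)" by (intro continuous_intros)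
    from open_vimage[OF W(1) this] show "open J" by (simp add: J_def vimage_def)
    show "J \<noteq> {}" using u0 by (auto simp: J_def intro!: exI[of _ 0])
  qed
  have uN: "norm (u t' - u t - (t' - t) *\<^sub>R v) \<le> \<kappa> * (t' - t)" if "t \<in> J" "t' \<in> J" "t \<le> t'" for t t'
    using N[of "u0 + t *\<^sub>R w" "t' - t"] that by (simp add: J_def u_def add.assoc flip: scaleR_left_distrib)
  have uG: "g (u t') - g (u t) \<le> (p + \<kappa>) * (t' - t)" if "t \<in> J" "t' \<in> J" "t \<le> t'" for t t'
    using G[of "u0 + t *\<^sub>R w" "t' - t"] that by (simp add: J_def u_def add.assoc flip: scaleR_left_distrib)
  \<comment> \<open>The offset is selected rather than the point, as a function of (t, s), so that
    it tends to 0 with s as \<open>vanishing_slope_vec\<close> demands. The bound by 1 serves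
    \<open>definable_choice\<close>.\<close>
  let ?Z = "\<lambda>(x::real \<times> real) y. norm y < snd x \<and> norm y \<le> 1 \<and> steep v q (u (fst x) + y)"
  have dZ: "defpred (\<lambda>x. ?Z (fst x) (snd x))"
    by (intro defpred_intros defpred_steep deffun_compose[OF du])
  obtain \<zeta> where dz: "deffun \<zeta>" and z: "\<And>x y. ?Z x y \<Longrightarrow> ?Z x (\<zeta> x)"
    using definable_choice[OF dZ, of 1] by blast
  have z': "norm (\<zeta> (t, s)) < s" "steep v q (u t + \<zeta> (t, s))" if tJ: "t \<in> J" "0 < s" for t s
  proof -
    obtain y where "norm (y - u t) < min s 1" "steep v q y"
      using D[of "u0 + t *\<^sub>R w" "min s 1"] tJ by (auto simp: J_def u_def)
    then have "?Z (t, s) (y - u t)" by simp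
    then have "?Z (t, s) (\<zeta> (t, s))" by (rule z)
    then show "norm (\<zeta> (t, s)) < s" "steep v q (u t + \<zeta> (t, s))" by auto
  qed
  have small: "norm (\<zeta> (t, s)) \<le> s" if "t \<in> J" "0 < s" for t s
    using z'(1)[OF that] by simp
  obtain V \<sigma> where V: "open V" "V \<noteq> {}" "V \<subseteq> J" "\<sigma> > 0"
    and slope: "\<And>t t' s. t \<in> V \<Longrightarrow> t' \<in> V \<Longrightarrow> 0 < s \<Longrightarrow> s < \<sigma> \<Longrightarrow> norm (\<zeta> (t', s) - \<zeta> (t, s)) \<le> \<kappa> * \<bar>t' - t\<bar>"
    by (rule vanishing_slope_vec[OF dz J _ \<kappa>], rule small, assumption+, rule that)
  obtain a where "a \<in> V" using V by blast
  then obtain e where e: "e > 0" "cball a e \<subseteq> V" using V(1) open_contains_cball by blast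
  have ab: "t \<in> V" "t \<in> J" if "a \<le> t" "t \<le> a + e" for t
  proof -
    have "t \<in> cball a e" using that by (simp add: dist_real_def)
    then show "t \<in> V" "t \<in> J" using e V by auto
  qed
  \<comment> \<open>The interval [a, a + e] stays fixed while s tends to 0. The shifted curve
    deviates from direction v at rate 2 * \<kappa>, one \<kappa> from \<Phi> and one from the
    offsets, which costs 2 * L * \<kappa>; undoing the shift at the two endpoints costs L * s
    each.\<close>
  have main: "q * e \<le> (p + \<kappa> + 2 * L * \<kappa>) * e + (2 * L) * s" if s: "0 < s" "s < \<sigma>" for s
  proof -
    let ?G = "\<lambda>t. u t + \<zeta> (t, s)"
    have G2: "norm (?G t' - ?G t - (t' - t) *\<^sub>R v) \<le> 2 * \<kappa> * (t' - t)"
      if "a \<le> t" "t \<le> t'" "t' \<le> a + e" for t t'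
    proof -
      have "?G t' - ?G t - (t' - t) *\<^sub>R v = (u t' - u t - (t' - t) *\<^sub>R v) + (\<zeta> (t', s) - \<zeta> (t, s))" by simp
      also have "norm \<dots> \<le> \<kappa> * (t' - t) + \<kappa> * \<bar>t' - t\<bar>"
        using uN[of t t'] slope[of t t' s] ab[of t] ab[of t'] that s
        by (intro norm_triangle_le add_mono) auto
      finally show ?thesis using that by simp
    qed
    have Glip: "norm (?G t' - ?G t) \<le> (2 * \<kappa> + norm v) * (t' - t)"
      if "a \<le> t" "t \<le> t'" "t' \<le> a + e" for t t'
    proof -
      have "norm (?G t' - ?G t) \<le> norm (?G t' - ?G t - (t' - t) *\<^sub>R v) + norm ((t' - t) *\<^sub>R v)"
        using norm_triangle_ineq[of "?G t' - ?G t - (t' - t) *\<^sub>R v" "(t' - t) *\<^sub>R v"] by simp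
      also have "\<dots> \<le> 2 * \<kappa> * (t' - t) + (t' - t) * norm v"
        using G2[OF that] that by simp
      finally show ?thesis by (simp add: algebra_simps)
    qed
    have "(2 * \<kappa> + norm v)-lipschitz_on {a..a + e} ?G"
    proof (rule lipschitz_onI)
      fix t t' assume t: "t \<in> {a..a + e}" "t' \<in> {a..a + e}"
      show "dist (?G t) (?G t') \<le> (2 * \<kappa> + norm v) * dist t t'"
      proof (cases "t \<le> t'")
        case True
        then show ?thesis using Glip[of t t'] t by (simp add: dist_norm norm_minus_commute)
      next
        case False
        then show ?thesis using Glip[of t' t] t by (simp add: dist_norm)
      qed
    qed (use \<kappa> in simp)
    then have contG: "continuous_on {a..a + e} ?G" by (rule lipschitz_on_continuous_on)
    have "(q - 2 * L * \<kappa>) * (a + e - a) \<le> g (?G (a + e)) - g (?G a)"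
    proof (rule creeping)
      show "continuous_on {a..a + e} (\<lambda>t. g (?G t))"
        by (intro continuous_on_compose2[OF continuous_on_g[of UNIV] contG]) auto
      fix t assume t: "a \<le> t" "t < a + e"
      have "steep v q (?G t)" using z'(2) ab t s(1) by simp
      moreover have "\<forall>\<^sub>F h in at_right (0::real). h < a + e - t \<and> 0 < h"
        using t by (intro eventually_at_rightI[of 0 "a + e - t"]) auto
      ultimately show "\<forall>\<^sub>F h in at_right 0. g (?G t) + (q - 2 * L * \<kappa>) * h \<le> g (?G (t + h))"
        unfolding steep_def
      proof eventually_elim
        case (elim h)
        have "norm (?G (t + h) - ?G t - h *\<^sub>R v) \<le> 2 * \<kappa> * h"
          using G2[of t "t + h"] t elim by simp
        then have "L * norm (?G t + h *\<^sub>R v - ?G (t + h)) \<le> L * (2 * \<kappa> * h)"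
          using L_pos by (simp add: norm_minus_commute diff_diff_add)
        then have "g (?G t + h *\<^sub>R v) - g (?G (t + h)) \<le> 2 * L * \<kappa> * h"
          using lip[of "?G t + h *\<^sub>R v" "?G (t + h)"] by simp
        with elim show ?case by (simp add: algebra_simps)
      qed
    qed (use e contG in auto)
    moreover have "\<bar>g (?G t) - g (u t)\<bar> \<le> L * s" if "a \<le> t" "t \<le> a + e" for t
    proof -
      have "\<bar>g (?G t) - g (u t)\<bar> \<le> L * norm (\<zeta> (t, s))" using lip[of "?G t" "u t"] by simp
      also have "\<dots> \<le> L * s" using small[of t s] ab that s(1) L_pos by simp
      finally show ?thesis .
    qed
    from this[of a] this[of "a + e"]
    have "\<bar>g (?G a) - g (u a)\<bar> \<le> L * s" "\<bar>g (?G (a + e)) - g (u (a + e))\<bar> \<le> L * s"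
      using e(1) by auto
    moreover have "g (u (a + e)) - g (u a) \<le> (p + \<kappa>) * e"
      using uG[of a "a + e"] ab e(1) by simp
    ultimately show ?thesis by (simp add: algebra_simps)
  qed
  have "q * e \<le> (p + \<kappa> + 2 * L * \<kappa>) * e"
    using le_of_small_perturbation[OF V(4) main] .
  then show ?thesis using e(1) by simp
qed

end

section \<open>Coordinate projections and bad points on definable graphs\<close>

definition coord_proj :: "'a::euclidean_space set \<Rightarrow> 'a \<Rightarrow> 'a" where
  "coord_proj I x = (\<Sum>i\<in>I. (x \<bullet> i) *\<^sub>R i)"

lemma coord_proj_inner:
  assumes "I \<subseteq> Basis" "j \<in> Basis"
  shows "coord_proj I x \<bullet> j = (if j \<in> I then x \<bullet> j else 0)"
proof -
  have fin: "finite I" using assms(1) finite_Basis finite_subset by blast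
  have "coord_proj I x \<bullet> j = (\<Sum>i\<in>I. if i = j then x \<bullet> j else 0)"
    unfolding coord_proj_def inner_sum_left using assms
    by (intro sum.cong) (auto simp: inner_Basis)
  then show ?thesis using fin by simp
qed

lemma norm_coord_proj_le:
  assumes "I \<subseteq> Basis"
  shows "norm (coord_proj I x) \<le> norm x"
  using assms by (intro norm_le_componentwise) (simp add: coord_proj_inner)

lemma linear_coord_proj: "linear (coord_proj I)"
  by (rule linearI) (simp_all add: coord_proj_def inner_add_left scaleR_left_distrib sum.distrib scaleR_sum_right)

context omin
begin

lemma defpred_agree: "I \<subseteq> Basis \<Longrightarrow> deffun e \<Longrightarrow> deffun d \<Longrightarrow> defpred (\<lambda>x. agree I (e x) (d x))"
  unfolding agree_def
  by (intro defpred_finite_all defpred_eq deffun_inner_Basis) (auto intro: finite_subset[OF _ finite_Basis])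

end

context definable_lipschitz
begin

text \<open>Over a generic point of the base, a definable graph is almost linear, and \<open>g\<close> is almost
  linear along it. At a bad point the Clarke derivative exceeds this linear rate in a direction
  tangent to the graph, which contradicts the preceding lemma.\<close>

lemma bad_graph:
  fixes C :: "'a set"
  assumes I: "I \<subseteq> Basis" and C: "defset C" and graph: "\<And>x y. x \<in> C \<Longrightarrow> y \<in> C \<Longrightarrow> agree I x y \<Longrightarrow> x = y"
    and W: "open W" "W \<noteq> {}" and \<eta>: "\<eta> > 0" and K: "K \<ge> 0"
  shows "\<exists>u\<in>W. \<forall>x\<in>bad \<eta> K C. \<not> agree I x u"
proof (rule ccontr)
  assume "\<not> ?thesis"
  then have badW: "\<exists>x\<in>bad \<eta> K C. agree I x u" if "u \<in> W" for u using that by blast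
  \<comment> \<open>\<Phi> lifts u to the point of \<open>C\<close> above it, with default 0 outside
    the projection of \<open>C\<close>.\<close>
  let ?R = "\<lambda>u x. x \<in> C \<and> agree I x u \<or> \<not> (\<exists>y. y \<in> C \<and> agree I y u) \<and> x = 0"
  have dR: "defpred (\<lambda>p. ?R (fst p) (snd p))"
    by (intro defpred_intros defpred_agree I defpred_mem[OF C])
  have "\<exists>!x. ?R u x" for u
  proof (cases "\<exists>y. y \<in> C \<and> agree I y u")
    case True
    moreover have "y = y'" if "y \<in> C" "agree I y u" "y' \<in> C" "agree I y' u" for y y'
      using that by (intro graph) (auto simp: agree_def)
    ultimately show ?thesis by blast
  qed blast
  then obtain \<Phi> where dP: "deffun \<Phi>" and RP: "\<And>u. ?R u (\<Phi> u)" using deffun_ex1[OF dR] by blast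
  have PC: "\<Phi> u = x" if "x \<in> C" "agree I x u" for x u
  proof -
    have "\<Phi> u \<in> C" "agree I (\<Phi> u) u" using RP[of u] that by blast+
    then show ?thesis using that by (intro graph) (auto simp: agree_def)
  qed
  have Pbad: "\<Phi> u \<in> bad \<eta> K C" "agree I (\<Phi> u) u" if uW: "u \<in> W" for u
  proof -
    obtain x where x: "x \<in> bad \<eta> K C" "agree I x u" using badW[OF uW] by blast
    then have "\<Phi> u = x" by (intro PC) (auto simp: bad_def)
    then show "\<Phi> u \<in> bad \<eta> K C" "agree I (\<Phi> u) u" using x by auto
  qed
  \<comment> \<open>The excess \<eta> at bad points shrinks in three stages: to \<eta> - \<eta> / 8
    in \<open>key\<close>, to \<eta> / 2 in \<open>cover\<close>, and to \<eta> / 4 for the strict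
    inequality in \<open>clarke_ge_steep\<close>. This \<kappa> makes the total error in
    \<open>steep_limit\<close> equal to \<eta> / 8, which is still smaller.\<close>
  define \<kappa> where "\<kappa> = \<eta> / 8 / ((K + 1) * (1 + 2 * L))"
  have den: "(K + 1) * (1 + 2 * L) > 0" using K L_pos by simp
  have \<kappa>: "\<kappa> > 0" using \<eta> den unfolding \<kappa>_def by (intro divide_pos_pos) auto
  have \<kappa>8: "\<kappa> * (K + 1) * (1 + 2 * L) = \<eta> / 8"
    using den unfolding \<kappa>_def mult.assoc by (metis less_irrefl nonzero_eq_divide_eq)
  obtain V1 N where V1: "open V1" "V1 \<noteq> {}" "V1 \<subseteq> W" and N: "bounded_linear N"
    and PN: "\<And>u u'. u \<in> V1 \<Longrightarrow> u' \<in> V1 \<Longrightarrow> norm (\<Phi> u' - \<Phi> u - N (u' - u)) \<le> \<kappa> * norm (u' - u)"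
    by (rule generic_linear_vec[OF dP W \<kappa>]) (rule that)
  have dgP: "deffun (\<lambda>u. g (\<Phi> u))" by (intro deffun_compose[OF deffun_g] dP)
  obtain V2 n where V2: "open V2" "V2 \<noteq> {}" "V2 \<subseteq> V1"
    and gn: "\<And>u u'. u \<in> V2 \<Longrightarrow> u' \<in> V2 \<Longrightarrow> \<bar>g (\<Phi> u') - g (\<Phi> u) - n \<bullet> (u' - u)\<bar> \<le> \<kappa> * norm (u' - u)"
    by (rule generic_linear[OF dgP V1(1,2) \<kappa>]) (rule that)
  obtain BN where BN: "BN > 0" "\<And>x. norm (N x) \<le> norm x * BN"
    using bounded_linear.pos_bounded[OF N] by blast
  have PI: "norm (coord_proj I x) \<le> norm x" for x :: 'a by (rule norm_coord_proj_le[OF I])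
  \<comment> \<open>The points y of \<open>C\<close> that witness tangency are \<Phi> u' with u'
    obtained by projecting the displacement y - \<Phi> u to the coordinates in I. Hence v is close
    to N w for the projection w of v, and p is at least n \<bullet> w up to a small error, so the
    arbitrary pair (v, p) is replaced by linear data.\<close>
  have key: "\<exists>w. norm w \<le> K \<and> clarke_ge (\<Phi> u) (N w) (n \<bullet> w + \<eta> - \<eta> / 8)" if u: "u \<in> V2" for u
  proof -
    obtain v p where v: "norm v \<le> K" and cv: "clarke_ge (\<Phi> u) v (p + \<eta>)" and tv: "tangent_le C (\<Phi> u) v p"
      using Pbad(1)[of u] u V1(3) V2(3) unfolding bad_def by blast
    define w where "w = coord_proj I v"
    obtain r where r: "r > 0" "ball u r \<subseteq> V2" using V2(1) u open_contains_ball by blast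
    define \<rho> where "\<rho> = min 1 (r / (K + 1))"
    have \<rho>: "\<rho> > 0" "\<rho> \<le> 1" "\<rho> * (K + 1) \<le> r"
    proof -
      show "\<rho> > 0" using r K by (simp add: \<rho>_def)
      show "\<rho> \<le> 1" unfolding \<rho>_def by (rule min.cobounded1)
      have "\<rho> * (K + 1) \<le> (r / (K + 1)) * (K + 1)"
        using K unfolding \<rho>_def by (intro mult_right_mono min.cobounded2) auto
      then show "\<rho> * (K + 1) \<le> r" using K by simp
    qed
    have near: "norm (v - N w) \<le> \<kappa> * K + (\<kappa> + 1 + BN) * \<delta> \<and>
        n \<bullet> w \<le> (p + \<kappa> * K) + (1 + norm n + \<kappa>) * \<delta>" if \<delta>: "0 < \<delta>" "\<delta> < \<rho>" for \<delta>
    proof -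
      obtain y h where y: "y \<in> C" and h: "0 < h" "h < \<delta>" and yh: "norm (y - \<Phi> u - h *\<^sub>R v) \<le> \<delta> * h"
        and gy: "g y - g (\<Phi> u) \<le> (p + \<delta>) * h"
        using tv \<delta>(1) unfolding tangent_le_def by blast
      define e where "e = y - \<Phi> u - h *\<^sub>R v"
      define u' where "u' = u + coord_proj I (y - \<Phi> u)"
      have yu: "norm (y - \<Phi> u) \<le> h * (K + \<delta>)"
      proof -
        have "y - \<Phi> u = h *\<^sub>R v + e" by (simp add: e_def)
        then have "norm (y - \<Phi> u) \<le> norm (h *\<^sub>R v) + norm e" using norm_triangle_ineq by metis
        also have "\<dots> \<le> h * K + \<delta> * h" using h(1) v yh by (intro add_mono) (auto simp: e_def)
        finally show ?thesis by (simp add: algebra_simps)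
      qed
      then have uu: "norm (u' - u) \<le> h * (K + \<delta>)"
        using PI[of "y - \<Phi> u"] by (simp add: u'_def)
      also have "\<dots> < \<rho> * (K + 1)"
        using h \<delta> K \<rho>(2) by (intro mult_less_le_imp_less) auto
      also have "\<dots> \<le> r" by (rule \<rho>(3))
      finally have "u' \<in> ball u r" by (simp add: dist_norm norm_minus_commute)
      then have u'V: "u' \<in> V2" using r by blast
      have "agree I y u'"
        unfolding agree_def
      proof
        fix i assume i: "i \<in> I"
        then have "i \<in> Basis" using I by blast
        then have "u' \<bullet> i = u \<bullet> i + (y - \<Phi> u) \<bullet> i"
          using i by (simp add: u'_def inner_add_left coord_proj_inner[OF I])
        moreover have "\<Phi> u \<bullet> i = u \<bullet> i" using Pbad(2)[of u] u V1(3) V2(3) i unfolding agree_def by blast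
        ultimately show "y \<bullet> i = u' \<bullet> i" by (simp add: inner_diff_left)
      qed
      then have Pu': "\<Phi> u' = y" using y by (intro PC)
      have "y - \<Phi> u = h *\<^sub>R v + e" by (simp add: e_def)
      then have uw: "u' - u = h *\<^sub>R w + coord_proj I e"
        by (simp add: u'_def w_def linear_add[OF linear_coord_proj] linear_scale[OF linear_coord_proj])
      have e: "norm e \<le> \<delta> * h" "norm (coord_proj I e) \<le> \<delta> * h"
        using yh PI[of e] by (auto simp: e_def)
      have \<kappa>u: "\<kappa> * norm (u' - u) \<le> \<kappa> * (h * (K + \<delta>))" using uu \<kappa> by simp
      have 1: "norm (y - \<Phi> u - N (u' - u)) \<le> \<kappa> * (h * (K + \<delta>))"
        using PN[of u u'] u u'V V2(3) \<kappa>u unfolding Pu' by force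
      have "h *\<^sub>R (v - N w) = (y - \<Phi> u - N (u' - u)) - e + N (coord_proj I e)"
        unfolding uw by (simp add: e_def algebra_simps linear_add[OF bounded_linear.linear[OF N]]
            linear_scale[OF bounded_linear.linear[OF N]])
      then have "norm (h *\<^sub>R (v - N w)) \<le> norm (y - \<Phi> u - N (u' - u)) + norm e + norm (N (coord_proj I e))"
        by (metis norm_triangle_mono norm_triangle_ineq4 order_refl)
      also have "\<dots> \<le> \<kappa> * (h * (K + \<delta>)) + \<delta> * h + (\<delta> * h) * BN"
        using 1 e BN(1) by (intro add_mono order_trans[OF BN(2)] mult_right_mono) auto
      also have "\<dots> = h * (\<kappa> * K + (\<kappa> + 1 + BN) * \<delta>)" by (simp add: algebra_simps)
      finally have A: "norm (v - N w) \<le> \<kappa> * K + (\<kappa> + 1 + BN) * \<delta>" using h(1) by simp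
      have "n \<bullet> (u' - u) - \<kappa> * (h * (K + \<delta>)) \<le> g y - g (\<Phi> u)"
        using gn[OF u u'V] \<kappa>u unfolding Pu' by linarith
      also note gy
      finally have "n \<bullet> (u' - u) \<le> (p + \<delta>) * h + \<kappa> * (h * (K + \<delta>))" by simp
      moreover have "h * (n \<bullet> w) - norm n * (\<delta> * h) \<le> n \<bullet> (u' - u)"
      proof -
        have "\<bar>n \<bullet> coord_proj I e\<bar> \<le> norm n * (\<delta> * h)"
          using e(2) by (intro order_trans[OF Cauchy_Schwarz_ineq2] mult_left_mono) auto
        then show ?thesis unfolding uw by (simp add: inner_add_right)
      qed
      ultimately have "h * (n \<bullet> w) \<le> h * ((p + \<kappa> * K) + (1 + norm n + \<kappa>) * \<delta>)"
        by (simp add: algebra_simps)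
      then have B: "n \<bullet> w \<le> (p + \<kappa> * K) + (1 + norm n + \<kappa>) * \<delta>" using h(1) by simp
      show ?thesis using A B by blast
    qed
    have A: "norm (v - N w) \<le> \<kappa> * K"
      by (rule le_of_small_perturbation[OF \<rho>(1) conjunct1[OF near]])
    have B: "n \<bullet> w \<le> p + \<kappa> * K"
      by (rule le_of_small_perturbation[OF \<rho>(1) conjunct2[OF near]])
    have "L * norm (v - N w) \<le> L * (\<kappa> * K)" using A L_pos by simp
    then have "clarke_ge (\<Phi> u) (N w) (p + \<eta> - L * (\<kappa> * K))" by (rule clarke_ge_perturb[OF cv])
    moreover have "n \<bullet> w + \<eta> - \<eta> / 8 \<le> p + \<eta> - L * (\<kappa> * K)"
    proof -
      have "\<kappa> * K + L * (\<kappa> * K) = \<kappa> * K * (1 + L)" by (simp add: algebra_simps)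
      also have "\<dots> \<le> \<kappa> * (K + 1) * (1 + 2 * L)"
        using \<kappa> K L_pos by (intro mult_mono) auto
      finally show ?thesis using B \<kappa>8 by linarith
    qed
    ultimately have "clarke_ge (\<Phi> u) (N w) (n \<bullet> w + \<eta> - \<eta> / 8)" by (rule clarke_ge_mono)
    moreover have "norm w \<le> K" using PI[of v] v by (simp add: w_def)
    ultimately show ?thesis by blast
  qed
  \<comment> \<open>The direction w still depends on u. Moving it into a countable dense set costs
    another part of \<eta>, and Baire's theorem then gives one w for all u in an open set.\<close>
  obtain Q :: "'a set" where Q: "countable Q" "\<And>X. open X \<Longrightarrow> X \<noteq> {} \<Longrightarrow> \<exists>d\<in>Q. d \<in> X"
    using countable_dense_setE by blast
  let ?Q = "{w \<in> Q. norm w \<le> K + 1}"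
  have cQ: "countable ?Q" using Q(1) by (rule countable_subset[rotated]) auto
  have cover: "\<exists>w\<in>?Q. clarke_ge (\<Phi> u) (N w) (n \<bullet> w + \<eta> / 2)" if u: "u \<in> V2" for u
  proof -
    obtain w where w: "norm w \<le> K" "clarke_ge (\<Phi> u) (N w) (n \<bullet> w + \<eta> - \<eta> / 8)" using key[OF u] by blast
    define \<rho> where "\<rho> = min 1 (\<eta> / 4 / (L * BN + norm n + 1))"
    have den: "L * BN + norm n + 1 > 0" using L_pos BN(1) by (simp add: add_pos_nonneg add_nonneg_pos)
    have \<rho>: "\<rho> > 0" using \<eta> den by (simp add: \<rho>_def)
    then obtain w0 where w0: "w0 \<in> Q" "w0 \<in> ball w \<rho>" using Q(2)[of "ball w \<rho>"] by auto
    then have d: "norm (w - w0) < \<rho>" by (simp add: dist_norm)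
    have "norm w0 \<le> norm w + norm (w - w0)" using norm_triangle_ineq4[of w "w - w0"] by simp
    also have "\<dots> \<le> K + 1" using w(1) d unfolding \<rho>_def by linarith
    finally have "w0 \<in> ?Q" using w0 by simp
    have canc: "x * (y / x) = y" if "x > 0" for x y :: real using that by simp
    have \<rho>2: "(L * BN + norm n) * norm (w - w0) \<le> \<eta> / 4"
    proof -
      have "(L * BN + norm n) * norm (w - w0) \<le> (L * BN + norm n + 1) * (\<eta> / 4 / (L * BN + norm n + 1))"
        using d L_pos BN(1) unfolding \<rho>_def by (intro mult_mono) auto
      also have "\<dots> = \<eta> / 4"
        by (rule canc[OF den])
      finally show ?thesis .
    qed
    have "L * norm (N w - N w0) \<le> L * BN * norm (w - w0)"
      using BN(2)[of "w - w0"] L_pos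
      by (simp add: linear_diff[OF bounded_linear.linear[OF N]] mult.assoc mult.commute[of BN])
    then have "clarke_ge (\<Phi> u) (N w0) (n \<bullet> w + \<eta> - \<eta> / 8 - L * BN * norm (w - w0))"
      by (rule clarke_ge_perturb[OF w(2)])
    moreover have "n \<bullet> w0 + \<eta> / 2 \<le> n \<bullet> w + \<eta> - \<eta> / 8 - L * BN * norm (w - w0)"
    proof -
      have "n \<bullet> w0 - n \<bullet> w \<le> norm n * norm (w - w0)"
        using Cauchy_Schwarz_ineq2[of n "w - w0"] by (simp add: inner_diff_right)
      then show ?thesis using \<rho>2 \<eta> by (simp add: distrib_right)
    qed
    ultimately have "clarke_ge (\<Phi> u) (N w0) (n \<bullet> w0 + \<eta> / 2)" by (rule clarke_ge_mono)
    then show ?thesis using \<open>w0 \<in> ?Q\<close> by blast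
  qed
  obtain w V3 where w: "w \<in> ?Q" and V3: "open V3" "V3 \<noteq> {}" "V3 \<subseteq> V2"
    and cl: "\<And>u. u \<in> V3 \<Longrightarrow> clarke_ge (\<Phi> u) (N w) (n \<bullet> w + \<eta> / 2)"
  proof (rule defpred_Baire[OF V2(1,2) cQ])
    show "\<exists>w\<in>?Q. clarke_ge (\<Phi> u) (N w) (n \<bullet> w + \<eta> / 2)" if "u \<in> V2" for u using cover[OF that] .
    show "defpred (\<lambda>u. clarke_ge (\<Phi> u) (N w) (n \<bullet> w + \<eta> / 2))" for w
      by (intro defpred_clarke_ge dP deffun_const)
  qed (rule that)
  have wK: "norm w \<le> K + 1" using w by simp
  have \<kappa>w: "\<kappa> * norm (t *\<^sub>R w) \<le> (\<kappa> * (K + 1)) * t" if "0 \<le> t" for t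
    using mult_left_mono[OF mult_left_mono[OF wK that], of \<kappa>] \<kappa> that by (simp add: mult_ac)
  have "n \<bullet> w + \<eta> / 4 \<le> n \<bullet> w + \<kappa> * (K + 1) + 2 * L * (\<kappa> * (K + 1))"
  proof (rule steep_limit[OF dP V3(1,2), of "\<kappa> * (K + 1)" w "N w"])
    show "0 < \<kappa> * (K + 1)" using \<kappa> K by simp
    fix u assume u: "u \<in> V3"
    show "\<exists>z. norm (z - \<Phi> u) < s \<and> steep (N w) (n \<bullet> w + \<eta> / 4) z" if "s > 0" for s
      using \<eta> that by (intro clarke_ge_steep[OF cl[OF u]]) auto
    fix t :: real assume t: "u + t *\<^sub>R w \<in> V3" "0 \<le> t"
    have V: "u \<in> V1" "u + t *\<^sub>R w \<in> V1" "u \<in> V2" "u + t *\<^sub>R w \<in> V2" using u t V3(3) V2(3) by auto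
    show "norm (\<Phi> (u + t *\<^sub>R w) - \<Phi> u - t *\<^sub>R N w) \<le> \<kappa> * (K + 1) * t"
      using PN[OF V(1,2)] \<kappa>w[OF t(2)] by (simp add: linear_scale[OF bounded_linear.linear[OF N]])
    show "g (\<Phi> (u + t *\<^sub>R w)) - g (\<Phi> u) \<le> (n \<bullet> w + \<kappa> * (K + 1)) * t"
      using gn[OF V(3,4)] \<kappa>w[OF t(2)] by (simp add: algebra_simps)
  qed
  then have "\<eta> / 4 \<le> \<kappa> * (K + 1) * (1 + 2 * L)" by (simp add: algebra_simps)
  then show False using \<kappa>8 \<eta> by simp
qed

end

section \<open>Countable covers without bad points\<close>

lemma infinite_imp_infinite_coordinate:
  fixes X :: "'a::euclidean_space set"
  assumes "infinite X"
  shows "\<exists>j\<in>Basis. infinite ((\<lambda>x. x \<bullet> j) ` X)"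
proof (rule ccontr)
  assume "\<not> ?thesis"
  then have "finite (Pi\<^sub>E Basis (\<lambda>j. (\<lambda>x. x \<bullet> j) ` X))" by (intro finite_PiE) auto
  moreover have "X \<subseteq> (\<lambda>c. \<Sum>j\<in>Basis. c j *\<^sub>R j) ` (Pi\<^sub>E Basis (\<lambda>j. (\<lambda>x. x \<bullet> j) ` X))"
  proof
    fix x assume x: "x \<in> X"
    let ?c = "\<lambda>j. if j \<in> Basis then x \<bullet> j else undefined"
    show "x \<in> (\<lambda>c. \<Sum>j\<in>Basis. c j *\<^sub>R j) ` (Pi\<^sub>E Basis (\<lambda>j. (\<lambda>x. x \<bullet> j) ` X))"
    proof (rule image_eqI)
      show "x = (\<Sum>j\<in>Basis. ?c j *\<^sub>R j)" using euclidean_representation[of x] by simp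
      show "?c \<in> Pi\<^sub>E Basis (\<lambda>j. (\<lambda>x. x \<bullet> j) ` X)" using x by auto
    qed
  qed
  ultimately show False using assms finite_surj by blast
qed

text \<open>The projection of \<open>A\<close> to the coordinates in \<open>I\<close> has interior points. The set of these \<open>I\<close> takes
  the role of the dimension of \<open>A\<close>.\<close>

definition thick :: "'a::euclidean_space set \<Rightarrow> 'a set \<Rightarrow> bool" where
  "thick I A \<longleftrightarrow> (\<exists>W. open W \<and> W \<noteq> {} \<and> (\<forall>u\<in>W. \<exists>x\<in>A. agree I x u))"

definition thick_index :: "'a::euclidean_space set \<Rightarrow> 'a set set" where
  "thick_index A = {I \<in> Pow Basis. thick I A}"

lemma finite_thick_index: "finite (thick_index A)"
  by (rule finite_subset[of _ "Pow Basis"]) (auto simp: thick_index_def)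

lemma card_thick_index_less:
  assumes "B \<subseteq> A" "I \<in> thick_index A" "\<not> thick I B"
  shows "card (thick_index B) < card (thick_index A)"
proof (rule psubset_card_mono[OF finite_thick_index])
  have "thick J A" if "thick J B" for J
    using that assms(1) unfolding thick_def by (meson subsetD)
  then have "thick_index B \<subseteq> thick_index A" unfolding thick_index_def by blast
  moreover have "I \<notin> thick_index B" using assms(3) by (simp add: thick_index_def)
  ultimately show "thick_index B \<subset> thick_index A" using assms(2) by blast
qed

context omin
begin

text \<open>The remaining points of \<open>A\<close> are isolated in their fibre over the
  coordinates in I, and countably many graphs over I contain them; this is the situation of
  \<open>bad_graph\<close>.\<close>

definition fibre_limit :: "'a::euclidean_space set \<Rightarrow> 'a set \<Rightarrow> 'a set" where
  "fibre_limit I A = {x \<in> A. \<forall>\<delta>>0. \<exists>y\<in>A. y \<noteq> x \<and> norm (y - x) < \<delta> \<and> agree I y x}"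

lemma defset_fibre_limit:
  assumes "I \<subseteq> Basis" "defset A"
  shows "defset (fibre_limit I A)"
  unfolding fibre_limit_def mem_Collect_eq
  by (intro defpred_intros defpred_agree assms(1) defpred_mem[OF assms(2)])

text \<open>A fibre with a limit point is infinite, so some coordinate j outside I takes infinitely
  many values on it, hence all values in a rational interval. Baire's theorem makes j and the
  interval independent of u on an open set. Then \<open>A\<close> would be thick over
  \<open>insert j I\<close>, against the maximality of I.\<close>

lemma not_thick_fibre_limit:
  assumes A: "defset A" and I: "I \<subseteq> Basis" and max: "\<And>J. J \<in> thick_index A \<Longrightarrow> card J \<le> card I"
  shows "\<not> thick I (fibre_limit I A)"
proof
  assume "thick I (fibre_limit I A)"
  then obtain W where W: "open W" "W \<noteq> {}" and WA: "\<And>u. u \<in> W \<Longrightarrow> \<exists>x\<in>fibre_limit I A. agree I x u"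
    unfolding thick_def by blast
  let ?P = "\<lambda>(j, p, q) u. \<forall>t. p < t \<and> t < q \<longrightarrow> (\<exists>y\<in>A. agree I y u \<and> y \<bullet> j = t)"
  let ?K = "(Basis - I) \<times> {(p, q). p \<in> \<rat> \<and> q \<in> \<rat> \<and> p < (q::real)}"
  have "countable {(p, q). p \<in> \<rat> \<and> q \<in> \<rat> \<and> p < (q::real)}"
    by (rule countable_subset[OF _ countable_SIGMA[OF countable_rat countable_rat]]) auto
  then have cK: "countable ?K"
    by (intro countable_SIGMA) (auto intro: countable_finite)
  have cover: "\<exists>k\<in>?K. ?P k u" if u: "u \<in> W" for u
  proof -
    obtain x where x: "x \<in> A" "agree I x u" "\<And>\<delta>. \<delta> > 0 \<Longrightarrow> \<exists>y\<in>A. y \<noteq> x \<and> norm (y - x) < \<delta> \<and> agree I y x"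
      using WA[OF u] unfolding fibre_limit_def by blast
    let ?S = "{y \<in> A. agree I y u}"
    have "x islimpt ?S"
      unfolding islimpt_approachable
    proof (intro allI impI)
      fix e :: real assume "e > 0"
      then obtain y where "y \<in> A" "y \<noteq> x" "norm (y - x) < e" "agree I y x" using x(3) by blast
      then show "\<exists>x'\<in>?S. x' \<noteq> x \<and> dist x' x < e"
        using x(2) by (intro bexI[of _ y]) (auto simp: dist_norm agree_def)
    qed
    then have "infinite ?S" using islimpt_finite by blast
    then obtain j where j: "j \<in> Basis" "infinite ((\<lambda>y. y \<bullet> j) ` ?S)"
      using infinite_imp_infinite_coordinate by blast
    have "j \<notin> I"
    proof
      assume "j \<in> I"
      then have "(\<lambda>y. y \<bullet> j) ` ?S \<subseteq> {u \<bullet> j}" by (auto simp: agree_def)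
      then show False using j(2) finite_subset by blast
    qed
    have "(\<lambda>y. y \<bullet> j) ` ?S = {t. \<exists>y\<in>A. agree I y u \<and> y \<bullet> j = t}" by auto
    then have inf: "infinite {t. \<exists>y\<in>A. agree I y u \<and> y \<bullet> j = t}" using j(2) by simp
    have "defpred (\<lambda>t. \<exists>y\<in>A. agree I y u \<and> y \<bullet> j = t)"
      by (intro defpred_intros defpred_agree I defpred_mem[OF A])
    then obtain p q where pq: "p \<in> \<rat>" "q \<in> \<rat>" "p < q"
      "\<forall>t. p < t \<and> t < q \<longrightarrow> (\<exists>y\<in>A. agree I y u \<and> y \<bullet> j = t)"
      using defpred_infinite[OF _ inf] by blast
    then show ?thesis using j(1) \<open>j \<notin> I\<close> by (intro bexI[of _ "(j, p, q)"]) auto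
  qed
  obtain k V where k: "k \<in> ?K" and V: "open V" "V \<noteq> {}" "V \<subseteq> W" "\<And>u. u \<in> V \<Longrightarrow> ?P k u"
  proof (rule defpred_Baire[OF W cK])
    show "\<exists>k\<in>?K. ?P k u" if "u \<in> W" for u using cover[OF that] .
    show "defpred (?P k)" for k
    proof (cases k)
      case (fields j p q)
      show ?thesis unfolding fields prod.case by (intro defpred_intros defpred_agree I defpred_mem[OF A])
    qed
  qed (rule that)
  obtain j p q where kk: "k = (j, p, q)" by (cases k)
  have j: "j \<in> Basis" "j \<notin> I" and pq: "p < q" using k unfolding kk by auto
  have VP: "\<exists>y\<in>A. agree I y u \<and> y \<bullet> j = t" if "u \<in> V" "p < t" "t < q" for u t
    using V(4)[OF that(1)] that(2,3) unfolding kk by auto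
  obtain u0 where u0: "u0 \<in> V" using V by blast
  let ?U = "{u. set_coord u j (u0 \<bullet> j) \<in> V} \<inter> {u. p < u \<bullet> j \<and> u \<bullet> j < q}"
  have "open ?U"
  proof (intro open_Int)
    show "open {u. set_coord u j (u0 \<bullet> j) \<in> V}"
      using open_vimage[OF V(1) continuous_set_coord] by (simp add: vimage_def)
    show "open {u. p < u \<bullet> j \<and> u \<bullet> j < q}"
      by (intro open_Collect_conj open_Collect_less continuous_intros)
  qed
  moreover have "set_coord u0 j ((p + q) / 2) \<in> ?U"
    using u0 pq j(1) by (auto simp: set_coord_set_coord set_coord_same set_coord_inner field_simps)
  then have "?U \<noteq> {}" by blast
  moreover have "\<exists>y\<in>A. agree (insert j I) y u" if u: "u \<in> ?U" for u
  proof -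
    have "set_coord u j (u0 \<bullet> j) \<in> V" "p < u \<bullet> j" "u \<bullet> j < q" using u by auto
    then obtain y where y: "y \<in> A" "agree I y (set_coord u j (u0 \<bullet> j))" "y \<bullet> j = u \<bullet> j" using VP by blast
    have "y \<bullet> i = u \<bullet> i" if "i \<in> I" for i
    proof -
      have "i \<in> Basis" "i \<noteq> j" using that I j by auto
      then show ?thesis using y(2) that set_coord_inner[OF j(1), of i u] unfolding agree_def by auto
    qed
    then show ?thesis using y unfolding agree_def by blast
  qed
  ultimately have "thick (insert j I) A" unfolding thick_def by blast
  then have "insert j I \<in> thick_index A" using j(1) I unfolding thick_index_def by simp
  then have "card (insert j I) \<le> card I" by (rule max)
  moreover have "finite I" using I finite_Basis finite_subset by blast
  ultimately show False using j(2) by simp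
qed

end

context definable_lipschitz
begin

text \<open>For a thick I of maximal size, the fibre limits are not thick over I, and countably many
  graphs \<open>Q c m\<close> over I contain the rest of \<open>A\<close>. The bad points of a graph
  are not thick over I either, by \<open>bad_graph\<close>. Both kinds of exceptional sets thus have
  fewer thick index sets and are covered by induction; what remains of a graph has no bad points,
  because badness is monotone in the set.\<close>

theorem countable_good_cover:
  fixes A :: "'a set"
  assumes "defset A" and \<eta>: "\<eta> > 0" and K: "K \<ge> 0"
  shows "\<exists>\<C>. countable \<C> \<and> \<Union>\<C> = A \<and> (\<forall>C\<in>\<C>. defset C \<and> bad \<eta> K C = {})"
  using assms(1)
proof (induction "card (thick_index A)" arbitrary: A rule: less_induct)
  case less
  show ?case
  proof (cases "A = {}")
    case True
    then show ?thesis by (intro exI[of _ "{}"]) auto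
  next
    case False
    \<comment> \<open>Every nonempty set is thick over no coordinates, so a maximal I
      exists.\<close>
    have "{} \<in> thick_index A"
      using False unfolding thick_index_def thick_def agree_def by auto
    then have "Max (card ` thick_index A) \<in> card ` thick_index A"
      by (intro Max_in finite_imageI finite_thick_index) blast
    then obtain I where I: "I \<in> thick_index A" and cI: "card I = Max (card ` thick_index A)" by auto
    have max: "card J \<le> card I" if "J \<in> thick_index A" for J
      unfolding cI by (intro Max_ge finite_imageI finite_thick_index imageI that)
    have IB: "I \<subseteq> Basis" using I by (simp add: thick_index_def)
    let ?R = "fibre_limit I A"
    have "?R \<subseteq> A" by (auto simp: fibre_limit_def)
    then have "card (thick_index ?R) < card (thick_index A)"
      using I not_thick_fibre_limit[OF less.prems IB max] by (rule card_thick_index_less)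
    from less.hyps[OF this defset_fibre_limit[OF IB less.prems]]
    obtain \<R> where R: "countable \<R> \<and> \<Union>\<R> = ?R \<and> (\<forall>C\<in>\<R>. defset C \<and> bad \<eta> K C = {})"
      by (rule exE)
    then have \<R>: "countable \<R>" "\<Union>\<R> = ?R" "\<And>C. C \<in> \<R> \<Longrightarrow> defset C \<and> bad \<eta> K C = {}"
      by simp_all
    obtain D :: "'a set" where D: "countable D" "\<And>X. open X \<Longrightarrow> X \<noteq> {} \<Longrightarrow> \<exists>d\<in>D. d \<in> X"
      using countable_dense_setE by blast
    \<comment> \<open>The points of \<open>A\<close> in a ball that are alone in their fibre within
      this ball, hence a graph over I. A point isolated in its fibre up to distance \<delta> is
      captured by a centre in D as soon as two radii fit into \<delta>.\<close>
    define Q where "Q c m = {x \<in> A. norm (x - c) < 1 / Suc m \<and>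
      (\<forall>y\<in>A. norm (y - c) < 1 / Suc m \<and> agree I y x \<longrightarrow> y = x)}" for c and m :: nat
    have dQ: "defset (Q c m)" for c m
      unfolding Q_def mem_Collect_eq by (intro defpred_intros defpred_agree IB defpred_mem[OF less.prems])
    have QA: "Q c m \<subseteq> A" for c m by (auto simp: Q_def)
    have "\<not> thick I (bad \<eta> K (Q c m))" for c m
    proof
      assume "thick I (bad \<eta> K (Q c m))"
      then obtain W where W: "open W" "W \<noteq> {}" "\<forall>u\<in>W. \<exists>x\<in>bad \<eta> K (Q c m). agree I x u"
        unfolding thick_def by (elim exE conjE)
      have graph: "x = y" if "x \<in> Q c m" "y \<in> Q c m" "agree I x y" for x y
        using that unfolding Q_def by blast
      have "\<exists>u\<in>W. \<forall>x\<in>bad \<eta> K (Q c m). \<not> agree I x u"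
        by (rule bad_graph[OF IB dQ _ W(1,2) \<eta> K]) (rule graph)
      then show False using W(3) by blast
    qed
    note nt = this
    have bA: "bad \<eta> K (Q c m) \<subseteq> A" for c m using QA by (auto simp: bad_def)
    have "\<exists>\<C>. countable \<C> \<and> \<Union>\<C> = bad \<eta> K (Q c m) \<and> (\<forall>C\<in>\<C>. defset C \<and> bad \<eta> K C = {})" for c m
      by (rule less.hyps[OF card_thick_index_less[OF bA I nt] defset_bad[OF dQ]])
    then obtain \<B> where B: "\<And>c m. countable (\<B> c m) \<and> \<Union>(\<B> c m) = bad \<eta> K (Q c m) \<and>
      (\<forall>C\<in>\<B> c m. defset C \<and> bad \<eta> K C = {})" by metis
    then have \<B>: "\<And>c m. countable (\<B> c m)" "\<And>c m. \<Union>(\<B> c m) = bad \<eta> K (Q c m)"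
      "\<And>c m C. C \<in> \<B> c m \<Longrightarrow> defset C \<and> bad \<eta> K C = {}" by simp_all
    define G where "G c m = Q c m - bad \<eta> K (Q c m)" for c m
    have G: "defset (G c m)" "bad \<eta> K (G c m) = {}" for c m
    proof -
      show "defset (G c m)" unfolding G_def Diff_iff by (intro defpred_intros dQ defset_bad)
      have "bad \<eta> K (G c m) \<subseteq> bad \<eta> K (Q c m)" by (intro bad_mono) (auto simp: G_def)
      moreover have "bad \<eta> K (G c m) \<subseteq> G c m" by (auto simp: bad_def)
      ultimately show "bad \<eta> K (G c m) = {}" by (auto simp: G_def)
    qed
    let ?\<C> = "\<R> \<union> (\<Union>c\<in>D. \<Union>m. insert (G c m) (\<B> c m))"
    have "countable ?\<C>" using \<R>(1) D(1) \<B>(1) by auto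
    moreover have "\<forall>C\<in>?\<C>. defset C \<and> bad \<eta> K C = {}" using \<R>(3) \<B>(3) G by blast
    moreover have "\<Union>?\<C> = A"
    proof
      have "G c m \<subseteq> A" "\<Union>(\<B> c m) \<subseteq> A" for c m using QA[of c m] \<B>(2)[of c m] by (auto simp: G_def bad_def)
      then show "\<Union>?\<C> \<subseteq> A" using \<R>(2) \<open>?R \<subseteq> A\<close> by blast
      show "A \<subseteq> \<Union>?\<C>"
      proof
        fix x assume x: "x \<in> A"
        show "x \<in> \<Union>?\<C>"
        proof (cases "x \<in> ?R")
          case True
          then show ?thesis using \<R>(2) by blast
        next
          case False
          then obtain \<delta> where \<delta>: "\<delta> > 0" "\<And>y. y \<in> A \<Longrightarrow> norm (y - x) < \<delta> \<Longrightarrow> agree I y x \<Longrightarrow> y = x"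
            using x unfolding fibre_limit_def by blast
          obtain m where m: "1 / Suc m < \<delta> / 2" using nat_approx_posE[of "\<delta> / 2"] \<delta>(1) by auto
          have "ball x (1 / Suc m) \<noteq> {}" by simp
          then obtain c where c: "c \<in> D" "c \<in> ball x (1 / Suc m)" using D(2) open_ball by blast
          then have xc: "norm (x - c) < 1 / Suc m" by (simp add: dist_norm)
          have "y = x" if y: "y \<in> A" "norm (y - c) < 1 / Suc m" "agree I y x" for y
          proof (rule \<delta>(2)[OF y(1) _ y(3)])
            have "norm (y - x) \<le> norm (y - c) + norm (x - c)"
              using norm_triangle_ineq4[of "y - c" "x - c"] by simp
            then show "norm (y - x) < \<delta>" using y(2) xc m by linarith
          qed
          then have "x \<in> Q c m" using x xc unfolding Q_def by blast
          then have "x \<in> G c m \<or> x \<in> \<Union>(\<B> c m)" using \<B>(2)[of c m] by (auto simp: G_def)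
          then show ?thesis using c(1) by blast
        qed
      qed
    qed
    ultimately show ?thesis by blast
  qed
qed

section \<open>Critical values, and decrease along curves\<close>

definition critical :: "'a set" where
  "critical = {x. \<forall>d. clarke_ge x d 0}"

text \<open>A definable curve \<open>\<gamma>\<close> of critical points with \<open>g (\<gamma> t) = t\<close> would consist of bad points: \<open>g\<close>
  decreases at unit rate backwards along \<open>\<gamma>\<close>.\<close>

lemma critical_values_no_interval:
  assumes "a < b"
  shows "\<exists>t. a < t \<and> t < b \<and> \<not> (\<exists>x\<in>critical. norm x \<le> B \<and> g x = t)"
proof (rule ccontr)
  assume "\<not> ?thesis"
  then have all: "\<exists>x. x \<in> critical \<and> norm x \<le> B \<and> g x = t" if "a < t" "t < b" for t using that by blast
  have dc: "defset critical" unfolding critical_def mem_Collect_eq by (intro defpred_intros defpred_clarke_ge)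
  let ?Z = "\<lambda>t x. x \<in> critical \<and> norm x \<le> B \<and> g x = t"
  have dZ: "defpred (\<lambda>p. ?Z (fst p) (snd p))" by (intro defpred_intros defpred_mem[OF dc] deffun_compose[OF deffun_g])
  obtain \<gamma> where dg: "deffun \<gamma>" and Z: "\<And>t x. ?Z t x \<Longrightarrow> ?Z t (\<gamma> t)"
    using definable_choice[OF dZ, of B] by blast
  have \<gamma>: "?Z t (\<gamma> t)" if "t \<in> {a<..<b}" for t
    using all[of t] that Z by (metis greaterThanLessThan_iff)
  have ab: "open {a<..<b}" "{a<..<b} \<noteq> {}" using assms by auto
  obtain V N where V: "open V" "V \<noteq> {}" "V \<subseteq> {a<..<b}" and N: "bounded_linear N"
    and \<gamma>N: "\<And>u u'. u \<in> V \<Longrightarrow> u' \<in> V \<Longrightarrow> norm (\<gamma> u' - \<gamma> u - N (u' - u)) \<le> 1 * norm (u' - u)"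
    by (rule generic_linear_vec[OF dg ab zero_less_one]) (rule that)
  obtain BN where BN: "BN > 0" "\<And>x. norm (N x) \<le> norm x * BN"
    using bounded_linear.pos_bounded[OF N] by blast
  \<comment> \<open>A Lipschitz constant of \<gamma> on V. It bounds the difference quotients and
    hence the tangent vector v below.\<close>
  let ?K = "BN + 1"
  have lipg: "norm (\<gamma> u' - \<gamma> u) \<le> ?K * \<bar>u' - u\<bar>" if "u \<in> V" "u' \<in> V" for u u'
  proof -
    have "norm (\<gamma> u' - \<gamma> u) \<le> norm (\<gamma> u' - \<gamma> u - N (u' - u)) + norm (N (u' - u))"
      using norm_triangle_ineq[of "\<gamma> u' - \<gamma> u - N (u' - u)" "N (u' - u)"] by simp
    then show ?thesis using \<gamma>N[OF that] BN(2)[of "u' - u"] by (simp add: algebra_simps)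
  qed
  have K0: "?K \<ge> 0" using BN by simp
  have dK: "defset {x \<in> critical. norm x \<le> B}" unfolding mem_Collect_eq by (intro defpred_intros dc)
  have "\<exists>\<C>. countable \<C> \<and> \<Union>\<C> = {x \<in> critical. norm x \<le> B} \<and> (\<forall>C\<in>\<C>. defset C \<and> bad (1 / 4) ?K C = {})"
    by (rule countable_good_cover[OF dK _ K0]) simp
  then obtain \<C> where C0: "countable \<C> \<and> \<Union>\<C> = {x \<in> critical. norm x \<le> B} \<and> (\<forall>C\<in>\<C>. defset C \<and> bad (1 / 4) ?K C = {})"
    by (rule exE)
  then have \<C>: "countable \<C>" "\<Union>\<C> = {x \<in> critical. norm x \<le> B}"
    "\<And>C. C \<in> \<C> \<Longrightarrow> defset C \<and> bad (1 / 4) ?K C = {}" by simp_all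
  obtain C V' where C: "C \<in> \<C>" and V': "open V'" "V' \<noteq> {}" "V' \<subseteq> V" "\<And>t. t \<in> V' \<Longrightarrow> \<gamma> t \<in> C"
  proof (rule defpred_Baire[OF V(1,2) \<C>(1)])
    show "\<exists>C\<in>\<C>. \<gamma> t \<in> C" if "t \<in> V" for t using \<gamma>[of t] V(3) \<C>(2) that by blast
    show "defpred (\<lambda>t. \<gamma> t \<in> C)" if "C \<in> \<C>" for C by (rule defpred_mem[OF conjunct1[OF \<C>(3)[OF that]] dg])
  qed (rule that)
  obtain t where t: "t \<in> V'" using V' by blast
  obtain e where e: "e > 0" "ball t e \<subseteq> V'" using V'(1) t open_contains_ball by blast
  define h where "h n = e / 2 * inverse (real (Suc n))" for n
  have h: "h n > 0" "t - h n \<in> V'" for n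
  proof -
    show "h n > 0" using e by (simp add: h_def)
    have "h n \<le> e / 2 * 1" unfolding h_def
      using e by (intro mult_left_mono) (auto simp: inverse_eq_divide)
    then have "h n < e" using e by simp
    then have "t - h n \<in> ball t e" using \<open>h n > 0\<close> by (simp add: dist_real_def)
    then show "t - h n \<in> V'" using e by blast
  qed
  have h0: "h \<longlonglongrightarrow> 0" unfolding h_def by (intro tendsto_mult_right_zero LIMSEQ_inverse_real_of_nat)
  \<comment> \<open>Backward difference quotients of \<gamma>. A limit v of a subsequence is tangent
    to C at \<gamma> t, and g changes along it at rate -1 because g (\<gamma> t) = t.\<close>
  define w where "w n = (1 / h n) *\<^sub>R (\<gamma> (t - h n) - \<gamma> t)" for n
  have w: "w n \<in> cball 0 ?K" for n
  proof -
    have "norm (\<gamma> (t - h n) - \<gamma> t) \<le> ?K * h n"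
      using lipg[of t "t - h n"] h[of n] t V'(3) by auto
    then show ?thesis using h(1)[of n] by (simp add: w_def divide_le_eq)
  qed
  have "compact (cball (0::'a) ?K)" by simp
  then obtain v r where v: "v \<in> cball 0 ?K" "strict_mono r" "(w \<circ> r) \<longlonglongrightarrow> v"
    using w unfolding compact_def by metis
  have "tangent_le C (\<gamma> t) v (- 1)"
    unfolding tangent_le_def
  proof (intro allI impI)
    fix \<delta> :: real assume \<delta>: "\<delta> > 0"
    have "\<forall>\<^sub>F n in sequentially. dist ((w \<circ> r) n) v < \<delta>" using v(3) \<delta> by (rule tendstoD)
    moreover have "(h \<circ> r) \<longlonglongrightarrow> 0" using h0 v(2) by (rule LIMSEQ_subseq_LIMSEQ)
    then have "\<forall>\<^sub>F n in sequentially. (h \<circ> r) n < \<delta>" using \<delta> by (rule order_tendstoD)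
    ultimately have "\<forall>\<^sub>F n in sequentially. dist ((w \<circ> r) n) v < \<delta> \<and> (h \<circ> r) n < \<delta>" by (rule eventually_conj)
    then obtain n where n: "dist (w (r n)) v < \<delta>" "h (r n) < \<delta>"
      using eventually_happens'[OF sequentially_bot] by auto
    let ?h = "h (r n)"
    have "\<gamma> (t - ?h) - \<gamma> t - ?h *\<^sub>R v = ?h *\<^sub>R (w (r n) - v)"
      using h(1)[of "r n"] by (simp add: w_def scaleR_diff_right)
    then have 1: "norm (\<gamma> (t - ?h) - \<gamma> t - ?h *\<^sub>R v) \<le> \<delta> * ?h"
      using n(1) h(1)[of "r n"] by (simp add: dist_norm mult.commute)
    have "t \<in> {a<..<b}" "t - ?h \<in> {a<..<b}" using t h(2)[of "r n"] V'(3) V(3) by blast+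
    then have "g (\<gamma> t) = t" "g (\<gamma> (t - ?h)) = t - ?h" using \<gamma> by blast+
    then have 2: "g (\<gamma> (t - ?h)) - g (\<gamma> t) \<le> (- 1 + \<delta>) * ?h"
      using \<delta> h(1)[of "r n"] by (simp add: algebra_simps)
    show "\<exists>y\<in>C. \<exists>h>0. h < \<delta> \<and> norm (y - \<gamma> t - h *\<^sub>R v) \<le> \<delta> * h \<and> g y - g (\<gamma> t) \<le> (- 1 + \<delta>) * h"
      using 1 2 n(2) h[of "r n"] V'(4) by (intro bexI[of _ "\<gamma> (t - ?h)"] exI[of _ ?h]) auto
  qed
  \<comment> \<open>At a critical point the upper derivative in direction v is at least 0, which
    exceeds the rate -1 by more than 1 / 4. Any positive error up to 1 would do.\<close>
  moreover have "clarke_ge (\<gamma> t) v ((- 1) + 1 / 4)"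
  proof (rule clarke_ge_mono)
    have "\<gamma> t \<in> critical" using \<gamma>[of t] t V'(3) V(3) by blast
    then show "clarke_ge (\<gamma> t) v 0" by (simp add: critical_def)
  qed simp
  ultimately have "\<gamma> t \<in> bad (1 / 4) ?K C"
    using v(1) V'(4)[OF t] unfolding bad_def mem_Collect_eq by (intro conjI exI[of _ v] exI[of _ "- 1"]) auto
  then show False using \<C>(3)[OF C] by blast
qed

text \<open>As c t is not bad, the rate q - \<eta> is exceeded, but only for those h with c (t - h)
  in \<open>C\<close>. The bound is moved to the ray c t + h d, where definability in h turns
  arbitrarily small h into all small h, and then back to the curve. One \<eta> is lost through the
  definition of bad points, the other on the way back.\<close>

lemma decrease_along_curve:
  assumes C: "bad \<eta> K C = {}" and x: "c t \<in> C" and d: "norm d \<le> K" and \<eta>: "\<eta> > 0"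
    and der: "\<And>\<epsilon>. \<epsilon> > 0 \<Longrightarrow> \<forall>\<^sub>F h in at_right 0. norm (c (t - h) - c t - h *\<^sub>R d) \<le> \<epsilon> * h"
    and freq: "\<exists>\<^sub>F h in at_right 0. c (t - h) \<in> C"
    and q: "clarke_ge (c t) d q"
  shows "\<forall>\<^sub>F h in at_right (0::real). g (c t) + (q - 2 * \<eta>) * h \<le> g (c (t - h))"
proof -
  let ?p = "q - \<eta>"
  have "\<not> tangent_le C (c t) d ?p"
  proof
    assume "tangent_le C (c t) d ?p"
    moreover have "clarke_ge (c t) d (?p + \<eta>)" using q by simp
    ultimately have "c t \<in> bad \<eta> K C" unfolding bad_def using x d by blast
    then show False using C by simp
  qed
  then obtain \<delta> where \<delta>: "\<delta> > 0" "\<And>y h. y \<in> C \<Longrightarrow> 0 < h \<Longrightarrow> h < \<delta> \<Longrightarrow> norm (y - c t - h *\<^sub>R d) \<le> \<delta> * h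
      \<Longrightarrow> (?p + \<delta>) * h < g y - g (c t)"
    unfolding tangent_le_def by (meson not_le)
  \<comment> \<open>The margin \<delta> in \<open>\<delta>\<close> absorbs L * \<epsilon> on the way
    to the ray; L * \<epsilon> \<le> \<eta> pays for the way back.\<close>
  define \<epsilon> where "\<epsilon> = min \<delta> (min \<delta> \<eta> / L)"
  have \<epsilon>: "\<epsilon> > 0" "\<epsilon> \<le> \<delta>" "L * \<epsilon> \<le> \<delta>" "L * \<epsilon> \<le> \<eta>"
  proof -
    show "\<epsilon> > 0" using \<delta>(1) \<eta> L_pos by (simp add: \<epsilon>_def)
    show "\<epsilon> \<le> \<delta>" unfolding \<epsilon>_def by (rule min.cobounded1)
    have "L * \<epsilon> \<le> L * (min \<delta> \<eta> / L)" using L_pos unfolding \<epsilon>_def by (intro mult_left_mono min.cobounded2) auto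
    then have "L * \<epsilon> \<le> min \<delta> \<eta>" using L_pos by simp
    then show "L * \<epsilon> \<le> \<delta>" "L * \<epsilon> \<le> \<eta>" by auto
  qed
  have h\<delta>: "\<forall>\<^sub>F h in at_right (0::real). h < \<delta> \<and> 0 < h"
    using \<delta>(1) by (intro eventually_at_rightI[of 0 \<delta>]) auto
  have near: "\<bar>g (c (t - h)) - g (c t + h *\<^sub>R d)\<bar> \<le> L * \<epsilon> * h" if "norm (c (t - h) - c t - h *\<^sub>R d) \<le> \<epsilon> * h" for h
  proof -
    have "\<bar>g (c (t - h)) - g (c t + h *\<^sub>R d)\<bar> \<le> L * norm (c (t - h) - (c t + h *\<^sub>R d))" by (rule lip)
    also have "\<dots> \<le> L * (\<epsilon> * h)" using that L_pos by (simp add: diff_diff_add)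
    finally show ?thesis by simp
  qed
  have "\<exists>\<^sub>F h in at_right 0. g (c t) + ?p * h \<le> g (c t + h *\<^sub>R d)"
    using frequently_eventually_conj[OF freq eventually_conj[OF h\<delta> der[OF \<epsilon>(1)]]]
  proof (rule frequently_elim1)
    fix h assume *: "((h < \<delta> \<and> 0 < h) \<and> norm (c (t - h) - c t - h *\<^sub>R d) \<le> \<epsilon> * h) \<and> c (t - h) \<in> C"
    then have "norm (c (t - h) - c t - h *\<^sub>R d) \<le> \<delta> * h"
      using \<epsilon>(2) by (meson less_imp_le mult_right_mono order_trans)
    then have "(?p + \<delta>) * h < g (c (t - h)) - g (c t)" using * by (intro \<delta>(2)) auto
    moreover have "L * \<epsilon> * h \<le> \<delta> * h" using \<epsilon>(3) * by (intro mult_right_mono) auto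
    moreover have "\<bar>g (c (t - h)) - g (c t + h *\<^sub>R d)\<bar> \<le> L * \<epsilon> * h" using near * by blast
    ultimately show "g (c t) + ?p * h \<le> g (c t + h *\<^sub>R d)"
      unfolding distrib_right by linarith
  qed
  moreover have "defpred (\<lambda>h. g (c t) + ?p * h \<le> g (c t + h *\<^sub>R d))"
    by (intro defpred_intros deffun_compose[OF deffun_g])
  ultimately have "\<forall>\<^sub>F h in at_right 0. g (c t) + ?p * h \<le> g (c t + h *\<^sub>R d)"
    using defpred_eventually unfolding frequently_def by blast
  with der[OF \<epsilon>(1)] h\<delta> show ?thesis
  proof eventually_elim
    case (elim h)
    moreover have "L * \<epsilon> * h \<le> \<eta> * h" using \<epsilon>(4) elim by (intro mult_right_mono) auto
    moreover have "\<bar>g (c (t - h)) - g (c t + h *\<^sub>R d)\<bar> \<le> L * \<epsilon> * h" using near elim by blast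
    moreover have "(q - 2 * \<eta>) * h = (q - \<eta>) * h - \<eta> * h" by (simp add: algebra_simps)
    ultimately show ?case by linarith
  qed
qed

end

section \<open>Absolutely continuous curves\<close>

lemma ip_norm_inner: "ip_norm (\<bullet>) x = norm x"
  by (simp add: ip_norm_def norm_eq_sqrt_inner)

lemma absolutely_continuousD:
  fixes x :: "real \<Rightarrow> 'a::euclidean_space"
  assumes "absolutely_continuous_fun (\<bullet>) a b x" "\<epsilon> > 0"
  shows "\<exists>\<delta>>0. \<forall>(m::nat) l u. (\<forall>i<m. a \<le> l i \<and> l i \<le> u i \<and> u i \<le> b) \<and>
      disjoint_family_on (\<lambda>i. {l i..u i}) {..<m} \<and> (\<Sum>i<m. u i - l i) \<le> \<delta> \<longrightarrow>
      (\<Sum>i<m. norm (x (u i) - x (l i))) \<le> \<epsilon>"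
  by (rule mp[OF spec[OF assms(1)[unfolded absolutely_continuous_fun_def ip_norm_inner], of \<epsilon>] assms(2)])

lemma ac_continuous_on:
  fixes x :: "real \<Rightarrow> 'a::euclidean_space"
  assumes "absolutely_continuous_fun (\<bullet>) a b x"
  shows "continuous_on {a..b} x"
  unfolding continuous_on_iff
proof (intro ballI allI impI)
  fix t e :: real assume t: "t \<in> {a..b}" and e: "e > 0"
  obtain \<delta> where \<delta>: "\<delta> > 0" "\<forall>(m::nat) l u. (\<forall>i<m. a \<le> l i \<and> l i \<le> u i \<and> u i \<le> b) \<and>
      disjoint_family_on (\<lambda>i. {l i..u i}) {..<m} \<and> (\<Sum>i<m. u i - l i) \<le> \<delta> \<longrightarrow>
      (\<Sum>i<m. norm (x (u i) - x (l i))) \<le> e / 2"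
    using absolutely_continuousD[OF assms half_gt_zero[OF e]] by (elim exE conjE)
  have ord: "norm (x u - x l) \<le> e / 2" if "a \<le> l" "l \<le> u" "u \<le> b" "u - l \<le> \<delta>" for l u
    using spec[OF spec[OF spec[OF \<delta>(2), of 1], of "\<lambda>_. l"], of "\<lambda>_. u"] that by (simp add: disjoint_family_on_def)
  show "\<exists>d>0. \<forall>s\<in>{a..b}. dist s t < d \<longrightarrow> dist (x s) (x t) < e"
  proof (intro exI[of _ \<delta>] conjI ballI impI \<delta>(1))
    fix s assume s: "s \<in> {a..b}" "dist s t < \<delta>"
    have "norm (x s - x t) \<le> e / 2"
    proof (cases "s \<le> t")
      case True
      then show ?thesis using ord[of s t] s t by (auto simp: dist_real_def norm_minus_commute)
    next
      case False
      then show ?thesis using ord[of t s] s t by (auto simp: dist_real_def)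
    qed
    then show "dist (x s) (x t) < e" using e by (simp add: dist_norm)
  qed
qed

text \<open>The definition of absolute continuity only speaks about disjoint closed intervals; adjacent
  intervals are shrunk slightly, using continuity.\<close>

lemma ac_nonoverlapping:
  fixes x :: "real \<Rightarrow> 'a::euclidean_space"
  assumes ac: "absolutely_continuous_fun (\<bullet>) a b x" and \<epsilon>: "\<epsilon> > 0"
  obtains \<delta> where "\<delta> > 0" "\<And>q l u. finite (q :: 'i set) \<Longrightarrow> (\<And>i. i \<in> q \<Longrightarrow> a \<le> l i \<and> l i < u i \<and> u i \<le> b) \<Longrightarrow>
     disjoint_family_on (\<lambda>i. {l i<..<u i}) q \<Longrightarrow> (\<Sum>i\<in>q. u i - l i) \<le> \<delta> \<Longrightarrow>
     (\<Sum>i\<in>q. norm (x (u i) - x (l i))) \<le> \<epsilon>"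
proof -
  obtain \<delta> where \<delta>: "\<delta> > 0" "\<forall>(m::nat) l u. (\<forall>i<m. a \<le> l i \<and> l i \<le> u i \<and> u i \<le> b) \<and>
      disjoint_family_on (\<lambda>i. {l i..u i}) {..<m} \<and> (\<Sum>i<m. u i - l i) \<le> \<delta> \<longrightarrow>
      (\<Sum>i<m. norm (x (u i) - x (l i))) \<le> \<epsilon> / 2"
    using absolutely_continuousD[OF ac half_gt_zero[OF \<epsilon>]] by (elim exE conjE)
  have cont: "continuous_on {a..b} x" by (rule ac_continuous_on[OF ac])
  have "(\<Sum>i\<in>q. norm (x (u i) - x (l i))) \<le> \<epsilon>"
    if q: "finite q" and lu: "\<And>i. i \<in> q \<Longrightarrow> a \<le> l i \<and> l i < u i \<and> u i \<le> b"
      and disj: "disjoint_family_on (\<lambda>i. {l i<..<u i}) q" and small: "(\<Sum>i\<in>q. u i - l i) \<le> \<delta>"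
    for q :: "'i set" and l u
  proof -
    \<comment> \<open>Shrinking changes each increment by at most e, in total by at most \<epsilon>
      / 2.\<close>
    define e where "e = \<epsilon> / 2 / (real (card q) + 1)"
    have e: "e > 0" using \<epsilon> by (simp add: e_def)
    have "\<exists>l' u'. l i < l' \<and> l' < u' \<and> u' < u i \<and> norm (x (u i) - x (l i)) \<le> norm (x u' - x l') + e" if i: "i \<in> q" for i
    proof -
      have c: "a \<le> l i" "l i < u i" "u i \<le> b" using lu[OF i] by auto
      then have li: "l i \<in> {a..b}" "u i \<in> {a..b}" by auto
      obtain d1 where d1: "d1 > 0" "\<And>s. s \<in> {a..b} \<Longrightarrow> dist s (l i) < d1 \<Longrightarrow> dist (x s) (x (l i)) < e / 2"
        using cont[unfolded continuous_on_iff, rule_format, OF li(1) half_gt_zero[OF e]] by blast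
      obtain d2 where d2: "d2 > 0" "\<And>s. s \<in> {a..b} \<Longrightarrow> dist s (u i) < d2 \<Longrightarrow> dist (x s) (x (u i)) < e / 2"
        using cont[unfolded continuous_on_iff, rule_format, OF li(2) half_gt_zero[OF e]] by blast
      define r where "r = min (min d1 d2) (u i - l i) / 3"
      have r: "r > 0" "r < d1" "r < d2" "3 * r \<le> u i - l i" using d1 d2 c by (auto simp: r_def min_def)
      have 1: "dist (x (l i + r)) (x (l i)) < e / 2" using r c by (intro d1(2)) (auto simp: dist_real_def)
      have 2: "dist (x (u i - r)) (x (u i)) < e / 2" using r c by (intro d2(2)) (auto simp: dist_real_def)
      have "norm (x (u i) - x (l i)) \<le> norm (x (u i - r) - x (l i + r)) + norm (x (u i) - x (u i - r)) + norm (x (l i + r) - x (l i))"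
        using norm_triangle_ineq[of "x (u i - r) - x (l i + r)" "(x (u i) - x (u i - r)) + (x (l i + r) - x (l i))"]
          norm_triangle_ineq[of "x (u i) - x (u i - r)" "x (l i + r) - x (l i)"] by simp
      then have "norm (x (u i) - x (l i)) \<le> norm (x (u i - r) - x (l i + r)) + e"
        using 1 2 by (simp add: dist_norm norm_minus_commute)
      then show ?thesis using r by (intro exI[of _ "l i + r"] exI[of _ "u i - r"]) auto
    qed
    then obtain l' u' where lu': "\<And>i. i \<in> q \<Longrightarrow> l i < l' i \<and> l' i < u' i \<and> u' i < u i \<and>
        norm (x (u i) - x (l i)) \<le> norm (x (u' i) - x (l' i)) + e" by metis
    obtain h where h: "bij_betw h {..<card q} q"
      using ex_bij_betw_nat_finite[OF q] by (auto simp: lessThan_atLeast0)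
    have hq: "h j \<in> q" if "j < card q" for j using h that by (auto simp: bij_betw_def)
    have "(\<Sum>j<card q. norm (x (u' (h j)) - x (l' (h j)))) \<le> \<epsilon> / 2"
    proof (rule \<delta>(2)[rule_format], intro conjI allI impI)
      fix j assume "j < card q"
      then have "h j \<in> q" by (rule hq)
      then show "a \<le> l' (h j)" "l' (h j) \<le> u' (h j)" "u' (h j) \<le> b"
        using lu[of "h j"] lu'[of "h j"] by auto
    next
      show "disjoint_family_on (\<lambda>j. {l' (h j)..u' (h j)}) {..<card q}"
        unfolding disjoint_family_on_def
      proof (intro ballI impI)
        fix j k assume jk: "j \<in> {..<card q}" "k \<in> {..<card q}" "j \<noteq> k"
        then have "h j \<in> q" "h k \<in> q" "h j \<noteq> h k" using h hq by (auto simp: bij_betw_def inj_on_def)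
        moreover from this have "{l (h j)<..<u (h j)} \<inter> {l (h k)<..<u (h k)} = {}"
          using disj unfolding disjoint_family_on_def by blast
        moreover have "{l' i..u' i} \<subseteq> {l i<..<u i}" if "i \<in> q" for i using lu'[OF that] by auto
        ultimately show "{l' (h j)..u' (h j)} \<inter> {l' (h k)..u' (h k)} = {}" by blast
      qed
      have "(\<Sum>j<card q. u' (h j) - l' (h j)) = (\<Sum>i\<in>q. u' i - l' i)"
        using sum.reindex_bij_betw[OF h, of "\<lambda>i. u' i - l' i"] .
      also have "\<dots> \<le> (\<Sum>i\<in>q. u i - l i)" using lu' by (intro sum_mono) force
      finally show "(\<Sum>j<card q. u' (h j) - l' (h j)) \<le> \<delta>" using small by simp
    qed
    then have "(\<Sum>i\<in>q. norm (x (u' i) - x (l' i))) \<le> \<epsilon> / 2"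
      using sum.reindex_bij_betw[OF h, of "\<lambda>i. norm (x (u' i) - x (l' i))"] by simp
    moreover have "(\<Sum>i\<in>q. norm (x (u i) - x (l i))) \<le> (\<Sum>i\<in>q. norm (x (u' i) - x (l' i)) + e)"
      using lu' by (intro sum_mono) blast
    moreover have "(\<Sum>i\<in>q. norm (x (u' i) - x (l' i)) + e) = (\<Sum>i\<in>q. norm (x (u' i) - x (l' i))) + card q * e"
      by (simp add: sum.distrib)
    moreover have "card q * e \<le> \<epsilon> / 2"
    proof -
      have canc: "y * (z / y) = z" if "y > 0" for y z :: real using that by simp
      have "card q * e \<le> (real (card q) + 1) * e" using e by simp
      also have "\<dots> = \<epsilon> / 2" unfolding e_def by (rule canc) (simp add: add_nonneg_pos)
      finally show ?thesis .
    qed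
    ultimately show ?thesis by linarith
  qed
  then show ?thesis by (intro that[OF \<delta>(1)]) auto
qed

text \<open>A gauge argument. Off N, differentiability gives each tag a radius within which
  increments across it are at most K + \<epsilon> times the length. As the indicator of N has
  integral 0, a further gauge keeps the total length of the intervals tagged in N below \<delta>, so
  absolute continuity bounds their increments by \<epsilon>. Telescoping over a division that is
  fine for both gauges gives the claim up to \<epsilon>.\<close>

lemma ac_lipschitz:
  fixes x :: "real \<Rightarrow> 'a::euclidean_space"
  assumes ac: "absolutely_continuous_fun (\<bullet>) a b x" and N: "negligible N" and K: "K \<ge> 0"
    and der: "\<And>t. t \<in> {a..b} - N \<Longrightarrow> \<exists>v. (x has_vector_derivative v) (at t within {a..b}) \<and> norm v \<le> K"
    and st: "a \<le> s" "s \<le> t" "t \<le> b"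
  shows "norm (x t - x s) \<le> K * (t - s)"
proof (rule le_of_small_perturbation[of 1])
  fix \<epsilon> :: real assume \<epsilon>: "0 < \<epsilon>"
  obtain \<delta> where \<delta>: "\<delta> > 0" "\<And>q l u. finite (q :: (real \<times> real set) set) \<Longrightarrow> (\<And>i. i \<in> q \<Longrightarrow> a \<le> l i \<and> l i < u i \<and> u i \<le> b) \<Longrightarrow>
     disjoint_family_on (\<lambda>i. {l i<..<u i}) q \<Longrightarrow> (\<Sum>i\<in>q. u i - l i) \<le> \<delta> \<Longrightarrow>
     (\<Sum>i\<in>q. norm (x (u i) - x (l i))) \<le> \<epsilon>"
    using ac_nonoverlapping[OF ac \<epsilon>] by blast
  have "\<exists>r>0. t \<in> {a..b} - N \<longrightarrow> (\<forall>c d. c \<in> {a..b} \<and> d \<in> {a..b} \<and> c \<le> t \<and> t \<le> d \<and> \<bar>c - t\<bar> < r \<and> \<bar>d - t\<bar> < r \<longrightarrow>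
      norm (x d - x c) \<le> (K + \<epsilon>) * (d - c))" for t
  proof (cases "t \<in> {a..b} - N")
    case True
    then obtain v where v: "(x has_vector_derivative v) (at t within {a..b})" "norm v \<le> K" using der by blast
    then obtain r where r: "r > 0" "\<And>y. y \<in> {a..b} \<Longrightarrow> norm (y - t) < r \<Longrightarrow>
        norm (x y - x t - (y - t) *\<^sub>R v) \<le> \<epsilon> * norm (y - t)"
      using \<epsilon> unfolding has_vector_derivative_def has_derivative_within_alt by blast
    have y: "norm (x y - x t) \<le> (K + \<epsilon>) * \<bar>y - t\<bar>" if "y \<in> {a..b}" "\<bar>y - t\<bar> < r" for y
    proof -
      have "norm (x y - x t) \<le> norm (x y - x t - (y - t) *\<^sub>R v) + norm ((y - t) *\<^sub>R v)"
        using norm_triangle_ineq[of "x y - x t - (y - t) *\<^sub>R v" "(y - t) *\<^sub>R v"] by simp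
      also have "\<dots> \<le> \<epsilon> * \<bar>y - t\<bar> + \<bar>y - t\<bar> * K"
        using r(2)[of y] that v(2) by (intro add_mono) (auto intro: mult_left_mono)
      finally show ?thesis by (simp add: algebra_simps)
    qed
    have "norm (x d - x c) \<le> (K + \<epsilon>) * (d - c)"
      if "c \<in> {a..b}" "d \<in> {a..b}" "c \<le> t" "t \<le> d" "\<bar>c - t\<bar> < r" "\<bar>d - t\<bar> < r" for c d
    proof -
      have "norm (x d - x c) \<le> norm (x d - x t) + norm (x c - x t)"
        using norm_triangle_ineq4[of "x d - x t" "x c - x t"] by simp
      then show ?thesis using y[of c] y[of d] that by (simp add: algebra_simps)
    qed
    then show ?thesis using r(1) by blast
  qed (auto intro: exI[of _ 1])
  then obtain r where r: "\<And>t. r t > 0" "\<And>t c d. t \<in> {a..b} - N \<Longrightarrow> c \<in> {a..b} \<Longrightarrow> d \<in> {a..b} \<Longrightarrow> c \<le> t \<Longrightarrow> t \<le> d \<Longrightarrow>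
      \<bar>c - t\<bar> < r t \<Longrightarrow> \<bar>d - t\<bar> < r t \<Longrightarrow> norm (x d - x c) \<le> (K + \<epsilon>) * (d - c)"
    by metis
  have "((indicator N :: real \<Rightarrow> real) has_integral 0) {s..t}"
    using N unfolding negligible_def by (metis box_real(2))
  then obtain \<gamma> where \<gamma>: "gauge \<gamma>" "\<And>\<D>. \<D> tagged_division_of {s..t} \<Longrightarrow> \<gamma> fine \<D> \<Longrightarrow>
      norm (sum (\<lambda>(x,k). measure lborel k *\<^sub>R (indicator N x :: real)) \<D> - 0) < \<delta>"
    unfolding has_integral_real using \<delta>(1) by meson
  have "gauge (\<lambda>t. ball t (r t))" using r(1) by (simp add: gauge_ball_dependent)
  then have "gauge (\<lambda>t. \<gamma> t \<inter> ball t (r t))" using \<gamma>(1) by (rule gauge_Int[rotated])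
  then obtain p where p: "p tagged_division_of {s..t}" "(\<lambda>t. \<gamma> t \<inter> ball t (r t)) fine p"
    by (rule fine_division_exists_real)
  have fine: "\<gamma> fine p" "(\<lambda>t. ball t (r t)) fine p" using p(2) by (auto simp: fine_def)
  have fin: "finite p" using p(1) by blast
  have pk: "\<exists>c d. k = {c..d} \<and> c \<le> \<tau> \<and> \<tau> \<le> d \<and> s \<le> c \<and> d \<le> t \<and> Inf k = c \<and> Sup k = d \<and> \<bar>c - \<tau>\<bar> < r \<tau> \<and> \<bar>d - \<tau>\<bar> < r \<tau>"
    if k: "(\<tau>, k) \<in> p" for \<tau> k
  proof -
    obtain c d where cd: "k = cbox c d" using tagged_division_ofD(4)[OF p(1) k] by blast
    have "\<tau> \<in> k" "k \<subseteq> {s..t}" using tagged_division_ofD(2,3)[OF p(1) k] by auto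
    moreover have "k \<subseteq> ball \<tau> (r \<tau>)" using fine(2) k by (auto simp: fine_def)
    ultimately have c: "c \<le> \<tau>" "\<tau> \<le> d" "{c..d} \<subseteq> {s..t}" "{c..d} \<subseteq> ball \<tau> (r \<tau>)" by (auto simp: cd)
    then have cc: "c \<in> {c..d}" "d \<in> {c..d}" by auto
    then have "s \<le> c" "d \<le> t" "\<bar>c - \<tau>\<bar> < r \<tau>" "\<bar>d - \<tau>\<bar> < r \<tau>"
      using c(3,4) by (auto simp: subset_iff dist_real_def abs_minus_commute)
    then show ?thesis using c by (intro exI[of _ c] exI[of _ d]) (auto simp: cd)
  qed
  let ?w = "\<lambda>(\<tau>::real, k). norm (x (Sup k) - x (Inf k))"
  \<comment> \<open>The intervals tagged in N. Degenerate ones are left out because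
    \<open>ac_nonoverlapping\<close> asks for l < u; they contribute no increment.\<close>
  define q where "q = {(\<tau>, k) \<in> p. \<tau> \<in> N \<and> Inf k < Sup k}"
  have qp: "q \<subseteq> p" by (auto simp: q_def)
  have "x t - x s = (\<Sum>(\<tau>, k)\<in>p. x (Sup k) - x (Inf k))"
    using additive_tagged_division_1[OF st(2) p(1), of x] by simp
  also have "norm \<dots> \<le> (\<Sum>i\<in>p. norm (case i of (\<tau>, k) \<Rightarrow> x (Sup k) - x (Inf k)))" by (rule norm_sum)
  also have "\<dots> = sum ?w p" by (intro sum.cong) auto
  also have "\<dots> = sum ?w q + sum ?w (p - q)" using fin qp by (simp add: sum.subset_diff)
  also have "sum ?w q \<le> \<epsilon>"
  proof -
    have "(\<Sum>i\<in>q. norm (x (Sup (snd i)) - x (Inf (snd i)))) \<le> \<epsilon>"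
    proof (rule \<delta>(2))
      show "finite q" using fin qp finite_subset by blast
      show "a \<le> Inf (snd i) \<and> Inf (snd i) < Sup (snd i) \<and> Sup (snd i) \<le> b" if "i \<in> q" for i
        using pk[of "fst i" "snd i"] that st by (fastforce simp: q_def)
      show "disjoint_family_on (\<lambda>i. {Inf (snd i)<..<Sup (snd i)}) q"
        unfolding disjoint_family_on_def
      proof (intro ballI impI)
        fix i j assume ij: "i \<in> q" "j \<in> q" "i \<noteq> j"
        have "interior (snd i) \<inter> interior (snd j) = {}"
          using tagged_division_ofD(5)[OF p(1), of "fst i" "snd i" "fst j" "snd j"] ij qp by auto
        moreover have "{Inf (snd i)<..<Sup (snd i)} \<subseteq> interior (snd i)" if "i \<in> q" for i
        proof (rule interior_maximal)
          have "(fst i, snd i) \<in> p" using that qp by auto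
          from pk[OF this] have "snd i = {Inf (snd i)..Sup (snd i)}" by metis
          then show "{Inf (snd i)<..<Sup (snd i)} \<subseteq> snd i"
            by (metis greaterThanLessThan_subseteq_atLeastAtMost_iff order_refl)
        qed simp
        ultimately show "{Inf (snd i)<..<Sup (snd i)} \<inter> {Inf (snd j)<..<Sup (snd j)} = {}"
          using ij by blast
      qed
      have "(\<Sum>i\<in>q. Sup (snd i) - Inf (snd i)) = (\<Sum>(\<tau>, k)\<in>q. measure lborel k *\<^sub>R (indicator N \<tau> :: real))"
      proof (intro sum.cong refl)
        fix i assume i: "i \<in> q"
        then obtain c d where "snd i = {c..d}" "c \<le> d" "Inf (snd i) = c" "Sup (snd i) = d" "fst i \<in> N"
          using pk[of "fst i" "snd i"] by (fastforce simp: q_def)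
        then show "Sup (snd i) - Inf (snd i) = (case i of (\<tau>, k) \<Rightarrow> measure lborel k *\<^sub>R (indicator N \<tau> :: real))"
          by (cases i) auto
      qed
      also have "\<dots> \<le> (\<Sum>(\<tau>, k)\<in>p. measure lborel k *\<^sub>R (indicator N \<tau> :: real))"
        using fin qp by (intro sum_mono2) (auto simp: indicator_def)
      also have "\<dots> \<le> \<delta>" using \<gamma>(2)[OF p(1) fine(1)] by simp
      finally show "(\<Sum>i\<in>q. Sup (snd i) - Inf (snd i)) \<le> \<delta>" .
    qed
    then show ?thesis by (simp add: case_prod_unfold)
  qed
  also have "sum ?w (p - q) \<le> (\<Sum>(\<tau>, k)\<in>p - q. (K + \<epsilon>) * (Sup k - Inf k))"
  proof (intro sum_mono)
    fix i assume i: "i \<in> p - q"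
    obtain \<tau> k where ik: "i = (\<tau>, k)" by (cases i)
    obtain c d where cd: "k = {c..d}" "c \<le> \<tau>" "\<tau> \<le> d" "s \<le> c" "d \<le> t" "Inf k = c" "Sup k = d" "\<bar>c - \<tau>\<bar> < r \<tau>" "\<bar>d - \<tau>\<bar> < r \<tau>"
      using pk[of \<tau> k] i unfolding ik by blast
    have "norm (x d - x c) \<le> (K + \<epsilon>) * (d - c)"
    proof (cases "\<tau> \<in> N")
      case True
      then have "c = d" using i cd unfolding ik q_def by auto
      then show ?thesis by simp
    next
      case False
      then show ?thesis using cd st by (intro r(2)[of \<tau>]) auto
    qed
    then show "?w i \<le> (case i of (\<tau>, k) \<Rightarrow> (K + \<epsilon>) * (Sup k - Inf k))" by (simp add: ik cd(6,7))
  qed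
  also have "(\<Sum>(\<tau>, k)\<in>p - q. (K + \<epsilon>) * (Sup k - Inf k)) \<le> (\<Sum>(\<tau>, k)\<in>p. (K + \<epsilon>) * (Sup k - Inf k))"
  proof (intro sum_mono2 fin)
    fix i assume "i \<in> p - (p - q)"
    then show "0 \<le> (case i of (\<tau>, k) \<Rightarrow> (K + \<epsilon>) * (Sup k - Inf k))"
      using K \<epsilon> by (auto simp: q_def)
  qed auto
  also have "(\<Sum>(\<tau>, k)\<in>p. (K + \<epsilon>) * (Sup k - Inf k)) = (K + \<epsilon>) * (\<Sum>(\<tau>, k)\<in>p. Sup k - Inf k)"
    by (simp add: sum_distrib_left case_prod_unfold)
  also have "(\<Sum>(\<tau>, k)\<in>p. Sup k - Inf k) = t - s"
    using additive_tagged_division_1[OF st(2) p(1), of "\<lambda>y. y"] .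
  finally show "norm (x t - x s) \<le> K * (t - s) + (1 + (t - s)) * \<epsilon>"
    by (simp add: algebra_simps)
qed simp

text \<open>Enclose N in an open set T of measure less than \<epsilon> and subtract from F the
  correction C * m, where m t measures the part of T up to time t. At times in N, m grows at unit
  rate, and C = M + |q| outweighs the worst behaviour of F; at other times monotonicity of m has the
  right sign. The correction totals at most C * \<epsilon>.\<close>

lemma creeping_left_negligible:
  fixes F :: "real \<Rightarrow> real"
  assumes ab: "a \<le> b" and N: "negligible N" and M: "M \<ge> 0"
    and F: "\<And>s t. a \<le> s \<Longrightarrow> s \<le> t \<Longrightarrow> t \<le> b \<Longrightarrow> \<bar>F t - F s\<bar> \<le> M * (t - s)"
    and loc: "\<And>t. a < t \<Longrightarrow> t \<le> b \<Longrightarrow> t \<notin> N \<Longrightarrow> \<forall>\<^sub>F h in at_right 0. F t + q * h \<le> F (t - h)"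
  shows "q * (b - a) \<le> F a - F b"
proof (rule le_of_small_perturbation[of 1])
  fix \<epsilon> :: real assume \<epsilon>: "0 < \<epsilon>"
  have Nn: "N \<in> null_sets lebesgue" using N by (simp add: negligible_iff_null_sets)
  obtain T where T: "open T" "N \<subseteq> T" "emeasure lebesgue (T - N) < ennreal \<epsilon>"
    using sets_lebesgue_outer_open[OF null_setsD2[OF Nn] \<epsilon>] by blast
  have Ts: "T \<in> sets lebesgue" using T(1) by (simp add: borel_open sets_completionI_sets)
  have em: "emeasure lebesgue T < ennreal \<epsilon>" using T(3) emeasure_Diff_null_set[OF Nn Ts] by simp
  have Tm: "T \<in> lmeasurable"
  proof (rule fmeasurableI[OF Ts])
    show "emeasure lebesgue T < \<infinity>" using em by (rule order.strict_trans) simp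
  qed
  have "measure lebesgue T < \<epsilon>"
    using em \<epsilon> Tm by (simp add: emeasure_eq_measure2 ennreal_less_iff)
  note T = T(1,2) Tm this
  define m where "m t = measure lebesgue (T \<inter> {a..t})" for t
  have meas: "T \<inter> {s..t} \<in> lmeasurable" "T \<inter> {s<..t} \<in> lmeasurable" for s t
    by (auto intro!: fmeasurable_Int_fmeasurable[OF T(3)])
  have split: "m t = m s + measure lebesgue (T \<inter> {s<..t})" if "a \<le> s" "s \<le> t" for s t
  proof -
    have "T \<inter> {a..t} = (T \<inter> {a..s}) \<union> (T \<inter> {s<..t})" using that by auto
    moreover have "(T \<inter> {a..s}) \<inter> (T \<inter> {s<..t}) = {}" by auto
    ultimately show ?thesis
      unfolding m_def using measure_Un3[OF meas, of a s s t] by simp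
  qed
  have m0: "0 \<le> measure lebesgue (T \<inter> {s<..t})" for s t by simp
  have m1: "measure lebesgue (T \<inter> {s<..t}) \<le> t - s" if "s \<le> t" for s t
  proof -
    have "measure lebesgue (T \<inter> {s<..t}) \<le> measure lebesgue {s..t}"
      by (intro measure_mono_fmeasurable) (use meas in \<open>auto simp: fmeasurableD\<close>)
    then show ?thesis using that by simp
  qed
  define C where "C = M + \<bar>q\<bar>"
  have C: "C \<ge> 0" using M by (simp add: C_def)
  define H where "H t = F t - C * m t" for t
  have "(M + C)-lipschitz_on {a..b} H"
  proof (rule lipschitz_onI)
    have *: "\<bar>H t - H s\<bar> \<le> (M + C) * (t - s)" if "a \<le> s" "s \<le> t" "t \<le> b" for s t
    proof -
      have "\<bar>F t - F s\<bar> \<le> M * (t - s)" using F that by blast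
      moreover have "0 \<le> C * (m t - m s)" using split[of s t] that m0[of s t] C by simp
      moreover have "C * (m t - m s) \<le> C * (t - s)" using split[of s t] that m1[of s t] C by (intro mult_left_mono) auto
      moreover have "H t - H s = (F t - F s) - C * (m t - m s)" by (simp add: H_def algebra_simps)
      ultimately show ?thesis unfolding distrib_right by linarith
    qed
    fix s t assume st: "s \<in> {a..b}" "t \<in> {a..b}"
    show "dist (H s) (H t) \<le> (M + C) * dist s t"
    proof (cases "s \<le> t")
      case True
      then show ?thesis using *[of s t] st by (simp add: dist_real_def abs_minus_commute)
    next
      case False
      then show ?thesis using *[of t s] st by (simp add: dist_real_def)
    qed
  qed (use M C in simp)
  then have cont: "continuous_on {a..b} H" by (rule lipschitz_on_continuous_on)
  have "q * (b - a) \<le> H a - H b"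
  proof (rule creeping_left[OF ab cont])
    fix t assume t: "a < t" "t \<le> b"
    have ev: "\<forall>\<^sub>F h in at_right (0::real). h < t - a \<and> 0 < h"
      using t by (intro eventually_at_rightI[of 0 "t - a"]) auto
    show "\<forall>\<^sub>F h in at_right 0. H t + q * h \<le> H (t - h)"
    proof (cases "t \<in> N")
      case False
      from loc[OF t False] ev show ?thesis
      proof eventually_elim
        case (elim h)
        have "C * m (t - h) \<le> C * m t" using split[of "t - h" t] m0[of "t - h" t] elim C by (intro mult_left_mono) auto
        then show ?case using elim unfolding H_def by linarith
      qed
    next
      case True
      then obtain e where e: "e > 0" "ball t e \<subseteq> T" using T(1,2) open_contains_ball by blast
      have "\<forall>\<^sub>F h in at_right (0::real). h < e" using e by (intro eventually_at_rightI[of 0 e]) auto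
      with ev show ?thesis
      proof eventually_elim
        case (elim h)
        have "{t - h<..t} \<subseteq> ball t e" using elim by (auto simp: dist_real_def)
        then have "T \<inter> {t - h<..t} = {t - h<..t}" using e(2) by blast
        then have "m t = m (t - h) + h" using split[of "t - h" t] elim by simp
        moreover have "\<bar>F t - F (t - h)\<bar> \<le> M * h" using F[of "t - h" t] elim t by simp
        moreover have "q * h \<le> \<bar>q\<bar> * h" using elim by (intro mult_right_mono) auto
        ultimately show ?case unfolding H_def C_def by (simp add: algebra_simps)
      qed
    qed
  qed
  moreover have "m b \<le> measure lebesgue T"
    unfolding m_def by (intro measure_mono_fmeasurable T(3)) (use meas in \<open>auto simp: fmeasurableD\<close>)
  then have "C * m b \<le> C * \<epsilon>" using T(4) C by (intro mult_left_mono) auto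
  moreover have "0 \<le> C * m a" using C by (simp add: m_def)
  ultimately show "q * (b - a) \<le> F a - F b + C * \<epsilon>" unfolding H_def by linarith
qed simp

text \<open>Each such point has a rational to its left with no point of X in between, and different
  points have different rationals.\<close>

lemma countable_left_isolated:
  fixes X :: "real set"
  shows "countable {t \<in> X. \<not> (\<exists>\<^sub>F h in at_right 0. t - h \<in> X)}"
proof -
  define I where "I = {t \<in> X. \<not> (\<exists>\<^sub>F h in at_right 0. t - h \<in> X)}"
  have "\<exists>r. r \<in> \<rat> \<and> r < t \<and> (\<forall>s. r < s \<and> s < t \<longrightarrow> s \<notin> X)" if "t \<in> I" for t
  proof -
    have "\<forall>\<^sub>F h in at_right 0. t - h \<notin> X" using that by (simp add: I_def not_frequently)
    then obtain d where d: "d > 0" "\<And>h. 0 < h \<Longrightarrow> h < d \<Longrightarrow> t - h \<notin> X"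
      unfolding eventually_at_right_field by blast
    obtain r where r: "r \<in> \<rat>" "t - d < r" "r < t" using Rats_dense_in_real[of "t - d" t] d(1) by auto
    have "s \<notin> X" if "r < s" "s < t" for s using d(2)[of "t - s"] that r by simp
    then show ?thesis using r by blast
  qed
  then have "\<forall>t\<in>I. \<exists>r. r \<in> \<rat> \<and> r < t \<and> (\<forall>s. r < s \<and> s < t \<longrightarrow> s \<notin> X)" by blast
  from bchoice[OF this] obtain r where r: "\<forall>t\<in>I. r t \<in> \<rat> \<and> r t < t \<and> (\<forall>s. r t < s \<and> s < t \<longrightarrow> s \<notin> X)"
    by (rule exE)
  have IX: "t \<in> X" if "t \<in> I" for t using that by (simp add: I_def)
  have "inj_on r I"
  proof (rule inj_onI)
    have *: "\<not> s < t" if "s \<in> I" "t \<in> I" "r s = r t" for s t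
      using bspec[OF r that(2)] IX[OF that(1)] bspec[OF r that(1)] that(3) by auto
    fix s t assume "s \<in> I" "t \<in> I" "r s = r t"
    then show "s = t" using *[of s t] *[of t s] by linarith
  qed
  moreover have "countable (r ` I)" by (rule countable_subset[OF _ countable_rat]) (use r in blast)
  ultimately show ?thesis using countable_image_inj_on unfolding I_def by blast
qed

section \<open>The tame objective function\<close>

text \<open>This replaces the upper limit in the extended reals by the first-order form used in
  \<open>clarke_ge\<close>. A single \<delta> may control base point, step and slope error, since
  one can pass to the minimum of three tolerances.\<close>

lemma clarke_dderiv_ge_iff:
  "ereal q \<le> clarke_dderiv f x d \<longleftrightarrow>
    (\<forall>\<delta>>0. \<exists>z t. norm (z - x) < \<delta> \<and> 0 < t \<and> t < \<delta> \<and> f z + (q - \<delta>) * t \<le> f (z + t *\<^sub>R d))"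
proof (intro iffI allI impI)
  fix \<delta> :: real assume q: "ereal q \<le> clarke_dderiv f x d" and \<delta>: "\<delta> > 0"
  show "\<exists>z t. norm (z - x) < \<delta> \<and> 0 < t \<and> t < \<delta> \<and> f z + (q - \<delta>) * t \<le> f (z + t *\<^sub>R d)"
  proof (rule ccontr)
    assume none: "\<not> ?thesis"
    have "\<forall>\<^sub>F (y, t) in nhds x \<times>\<^sub>F at_right 0. ereal ((f (y + t *\<^sub>R d) - f y) / t) \<le> ereal (q - \<delta>)"
      unfolding eventually_prod_filter prod.case
    proof (intro exI conjI allI impI)
      show "\<forall>\<^sub>F y in nhds x. y \<in> ball x \<delta>" using \<delta> by (intro eventually_nhds_in_open) auto
      show "\<forall>\<^sub>F t in at_right (0::real). 0 < t \<and> t < \<delta>"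
        using \<delta> by (intro eventually_at_rightI[of 0 \<delta>]) auto
      fix y t assume y: "y \<in> ball x \<delta>" and t: "0 < t \<and> t < \<delta>"
      then have "\<not> f y + (q - \<delta>) * t \<le> f (y + t *\<^sub>R d)"
        using none by (auto simp: dist_norm norm_minus_commute)
      then show "ereal ((f (y + t *\<^sub>R d) - f y) / t) \<le> ereal (q - \<delta>)"
        using t by (simp only: ereal_less_eq pos_divide_le_eq)
    qed
    then have "clarke_dderiv f x d \<le> ereal (q - \<delta>)"
      unfolding clarke_dderiv_def by (intro Limsup_bounded) (simp add: case_prod_unfold)
    with q have "ereal q \<le> ereal (q - \<delta>)" by (rule order_trans)
    then show False using \<delta> by simp
  qed
next
  assume c: "\<forall>\<delta>>0. \<exists>z t. norm (z - x) < \<delta> \<and> 0 < t \<and> t < \<delta> \<and> f z + (q - \<delta>) * t \<le> f (z + t *\<^sub>R d)"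
  show "ereal q \<le> clarke_dderiv f x d"
  proof (rule ccontr)
    assume "\<not> ?thesis"
    then obtain r where r: "clarke_dderiv f x d < ereal r" "ereal r < ereal q"
      using ereal_dense2 by (metis not_le)
    have "\<forall>\<^sub>F p in nhds x \<times>\<^sub>F at_right 0. (case p of (y, t) \<Rightarrow> ereal ((f (y + t *\<^sub>R d) - f y) / t)) < ereal r"
      using r(1) unfolding clarke_dderiv_def by (rule Limsup_lessD)
    then obtain Pf Pg where P: "\<forall>\<^sub>F y in nhds x. Pf y" "\<forall>\<^sub>F t in at_right 0. Pg t"
      "\<And>y t. Pf y \<Longrightarrow> Pg t \<Longrightarrow> (f (y + t *\<^sub>R d) - f y) / t < r"
      unfolding eventually_prod_filter by auto
    obtain e where e: "e > 0" "\<And>y. dist y x < e \<Longrightarrow> Pf y" using P(1) unfolding eventually_nhds_metric by blast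
    obtain b where b: "b > 0" "\<And>t. 0 < t \<Longrightarrow> t < b \<Longrightarrow> Pg t" using P(2) unfolding eventually_at_right_field by blast
    define \<delta> where "\<delta> = min (min e b) (q - r)"
    have \<delta>: "\<delta> > 0" "\<delta> \<le> e" "\<delta> \<le> b" "\<delta> \<le> q - r" using e b r by (auto simp: \<delta>_def)
    obtain z t where z: "norm (z - x) < \<delta>" "0 < t" "t < \<delta>" "f z + (q - \<delta>) * t \<le> f (z + t *\<^sub>R d)"
      using c \<delta>(1) by blast
    have "(f (z + t *\<^sub>R d) - f z) / t < r"
      using z \<delta> by (intro P(3) e(2) b(2)) (auto simp: dist_norm)
    then have "f (z + t *\<^sub>R d) - f z < r * t" using z(2) by (simp add: divide_less_eq)
    moreover have "r * t \<le> (q - \<delta>) * t" using \<delta>(4) z(2) by (intro mult_right_mono) auto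
    ultimately show False using z(4) by linarith
  qed
qed

locale tame_problem = omin S for S +
  fixes js :: "'n::finite list"
    and ip :: "real ^ 'n \<Rightarrow> real ^ 'n \<Rightarrow> real"
    and f :: "real ^ 'n \<Rightarrow> real"
  assumes js: "distinct js" "set js = UNIV"
    and ip: "inner_product ip"
    and loc_lip: "locally_Lipschitz ip f" and coer: "coercive ip f" and tame: "tame_function S js ip f"
begin

section \<open>The given inner product, compared with the Euclidean norm\<close>

lemma ip_sym: "ip x y = ip y x" and ip_linear: "linear (\<lambda>x. ip x y)" and ip_pos: "x \<noteq> 0 \<Longrightarrow> ip x x > 0"
  using ip unfolding inner_product_def by blast+

lemma ip_linear2: "linear (\<lambda>y. ip x y)"
  using ip_linear[of x] by (simp add: ip_sym[of x])

lemma bilinear_ip: "bilinear ip"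
  unfolding bilinear_def using ip_linear ip_linear2 by blast

lemma ip_nonneg: "ip x x \<ge> 0"
  using ip_pos[of x] linear_0[OF ip_linear, of 0] by (cases "x = 0") auto

lemma ip_norm_sq: "ip_norm ip x ^ 2 = ip x x"
  by (simp add: ip_norm_def ip_nonneg)

lemma ip_norm_nonneg: "0 \<le> ip_norm ip x"
  by (simp add: ip_norm_def ip_nonneg)

lemma ip_bound: "\<exists>B>0. \<forall>x y. \<bar>ip x y\<bar> \<le> B * norm x * norm y"
proof -
  obtain B where B: "\<And>x y. norm (ip x y) \<le> B * norm x * norm y"
    using bilinear_bounded[OF bilinear_ip] by blast
  have "\<bar>ip x y\<bar> \<le> (\<bar>B\<bar> + 1) * norm x * norm y" for x y
  proof -
    have "B * norm x * norm y \<le> (\<bar>B\<bar> + 1) * norm x * norm y" by (intro mult_right_mono) auto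
    then show ?thesis using B[of x y] by simp
  qed
  then show ?thesis by (intro exI[of _ "\<bar>B\<bar> + 1"]) auto
qed

lemma ip_norm_equiv:
  obtains l u where "l > 0" "u > 0" "\<And>x. l * norm x \<le> ip_norm ip x" "\<And>x. ip_norm ip x \<le> u * norm x"
proof -
  obtain B where B: "B > 0" "\<And>x y. \<bar>ip x y\<bar> \<le> B * norm x * norm y" using ip_bound by blast
  have cont: "continuous_on (sphere 0 1) (\<lambda>x. ip x x)"
    by (rule bilinear_continuous_on_compose[OF continuous_on_id continuous_on_id bilinear_ip])
  have ne: "(sphere 0 1 :: (real^'n) set) \<noteq> {}" by simp
  obtain z where z: "z \<in> sphere 0 1" "\<And>x. x \<in> sphere 0 1 \<Longrightarrow> ip z z \<le> ip x x"
    using continuous_attains_inf[OF compact_sphere ne cont] by blast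
  have zp: "ip z z > 0" using z(1) by (intro ip_pos) auto
  have low: "ip z z * norm x ^ 2 \<le> ip x x" for x
  proof (cases "x = 0")
    case False
    let ?y = "(1 / norm x) *\<^sub>R x"
    have "ip z z \<le> ip ?y ?y" using False by (intro z(2)) auto
    also have "ip ?y ?y = ip x x / norm x ^ 2"
      by (simp add: linear_scale[OF ip_linear] linear_scale[OF ip_linear2] power2_eq_square)
    finally show ?thesis using False by (simp add: le_divide_eq)
  qed (simp add: ip_nonneg)
  show ?thesis
  proof (rule that)
    show "sqrt (ip z z) > 0" "sqrt B > 0" using zp B by auto
    show "sqrt (ip z z) * norm x \<le> ip_norm ip x" for x
      using real_sqrt_le_mono[OF low[of x]] by (simp add: ip_norm_def real_sqrt_mult)
    have "ip x x \<le> B * norm x ^ 2" for x using B(2)[of x x] by (simp add: power2_eq_square)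
    from real_sqrt_le_mono[OF this] show "ip_norm ip x \<le> sqrt B * norm x" for x
      by (simp add: ip_norm_def real_sqrt_mult)
  qed
qed

lemma f_lipschitz_on_cball:
  obtains L where "L > 0" "\<And>x y. x \<in> cball 0 R \<Longrightarrow> y \<in> cball 0 R \<Longrightarrow> \<bar>f x - f y\<bar> \<le> L * norm (x - y)"
proof -
  obtain l u where lu: "l > 0" "u > 0" "\<And>x. l * norm x \<le> ip_norm ip x" "\<And>x. ip_norm ip x \<le> u * norm x"
    using ip_norm_equiv by blast
  \<comment> \<open>The time parameter of \<open>local_lipschitz\<close> is a dummy, confined to the
    single point 0.\<close>
  have "local_lipschitz {0::real} (cball 0 R) (\<lambda>t. f)"
    unfolding local_lipschitz_def
  proof (intro ballI)
    fix a :: "real^'n" and t :: real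
    obtain r L where r: "r > 0" "L > 0" "\<And>x y. x \<in> ip_cball ip a r \<Longrightarrow> y \<in> ip_cball ip a r \<Longrightarrow>
        \<bar>f x - f y\<bar> \<le> L * ip_norm ip (x - y)"
      using loc_lip unfolding locally_Lipschitz_def by blast
    have sub: "x \<in> ip_cball ip a r" if "x \<in> cball a (r / u)" for x
    proof -
      have "ip_norm ip (x - a) \<le> u * (r / u)"
        using that lu(2) by (intro order_trans[OF lu(4)] mult_left_mono) (auto simp: dist_norm norm_minus_commute)
      then show ?thesis using lu(2) by (simp add: ip_cball_def)
    qed
    have "(L * u)-lipschitz_on (cball a (r / u) \<inter> cball 0 R) f"
    proof (rule lipschitz_onI)
      fix x y assume "x \<in> cball a (r / u) \<inter> cball 0 R" "y \<in> cball a (r / u) \<inter> cball 0 R"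
      then have "\<bar>f x - f y\<bar> \<le> L * ip_norm ip (x - y)" by (intro r(3) sub) auto
      also have "\<dots> \<le> L * (u * norm (x - y))" using lu(4) r(2) by (intro mult_left_mono) auto
      finally show "dist (f x) (f y) \<le> L * u * dist x y" by (simp add: dist_norm)
    qed (use r lu in simp)
    then show "\<exists>u>0. \<exists>L. \<forall>t\<in>cball t u \<inter> {0}. L-lipschitz_on (cball a u \<inter> cball 0 R) f"
      using r(1) lu(2) by (intro exI[of _ "r / u"]) auto
  qed
  then obtain L where L: "L-lipschitz_on (cball 0 R) f"
    using local_lipschitz_compact_implies_lipschitz[of "{0::real}" "cball 0 R" "\<lambda>t. f"] by auto
  have "\<bar>f x - f y\<bar> \<le> (\<bar>L\<bar> + 1) * norm (x - y)" if "x \<in> cball 0 R" "y \<in> cball 0 R" for x y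
  proof -
    have "\<bar>f x - f y\<bar> \<le> L * norm (x - y)" using lipschitz_onD[OF L that] by (simp add: dist_norm)
    also have "\<dots> \<le> (\<bar>L\<bar> + 1) * norm (x - y)" by (intro mult_right_mono) auto
    finally show ?thesis .
  qed
  then show ?thesis by (intro that[of "\<bar>L\<bar> + 1"]) auto
qed

lemma continuous_f: "continuous_on UNIV f"
proof -
  have "isCont f x" for x
  proof -
    obtain L where L: "L > 0" "\<And>y z. y \<in> cball 0 (norm x + 1) \<Longrightarrow> z \<in> cball 0 (norm x + 1) \<Longrightarrow> \<bar>f y - f z\<bar> \<le> L * norm (y - z)"
      using f_lipschitz_on_cball by blast
    have "L-lipschitz_on (ball 0 (norm x + 1)) f"
      using L by (intro lipschitz_onI) (auto simp: dist_norm)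
    then have "continuous_on (ball 0 (norm x + 1)) f" by (rule lipschitz_on_continuous_on)
    then show ?thesis by (simp add: continuous_on_eq_continuous_at)
  qed
  then show ?thesis by (simp add: continuous_at_imp_continuous_on)
qed

lemma is_enum_graph: "is_enum (map (\<lambda>j. (axis j 1 :: real^'n, 0)) js @ [(0, 1 :: real)])"
proof -
  have "set (map (\<lambda>j. (axis j 1 :: real^'n, 0)) js @ [(0, 1 :: real)]) = Basis"
    using js(2) by (auto simp: Basis_prod_def Basis_vec_def)
  moreover have "distinct (map (\<lambda>j. (axis j 1 :: real^'n, 0)) js @ [(0, 1 :: real)])"
    using js(1) by (auto simp: distinct_map inj_on_def axis_eq_axis)
  ultimately show ?thesis by (simp add: is_enum_def)
qed

text \<open>Tameness concerns the graph inside balls of the product space. As f is bounded by B on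
  the ball of radius R, the graph over it lies in one ball: the radius r dominates both u * |R|, a
  bound for the given norm, and B, with
  \<open>(u * \<bar>R\<bar>)\<^sup>2 + B\<^sup>2 \<le> r\<^sup>2\<close>.\<close>

lemma defpred_graph: "defpred (\<lambda>p. norm (fst p) \<le> R \<and> f (fst p) = snd p)"
proof -
  obtain l u where lu: "l > 0" "u > 0" "\<And>x. l * norm x \<le> ip_norm ip x" "\<And>x. ip_norm ip x \<le> u * norm x"
    using ip_norm_equiv by blast
  obtain L where L: "L > 0" "\<And>x y. x \<in> cball 0 R \<Longrightarrow> y \<in> cball 0 R \<Longrightarrow> \<bar>f x - f y\<bar> \<le> L * norm (x - y)"
    using f_lipschitz_on_cball by blast
  define B where "B = \<bar>f 0\<bar> + L * \<bar>R\<bar>"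
  have B: "\<bar>f x\<bar> \<le> B" if "norm x \<le> R" for x
  proof -
    have R: "0 \<le> R" using that norm_ge_zero[of x] by linarith
    then have "\<bar>f x - f 0\<bar> \<le> L * norm (x - 0)" using that by (intro L(2)) auto
    moreover have "L * norm x \<le> L * \<bar>R\<bar>" using that R L(1) by (intro mult_left_mono) auto
    ultimately show ?thesis unfolding B_def by simp
  qed
  define ip2 where "ip2 = (\<lambda>(x, t) (y, s). ip x y + t * (s::real))"
  define r where "r = u * \<bar>R\<bar> + B + 1"
  have B0: "B \<ge> 0" using L(1) by (simp add: B_def)
  have r: "r > 0" using lu(2) B0 by (simp add: r_def add_nonneg_pos)
  let ?G = "{(x, t). f x = t} \<inter> ip_cball ip2 0 r"
  let ?bs = "map (\<lambda>j. (axis j 1 :: real^'n, 0)) js @ [(0, 1 :: real)]"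
  have "(\<lambda>(x, t). map (\<lambda>j. x $ j) js @ [t]) ` ?G \<in> S (CARD('n) + 1)"
    using tame r unfolding tame_function_def tame_set_def ip2_def by blast
  moreover have "(\<lambda>(x, t). map (\<lambda>j. x $ j) js @ [t]) = coords ?bs"
    by (auto simp: coords_def fun_eq_iff inner_axis)
  moreover have "DIM((real^'n) \<times> real) = CARD('n) + 1" by simp
  ultimately have "coords ?bs ` {p. p \<in> ?G} \<in> S DIM((real^'n) \<times> real)"
    unfolding Collect_mem_eq by metis
  then have G: "defpred (\<lambda>p. p \<in> ?G)" using is_enum_graph unfolding defpred_def by blast
  have "defpred (\<lambda>p::(real^'n) \<times> real. p \<in> ?G \<and> norm (fst p) \<le> R)" by (intro defpred_intros G)
  moreover have "(p \<in> ?G \<and> norm (fst p) \<le> R) = (norm (fst p) \<le> R \<and> f (fst p) = snd p)" for p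
  proof -
    have "p \<in> ip_cball ip2 0 r" if p: "norm (fst p) \<le> R" "f (fst p) = snd p"
    proof -
      have a: "ip_norm ip (fst p) \<le> u * \<bar>R\<bar>"
        using p(1) lu(2) by (intro order_trans[OF lu(4)] mult_left_mono) auto
      have b: "\<bar>snd p\<bar> \<le> B" using B p by metis
      have "ip2 p p = ip_norm ip (fst p) ^ 2 + (snd p) ^ 2"
        unfolding ip_norm_sq by (simp add: ip2_def power2_eq_square case_prod_unfold)
      also have "\<dots> \<le> (u * \<bar>R\<bar>) ^ 2 + B ^ 2"
        using power_mono[OF a ip_norm_nonneg, of 2] power2_le_iff_abs_le[OF B0, of "snd p"] b by linarith
      also have "\<dots> \<le> r ^ 2"
        using B0 lu(2) by (simp add: r_def power2_eq_square algebra_simps)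
      finally have "sqrt (ip2 p p) \<le> r" using r by (intro real_le_lsqrt) auto
      then show ?thesis by (simp add: ip_cball_def ip_norm_def)
    qed
    then show ?thesis by (auto simp: case_prod_unfold)
  qed
  ultimately show ?thesis by simp
qed

text \<open>Tameness and Lipschitz bounds are available on bounded sets only; composition with the
  nearest-point map of a ball, which is definable and 1-Lipschitz, makes both global.\<close>

definition retracted :: "real \<Rightarrow> real ^ 'n \<Rightarrow> real" where
  "retracted R x = f (closest_point (cball 0 R) x)"

lemma retracted_eq: "norm x \<le> R \<Longrightarrow> retracted R x = f x"
  by (simp add: retracted_def closest_point_self)

lemma definable_lipschitz_retracted:
  assumes R: "R \<ge> 0"
  obtains L where "definable_lipschitz S (retracted R) L"
proof -
  obtain L where L: "L > 0" "\<And>x y. x \<in> cball 0 R \<Longrightarrow> y \<in> cball 0 R \<Longrightarrow> \<bar>f x - f y\<bar> \<le> L * norm (x - y)"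
    using f_lipschitz_on_cball by blast
  let ?C = "cball (0::real^'n) R"
  have C: "convex ?C" "closed ?C" "?C \<noteq> {}" using R by auto
  have cp: "closest_point ?C x \<in> ?C" for x using C by (intro closest_point_in_set)
  \<comment> \<open>A first-order description of the nearest point, from which definability is read
    off.\<close>
  have iff: "y = closest_point ?C x \<longleftrightarrow> norm y \<le> R \<and> (\<forall>z. norm z \<le> R \<longrightarrow> norm (x - y) \<le> norm (x - z))" for x y
  proof
    assume "y = closest_point ?C x"
    then show "norm y \<le> R \<and> (\<forall>z. norm z \<le> R \<longrightarrow> norm (x - y) \<le> norm (x - z))"
      using cp[of x] closest_point_le[OF C(2), of _ x] by (auto simp: dist_norm)
  next
    assume "norm y \<le> R \<and> (\<forall>z. norm z \<le> R \<longrightarrow> norm (x - y) \<le> norm (x - z))"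
    then show "y = closest_point ?C x"
      using C by (intro closest_point_unique) (auto simp: dist_norm)
  qed
  have "defpred (\<lambda>p. \<exists>y. (norm y \<le> R \<and> (\<forall>z. norm z \<le> R \<longrightarrow> norm (fst p - y) \<le> norm (fst p - z))) \<and>
      norm y \<le> R \<and> f y = snd p)"
    by (intro defpred_intros defpred_compose[OF defpred_graph, of "\<lambda>p. (snd p, snd (fst p))" R, unfolded fst_conv snd_conv])
  moreover have "(\<exists>y. y = closest_point ?C x \<and> norm y \<le> R \<and> f y = t) \<longleftrightarrow> t = retracted R x" for x t
    using cp[of x] by (auto simp: retracted_def)
  ultimately have "deffun (retracted R)" unfolding deffun_def iff[symmetric] by simp
  moreover have "\<bar>retracted R x - retracted R y\<bar> \<le> L * norm (x - y)" for x y
  proof -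
    have "\<bar>retracted R x - retracted R y\<bar> \<le> L * norm (closest_point ?C x - closest_point ?C y)"
      unfolding retracted_def by (intro L(2) cp)
    also have "\<dots> \<le> L * norm (x - y)"
      using closest_point_lipschitz[OF C, of x y] L(1) by (intro mult_left_mono) (auto simp: dist_norm)
    finally show ?thesis .
  qed
  ultimately have "definable_lipschitz S (retracted R) L"
    using L(1) by unfold_locales
  then show ?thesis by (rule that)
qed

text \<open>Strictly inside the ball the difference quotients of f and of its retraction coincide,
  once \<delta>' is so small that z and z + t d stay in the ball.\<close>

lemma clarke_ge_retracted:
  assumes g: "definable_lipschitz S (retracted R) L" and s: "s \<in> clarke_subdiff ip f x" and x: "norm x < R"
  shows "definable_lipschitz.clarke_ge (retracted R) x d (ip s d)"
proof -
  interpret definable_lipschitz S "retracted R" L by (rule g)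
  have "ereal (ip s d) \<le> clarke_dderiv f x d" using s by (simp add: clarke_subdiff_def)
  then have c: "\<exists>z t. norm (z - x) < \<delta> \<and> 0 < t \<and> t < \<delta> \<and> f z + (ip s d - \<delta>) * t \<le> f (z + t *\<^sub>R d)" if "\<delta> > 0" for \<delta>
    using that unfolding clarke_dderiv_ge_iff by blast
  show ?thesis
    unfolding clarke_ge_def
  proof (intro allI impI)
    fix \<delta> :: real assume \<delta>: "\<delta> > 0"
    have "0 < 1 + norm d" by (simp add: add_pos_nonneg)
    define \<delta>' where "\<delta>' = min \<delta> ((R - norm x) / (1 + norm d))"
    have \<delta>': "\<delta>' > 0" "\<delta>' \<le> \<delta>" "\<delta>' * (1 + norm d) \<le> R - norm x"
    proof -
      show "\<delta>' > 0" using \<delta> x \<open>0 < 1 + norm d\<close> by (simp add: \<delta>'_def)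
      show "\<delta>' \<le> \<delta>" unfolding \<delta>'_def by (rule min.cobounded1)
      have "\<delta>' \<le> (R - norm x) / (1 + norm d)" unfolding \<delta>'_def by (rule min.cobounded2)
      then show "\<delta>' * (1 + norm d) \<le> R - norm x" using \<open>0 < 1 + norm d\<close> by (simp add: le_divide_eq)
    qed
    obtain z t where z: "norm (z - x) < \<delta>'" "0 < t" "t < \<delta>'" "f z + (ip s d - \<delta>') * t \<le> f (z + t *\<^sub>R d)"
      using c[OF \<delta>'(1)] by blast
    have td: "t * norm d \<le> \<delta>' * norm d" using z by (intro mult_right_mono) auto
    have nz: "norm z \<le> norm x + norm (z - x)" using norm_triangle_ineq[of x "z - x"] by simp
    have "\<delta>' * (1 + norm d) = \<delta>' + \<delta>' * norm d" by (simp add: algebra_simps)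
    then have b: "\<delta>' + \<delta>' * norm d \<le> R - norm x" using \<delta>'(3) by simp
    moreover have "0 \<le> \<delta>' * norm d" using \<delta>'(1) by simp
    ultimately have "norm z \<le> R" using nz z(1) by linarith
    moreover have "norm (z + t *\<^sub>R d) \<le> R"
      using norm_triangle_ineq[of z "t *\<^sub>R d"] nz z(1,2) td b by simp
    moreover have "(ip s d - \<delta>) * t \<le> (ip s d - \<delta>') * t" using \<delta>'(2) z(2) by (intro mult_right_mono) auto
    ultimately have "retracted R z + (ip s d - \<delta>) * t \<le> retracted R (z + t *\<^sub>R d)"
      using z(4) by (simp add: retracted_eq)
    then show "\<exists>z t. norm (z - x) < \<delta> \<and> 0 < t \<and> t < \<delta> \<and> retracted R z + (ip s d - \<delta>) * t \<le> retracted R (z + t *\<^sub>R d)"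
      using z \<delta>'(2) by (intro exI[of _ z] exI[of _ t]) auto
  qed
qed

end

section \<open>Decrease along subgradient trajectories\<close>

text \<open>Applied with d = s, this bounds the subgradients s and hence the speed of
  trajectories.\<close>

lemma (in definable_lipschitz) clarke_ge_bound:
  assumes "clarke_ge x d q"
  shows "q \<le> L * norm d"
proof (rule le_of_small_perturbation[of 1])
  fix \<delta> :: real assume "0 < \<delta>"
  then obtain z t where z: "0 < t" "g z + (q - \<delta>) * t \<le> g (z + t *\<^sub>R d)"
    using assms unfolding clarke_ge_def by blast
  have "(q - \<delta>) * t \<le> g (z + t *\<^sub>R d) - g z" using z(2) by linarith
  also have "\<dots> \<le> L * norm (t *\<^sub>R d)" using lip[of "z + t *\<^sub>R d" z] by simp
  also have "\<dots> = (L * norm d) * t" using z(1) by simp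
  finally have "q - \<delta> \<le> L * norm d" using z(1) by simp
  then show "q \<le> L * norm d + 1 * \<delta>" by simp
qed simp

context tame_problem
begin

lemma ip_norm_lower: "\<exists>l>0. \<forall>x. l * norm x \<le> ip_norm ip x"
proof -
  obtain l u where "l > 0" "u > 0" "\<And>x. l * norm x \<le> ip_norm ip x" "\<And>x. ip_norm ip x \<le> u * norm x"
    by (rule ip_norm_equiv) (rule that)
  then show ?thesis by blast
qed

lemma ac_ip_imp_ac_inner:
  assumes "absolutely_continuous_fun ip a b x"
  shows "absolutely_continuous_fun (\<bullet>) a b x"
  unfolding absolutely_continuous_fun_def ip_norm_inner
proof (intro allI impI)
  fix \<epsilon> :: real assume \<epsilon>: "\<epsilon> > 0"
  obtain c where c: "c > 0" "\<And>x. c * norm x \<le> ip_norm ip x" using ip_norm_lower by blast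
  have "c * \<epsilon> > 0" using c \<epsilon> by simp
  from mp[OF spec[OF assms[unfolded absolutely_continuous_fun_def], of "c * \<epsilon>"] this]
  obtain \<delta> where \<delta>: "\<delta> > 0" and d: "\<forall>m l u. (\<forall>i<m. a \<le> l i \<and> l i \<le> u i \<and> u i \<le> b) \<and>
      disjoint_family_on (\<lambda>i. {l i..u i}) {..<m} \<and> (\<Sum>i<(m::nat). u i - l i) \<le> \<delta> \<longrightarrow>
      (\<Sum>i<m. ip_norm ip (x (u i) - x (l i))) \<le> c * \<epsilon>"
    by (elim exE conjE)
  show "\<exists>\<delta>>0. \<forall>m l u. (\<forall>i<m. a \<le> l i \<and> l i \<le> u i \<and> u i \<le> b) \<and>
      disjoint_family_on (\<lambda>i. {l i..u i}) {..<m} \<and> (\<Sum>i<(m::nat). u i - l i) \<le> \<delta> \<longrightarrow>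
      (\<Sum>i<m. norm (x (u i) - x (l i))) \<le> \<epsilon>"
  proof (intro exI[of _ \<delta>] conjI \<delta> allI impI)
    fix m :: nat and l u :: "nat \<Rightarrow> real"
    assume "(\<forall>i<m. a \<le> l i \<and> l i \<le> u i \<and> u i \<le> b) \<and>
      disjoint_family_on (\<lambda>i. {l i..u i}) {..<m} \<and> (\<Sum>i<m. u i - l i) \<le> \<delta>"
    then have "(\<Sum>i<m. ip_norm ip (x (u i) - x (l i))) \<le> c * \<epsilon>"
      by (rule mp[OF spec[OF spec[OF spec[OF d, of m], of l], of u]])
    moreover have "(\<Sum>i<m. c * norm (x (u i) - x (l i))) \<le> (\<Sum>i<m. ip_norm ip (x (u i) - x (l i)))"
      by (intro sum_mono c(2))
    ultimately have "c * (\<Sum>i<m. norm (x (u i) - x (l i))) \<le> c * \<epsilon>"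
      unfolding sum_distrib_left by linarith
    then show "(\<Sum>i<m. norm (x (u i) - x (l i))) \<le> \<epsilon>" using c(1) by simp
  qed
qed

text \<open>At a time with y' = - c s, the subgradient inequality in the backward direction c s
  gives an upper derivative of at least c * ip s s, hence at least \<open>c * \<mu>\<^sup>2\<close>.
  \<open>decrease_along_curve\<close> makes this an actual rate, up to 2 * \<eta>, outside a
  negligible set of times; creeping integrates it, and then \<eta> tends to 0.\<close>

lemma trajectory_decrease:
  assumes tr: "subgradient_trajectory ip f c T y" and c: "c > 0" and ab: "0 \<le> a" "a \<le> b" "b \<le> T"
    and \<mu>: "\<mu> \<ge> 0" "\<And>t s. a \<le> t \<Longrightarrow> t \<le> b \<Longrightarrow> s \<in> clarke_subdiff ip f (y t) \<Longrightarrow> \<mu> \<le> ip_norm ip s"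
  shows "c * \<mu>\<^sup>2 * (b - a) \<le> f (y a) - f (y b)"
proof -
  have ac: "absolutely_continuous_fun (\<bullet>) 0 T y"
    using tr unfolding subgradient_trajectory_def by (intro ac_ip_imp_ac_inner) blast
  let ?Q = "\<lambda>t. \<exists>v. (y has_vector_derivative v) (at t within {0..T}) \<and> v \<in> (\<lambda>s. - (c *\<^sub>R s)) ` clarke_subdiff ip f (y t)"
  have "AE t in lebesgue_on {0..T}. ?Q t" using tr unfolding subgradient_trajectory_def by blast
  then have "AE t in lebesgue. t \<in> {0..T} \<longrightarrow> ?Q t" by (subst (asm) AE_restrict_space_iff) auto
  then obtain N where N0: "N \<in> null_sets lebesgue" "{t \<in> space lebesgue. \<not> (t \<in> {0..T} \<longrightarrow> ?Q t)} \<subseteq> N"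
    unfolding eventually_ae_filter by blast
  have N: "negligible N" using N0(1) by (simp add: negligible_iff_null_sets)
  have Q: "?Q t" if "t \<in> {0..T} - N" for t
  proof (rule ccontr)
    assume "\<not> ?Q t"
    then have "t \<in> {t \<in> space lebesgue. \<not> (t \<in> {0..T} \<longrightarrow> ?Q t)}" using that by simp
    then show False using N0(2) that by blast
  qed
  have "bounded (y ` {0..T})"
    using ac_continuous_on[OF ac] by (intro compact_imp_bounded compact_continuous_image) auto
  then obtain R0 where R0: "\<And>t. t \<in> {0..T} \<Longrightarrow> norm (y t) \<le> R0" unfolding bounded_iff by blast
  define R where "R = \<bar>R0\<bar> + 1"
  have R: "R \<ge> 0" "\<And>t. t \<in> {0..T} \<Longrightarrow> norm (y t) < R" using R0 unfolding R_def by fastforce+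
  obtain L where L: "definable_lipschitz S (retracted R) L" using definable_lipschitz_retracted[OF R(1)] by blast
  interpret G: definable_lipschitz S "retracted R" L by (rule L)
  obtain l where l: "l > 0" "\<And>x. l * norm x \<le> ip_norm ip x" using ip_norm_lower by blast
  \<comment> \<open>A bound for the velocities, from
    \<open>(l * norm s)\<^sup>2 \<le> ip s s\<close> and
    \<open>ip s s \<le> L * norm s\<close>.\<close>
  define K where "K = c * (L / l\<^sup>2)"
  have K: "K \<ge> 0" using c l(1) G.L_pos by (simp add: K_def)
  have sK: "norm (c *\<^sub>R s) \<le> K" if s: "s \<in> clarke_subdiff ip f x" "norm x < R" for s x
  proof -
    have "G.clarke_ge x s (ip s s)" by (rule clarke_ge_retracted[OF L s])
    then have "ip s s \<le> L * norm s" by (rule G.clarke_ge_bound)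
    moreover have "(l * norm s)\<^sup>2 \<le> ip s s"
      unfolding ip_norm_sq[symmetric] using l by (intro power_mono) auto
    ultimately have "l\<^sup>2 * norm s * norm s \<le> L * norm s" by (simp add: power2_eq_square mult_ac)
    then have "norm s = 0 \<or> l\<^sup>2 * norm s \<le> L" by (metis mult_le_cancel_right_pos norm_eq_zero zero_less_norm_iff)
    then have "norm s \<le> L / l\<^sup>2" using l(1) G.L_pos by (auto simp: le_divide_eq mult.commute)
    then have "c * norm s \<le> K" unfolding K_def using c by (intro mult_left_mono) auto
    then show ?thesis using c by simp
  qed
  have der: "\<exists>v. (y has_vector_derivative v) (at t within {0..T}) \<and> norm v \<le> K" if t: "t \<in> {0..T} - N" for t
  proof -
    obtain s where "(y has_vector_derivative - (c *\<^sub>R s)) (at t within {0..T})" "s \<in> clarke_subdiff ip f (y t)"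
      using Q[OF t] by blast
    then show ?thesis using sK[of s "y t"] R(2)[of t] t by (intro exI[of _ "- (c *\<^sub>R s)"]) auto
  qed
  have ylip: "norm (y t - y s) \<le> K * (t - s)" if "0 \<le> s" "s \<le> t" "t \<le> T" for s t
    by (rule ac_lipschitz[OF ac N K der that])
  have Flip: "\<bar>f (y t) - f (y s)\<bar> \<le> L * K * (t - s)" if "a \<le> s" "s \<le> t" "t \<le> b" for s t
  proof -
    have st: "s \<in> {0..T}" "t \<in> {0..T}" using that ab by auto
    have "\<bar>retracted R (y t) - retracted R (y s)\<bar> \<le> L * norm (y t - y s)" by (rule G.lip)
    also have "\<dots> \<le> L * (K * (t - s))" using ylip[of s t] that ab G.L_pos by (intro mult_left_mono) auto
    finally show ?thesis using R(2)[OF st(1)] R(2)[OF st(2)] by (simp add: retracted_eq)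
  qed
  show ?thesis
  proof (rule le_of_small_perturbation[of 1])
    fix \<eta> :: real assume \<eta>: "0 < \<eta>"
    have "\<exists>\<C>. countable \<C> \<and> \<Union>\<C> = (UNIV :: (real^'n) set) \<and> (\<forall>C\<in>\<C>. defset C \<and> G.bad \<eta> K C = {})"
      by (rule G.countable_good_cover[OF _ \<eta> K]) (simp add: defpred_const)
    then obtain \<C> where C0: "countable \<C> \<and> \<Union>\<C> = (UNIV :: (real^'n) set) \<and> (\<forall>C\<in>\<C>. defset C \<and> G.bad \<eta> K C = {})"
      by (rule exE)
    define X where "X C = {t. y t \<in> C}" for C
    \<comment> \<open>Times at which the trajectory lies in a piece that it did not visit shortly
      before. Each of the countably many pieces contributes countably many.\<close>
    define I where "I = (\<Union>C\<in>\<C>. {t \<in> X C. \<not> (\<exists>\<^sub>F h in at_right 0. t - h \<in> X C)})"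
    have "countable I"
      unfolding I_def using C0 by (intro countable_UN countable_left_isolated) blast
    then have "negligible I"
      by (simp add: negligible_iff_null_sets countable_imp_null_set_lborel null_sets_completionI)
    with N have NI: "negligible (N \<union> I)" by (rule negligible_Un)
    have "(c * \<mu>\<^sup>2 - 2 * \<eta>) * (b - a) \<le> f (y a) - f (y b)"
    proof (rule creeping_left_negligible[OF ab(2) NI, of "L * K"])
      show "0 \<le> L * K" using G.L_pos K by simp
      show "\<bar>f (y t) - f (y s)\<bar> \<le> L * K * (t - s)" if "a \<le> s" "s \<le> t" "t \<le> b" for s t using Flip that .
      fix t assume t: "a < t" "t \<le> b" "t \<notin> N \<union> I"
      have t0: "t \<in> {0..T}" "t \<in> {0..T} - N" using t ab by auto
      obtain s where s: "(y has_vector_derivative - (c *\<^sub>R s)) (at t within {0..T})" "s \<in> clarke_subdiff ip f (y t)"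
        using Q[OF t0(2)] by blast
      have "y t \<in> \<Union>\<C>" using C0 by simp
      then obtain C where C: "C \<in> \<C>" "y t \<in> C" by (rule UnionE)
      have freq: "\<exists>\<^sub>F h in at_right 0. y (t - h) \<in> C"
      proof (rule ccontr)
        assume "\<not> ?thesis"
        then have "t \<in> {t \<in> X C. \<not> (\<exists>\<^sub>F h in at_right 0. t - h \<in> X C)}" using C(2) by (simp add: X_def)
        then have "t \<in> I" unfolding I_def by (rule UN_I[OF C(1)])
        then show False using t(3) by simp
      qed
      have ev: "\<forall>\<^sub>F h in at_right (0::real). h < t \<and> 0 < h"
        using t ab by (intro eventually_at_rightI[of 0 t]) auto
      have der: "\<forall>\<^sub>F h in at_right 0. norm (y (t - h) - y t - h *\<^sub>R (c *\<^sub>R s)) \<le> \<epsilon> * h" if "\<epsilon> > 0" for \<epsilon>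
      proof -
        obtain r where r: "r > 0" "\<And>x. x \<in> {0..T} \<Longrightarrow> norm (x - t) < r \<Longrightarrow>
            norm (y x - y t - (x - t) *\<^sub>R - (c *\<^sub>R s)) \<le> \<epsilon> * norm (x - t)"
          using s(1) \<open>\<epsilon> > 0\<close> unfolding has_vector_derivative_def has_derivative_within_alt by blast
        have "\<forall>\<^sub>F h in at_right (0::real). h < r" using r by (intro eventually_at_rightI[of 0 r]) auto
        with ev show ?thesis
        proof eventually_elim
          case (elim h)
          then show ?case using r(2)[of "t - h"] t ab by simp
        qed
      qed
      have "\<mu> \<le> ip_norm ip s" using \<mu>(2)[of t s] t s(2) by auto
      then have "\<mu>\<^sup>2 \<le> ip s s" unfolding ip_norm_sq[symmetric] using \<mu>(1) by (intro power_mono)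
      then have q: "c * \<mu>\<^sup>2 \<le> ip s (c *\<^sub>R s)" using c by (simp add: linear_scale[OF ip_linear2])
      have "G.clarke_ge (y t) (c *\<^sub>R s) (c * \<mu>\<^sup>2)"
        by (rule G.clarke_ge_mono[OF clarke_ge_retracted[OF L s(2) R(2)[OF t0(1)]] q])
      note cge = this
      have bC: "G.bad \<eta> K C = {}" using C0 C(1) by simp
      have "\<forall>\<^sub>F h in at_right 0. retracted R (y t) + (c * \<mu>\<^sup>2 - 2 * \<eta>) * h \<le> retracted R (y (t - h))"
        by (rule G.decrease_along_curve[OF bC C(2) sK[OF s(2) R(2)[OF t0(1)]] \<eta> der freq cge])
      with ev show "\<forall>\<^sub>F h in at_right 0. f (y t) + (c * \<mu>\<^sup>2 - 2 * \<eta>) * h \<le> f (y (t - h))"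
      proof eventually_elim
        case (elim h)
        then have "t - h \<in> {0..T}" using t ab by auto
        from R(2)[OF this] R(2)[OF t0(1)] show ?case using elim by (simp add: retracted_eq)
      qed
    qed
    then show "c * \<mu>\<^sup>2 * (b - a) \<le> f (y a) - f (y b) + (2 * (b - a)) * \<eta>"
      by (simp add: algebra_simps)
  qed simp
qed

section \<open>Sublevel sets, noncritical levels and uniform slopes\<close>

lemma bounded_sublevel: "bounded {x. f x \<le> v}"
proof -
  obtain l where l: "l > 0" "\<And>x. l * norm x \<le> ip_norm ip x" using ip_norm_lower by blast
  have "\<forall>\<^sub>F x in filtercomap (ip_norm ip) at_top. v < f x"
    using coer unfolding coercive_def filterlim_at_top_dense by blast
  then obtain Q where Q: "\<forall>\<^sub>F r in at_top. Q r" "\<And>x. Q (ip_norm ip x) \<Longrightarrow> v < f x"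
    unfolding eventually_filtercomap by blast
  then obtain r where r: "\<And>s. s \<ge> r \<Longrightarrow> Q s" unfolding eventually_at_top_linorder by blast
  have "norm x \<le> r / l" if "f x \<le> v" for x
  proof -
    have "\<not> Q (ip_norm ip x)" using Q(2)[of x] that by auto
    then have "ip_norm ip x \<le> r" using r[of "ip_norm ip x"] by (meson nle_le)
    then have "l * norm x \<le> r" using l(2)[of x] by linarith
    then show ?thesis using l(1) by (simp add: le_divide_eq mult.commute)
  qed
  then show ?thesis unfolding bounded_iff by blast
qed

lemma compact_sublevel: "compact {x. f x \<le> v}"
  unfolding compact_eq_bounded_closed
  using bounded_sublevel continuous_f by (auto intro: closed_Collect_le continuous_on_const)

lemma f_bounded_below: "\<exists>m. \<forall>x. m \<le> f x"
proof -
  have "0 \<in> {x. f x \<le> f 0}" by simp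
  then obtain z where z: "\<And>x. f x \<le> f 0 \<Longrightarrow> f z \<le> f x" "f z \<le> f 0"
    using continuous_attains_inf[OF compact_sublevel[of "f 0"] _ continuous_on_subset[OF continuous_f]] by blast
  have "f z \<le> f x" for x using z(1)[of x] z(2) by linarith
  then show ?thesis by blast
qed

text \<open>By coercivity all points with value at most b lie strictly inside one ball, where
  critical points of f are critical for the retraction, so
  \<open>critical_values_no_interval\<close> applies.\<close>

lemma noncritical_dense:
  assumes "a < b"
  shows "\<exists>v. a < v \<and> v < b \<and> \<not> critical_value ip f v"
proof -
  obtain R0 where R0: "\<And>x. f x \<le> b \<Longrightarrow> norm x \<le> R0" using bounded_sublevel[of b] unfolding bounded_iff by auto
  define R where "R = \<bar>R0\<bar> + 1"
  have R: "R \<ge> 0" "\<And>x. f x \<le> b \<Longrightarrow> norm x < R" using R0 unfolding R_def by fastforce+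
  obtain L where L: "definable_lipschitz S (retracted R) L" using definable_lipschitz_retracted[OF R(1)] by blast
  interpret G: definable_lipschitz S "retracted R" L by (rule L)
  obtain t where t: "a < t" "t < b" and none: "\<not> (\<exists>x\<in>G.critical. norm x \<le> R \<and> retracted R x = t)"
    using G.critical_values_no_interval[OF assms] by blast
  have "\<not> critical_value ip f t"
  proof
    assume "critical_value ip f t"
    then obtain x where x: "0 \<in> clarke_subdiff ip f x" "t = f x" unfolding critical_value_def critical_point_def by blast
    have nx: "norm x < R" using R(2) x(2) t(2) by simp
    have "x \<in> G.critical"
      using clarke_ge_retracted[OF L x(1) nx] unfolding G.critical_def by (simp add: linear_0[OF ip_linear])
    then show False using none nx x(2) by (auto simp: retracted_eq)
  qed
  then show ?thesis using t by blast
qed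

text \<open>Otherwise subgradients tending to 0 occur at points whose values approach [a, b]. These
  points accumulate by compactness of sublevel sets, and since the graph of the Clarke
  subdifferential is closed, the limit is a critical point with value in [a, b].\<close>

lemma uniform_slope:
  assumes nc: "\<And>v. a \<le> v \<Longrightarrow> v \<le> b \<Longrightarrow> \<not> critical_value ip f v"
  obtains \<sigma> \<mu> where "\<sigma> > 0" "\<mu> > 0"
    "\<And>x s. a - \<sigma> \<le> f x \<Longrightarrow> f x \<le> b + \<sigma> \<Longrightarrow> s \<in> clarke_subdiff ip f x \<Longrightarrow> \<mu> \<le> ip_norm ip s"
proof (rule ccontr)
  assume no: "\<not> thesis"
  define e where "e n = inverse (real (Suc n))" for n
  have e: "e n > 0" "e n \<le> 1" for n by (auto simp: e_def inverse_eq_divide)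
  have e0: "e \<longlonglongrightarrow> 0" unfolding e_def by (rule LIMSEQ_inverse_real_of_nat)
  have "\<exists>x s. a - e n \<le> f x \<and> f x \<le> b + e n \<and> s \<in> clarke_subdiff ip f x \<and> ip_norm ip s < e n" for n
  proof (rule ccontr)
    assume "\<not> ?thesis"
    then show False using no that[OF e(1) e(1), of n n] by (meson not_le)
  qed
  then obtain x s where xs: "\<And>n. a - e n \<le> f (x n) \<and> f (x n) \<le> b + e n \<and> s n \<in> clarke_subdiff ip f (x n) \<and> ip_norm ip (s n) < e n"
    by metis
  have "f (x n) \<le> b + 1" for n using xs[of n] e(2)[of n] by linarith
  then have "\<forall>n. x n \<in> {x. f x \<le> b + 1}" by simp
  then obtain z r where z: "strict_mono r" "(x \<circ> r) \<longlonglongrightarrow> z"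
    using compact_sublevel[of "b + 1"] unfolding compact_def by metis
  have er: "(\<lambda>n. e (r n)) \<longlonglongrightarrow> 0" using LIMSEQ_subseq_LIMSEQ[OF e0 z(1)] by (simp add: o_def)
  have "isCont f z" using continuous_f by (simp add: continuous_on_eq_continuous_at)
  then have fz: "(\<lambda>n. f (x (r n))) \<longlonglongrightarrow> f z" using isCont_tendsto_compose[OF _ z(2)] by (simp add: o_def)
  have "a \<le> f z"
  proof (rule LIMSEQ_le[OF _ fz])
    show "(\<lambda>n. a - e (r n)) \<longlonglongrightarrow> a" using tendsto_diff[OF tendsto_const er, of a] by simp
  qed (use xs in blast)
  moreover have "f z \<le> b"
  proof (rule LIMSEQ_le[OF fz])
    show "(\<lambda>n. b + e (r n)) \<longlonglongrightarrow> b" using tendsto_add[OF tendsto_const er, of b] by simp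
  qed (use xs in blast)
  moreover have "critical_value ip f (f z)"
    unfolding critical_value_def critical_point_def
  proof (intro exI[of _ z] conjI refl)
    show "0 \<in> clarke_subdiff ip f z"
      unfolding clarke_subdiff_def mem_Collect_eq
    proof
      fix d :: "real ^ 'n"
      obtain B where B: "B > 0" "\<And>x y. \<bar>ip x y\<bar> \<le> B * norm x * norm y" using ip_bound by blast
      obtain l where l: "l > 0" "\<And>x. l * norm x \<le> ip_norm ip x" using ip_norm_lower by blast
      define M where "M = B * norm d / l"
      have M: "M \<ge> 0" using B l by (simp add: M_def)
      have sM: "\<bar>ip (s n) d\<bar> \<le> M * e n" for n
      proof -
        have "norm (s n) \<le> e n / l" using l(2)[of "s n"] xs[of n] l(1) by (simp add: le_divide_eq mult.commute)
        then have "B * norm (s n) * norm d \<le> B * (e n / l) * norm d"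
          using B(1) by (intro mult_right_mono mult_left_mono) auto
        then show ?thesis using B(2)[of "s n" d] by (simp add: M_def mult_ac)
      qed
      have "ereal 0 \<le> clarke_dderiv f z d"
        unfolding clarke_dderiv_ge_iff
      proof (intro allI impI)
        fix \<delta> :: real assume \<delta>: "\<delta> > 0"
        have "\<forall>\<^sub>F n in sequentially. dist ((x \<circ> r) n) z < \<delta> / 2" by (rule tendstoD[OF z(2) half_gt_zero[OF \<delta>]])
        moreover have "(\<lambda>n. M * e (r n)) \<longlonglongrightarrow> 0" by (rule tendsto_mult_right_zero[OF er])
        then have "\<forall>\<^sub>F n in sequentially. M * e (r n) < \<delta> / 2" using half_gt_zero[OF \<delta>] by (rule order_tendstoD(2))
        ultimately have "\<forall>\<^sub>F n in sequentially. dist ((x \<circ> r) n) z < \<delta> / 2 \<and> M * e (r n) < \<delta> / 2" by (rule eventually_conj)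
        then obtain n where n: "dist (x (r n)) z < \<delta> / 2" "M * e (r n) < \<delta> / 2"
          using eventually_happens'[OF sequentially_bot] by auto
        have "ereal (ip (s (r n)) d) \<le> clarke_dderiv f (x (r n)) d"
          using xs[of "r n"] by (simp add: clarke_subdiff_def)
        then obtain w t where w: "norm (w - x (r n)) < \<delta> / 2" "0 < t" "t < \<delta> / 2"
          "f w + (ip (s (r n)) d - \<delta> / 2) * t \<le> f (w + t *\<^sub>R d)"
          using half_gt_zero[OF \<delta>] unfolding clarke_dderiv_ge_iff by blast
        have "norm (w - z) \<le> norm (w - x (r n)) + norm (x (r n) - z)"
          using norm_triangle_ineq[of "w - x (r n)" "x (r n) - z"] by simp
        then have "norm (w - z) < \<delta>" using w(1) n(1) by (simp add: dist_norm)
        moreover have "(0 - \<delta>) * t \<le> (ip (s (r n)) d - \<delta> / 2) * t"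
          using sM[of "r n"] n(2) w(2) by (intro mult_right_mono) (auto simp: abs_le_iff)
        ultimately show "\<exists>z' t. norm (z' - z) < \<delta> \<and> 0 < t \<and> t < \<delta> \<and> f z' + (0 - \<delta>) * t \<le> f (z' + t *\<^sub>R d)"
          using w \<delta> by (intro exI[of _ w] exI[of _ t]) auto
      qed
      then show "ereal (ip 0 d) \<le> clarke_dderiv f z d" by (simp add: linear_0[OF ip_linear])
    qed
  qed
  ultimately show False using nc by blast
qed

section \<open>Decrease of trajectories over one block of iterations\<close>

text \<open>The slack \<beta> in hypothesis and conclusion absorbs the distance between iterates and
  trajectory. For p = q the property says that a level cannot be crossed upwards in spite of this
  distance; starting at T / 2 leaves room for rounding T / \<alpha>.\<close>

definition block :: "real \<Rightarrow> real \<Rightarrow> real \<times> real \<Rightarrow> real \<Rightarrow> bool" where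
  "block c T = (\<lambda>(p, q) \<beta>. \<forall>y t. subgradient_trajectory ip f c T y \<longrightarrow> T / 2 \<le> t \<longrightarrow> t \<le> T \<longrightarrow>
     f (y 0) \<le> q + \<beta> \<longrightarrow> f (y t) \<le> max (p - \<beta>) (f (y 0) - \<beta>))"

text \<open>Unless the value falls to p - \<beta>', the trajectory stays in the zone where
  subgradients have size at least \<mu>, and over time T / 2 it loses at least \<beta>. All smaller
  \<beta>' are included so that finitely many pairs can share one.\<close>

lemma block_exists:
  assumes c: "c > 0" and T: "T > 0" and nc: "\<And>v. p \<le> v \<Longrightarrow> v \<le> q \<Longrightarrow> \<not> critical_value ip f v"
  shows "\<exists>\<beta>>0. \<forall>\<beta>'. 0 < \<beta>' \<and> \<beta>' \<le> \<beta> \<longrightarrow> block c T (p, q) \<beta>'"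
proof -
  obtain \<sigma> \<mu> where \<sigma>: "\<sigma> > 0" and \<mu>: "\<mu> > 0"
    and slope: "\<And>x s. p - \<sigma> \<le> f x \<Longrightarrow> f x \<le> q + \<sigma> \<Longrightarrow> s \<in> clarke_subdiff ip f x \<Longrightarrow> \<mu> \<le> ip_norm ip s"
    by (rule uniform_slope[OF nc], assumption+, rule that)
  define \<beta> where "\<beta> = min \<sigma> (c * \<mu>\<^sup>2 * (T / 2))"
  have \<beta>: "\<beta> > 0" "\<beta> \<le> \<sigma>" "\<beta> \<le> c * \<mu>\<^sup>2 * (T / 2)" using c T \<sigma> \<mu> by (auto simp: \<beta>_def)
  have "block c T (p, q) \<beta>'" if \<beta>': "0 < \<beta>'" "\<beta>' \<le> \<beta>" for \<beta>'
    unfolding block_def prod.case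
  proof (intro allI impI)
    fix y t assume y: "subgradient_trajectory ip f c T y" and t: "T / 2 \<le> t" "t \<le> T" and y0: "f (y 0) \<le> q + \<beta>'"
    have mono: "f (y v) \<le> f (y u)" if "0 \<le> u" "u \<le> v" "v \<le> T" for u v
      using trajectory_decrease[OF y c that, of 0] ip_norm_nonneg by simp
    show "f (y t) \<le> max (p - \<beta>') (f (y 0) - \<beta>')"
    proof (cases "f (y t) \<le> p - \<beta>'")
      case False
      have "c * \<mu>\<^sup>2 * (t - 0) \<le> f (y 0) - f (y t)"
      proof (rule trajectory_decrease[OF y c])
        fix u s assume u: "0 \<le> u" "u \<le> t" and s: "s \<in> clarke_subdiff ip f (y u)"
        have "f (y u) \<le> f (y 0)" "f (y t) \<le> f (y u)" using mono u t by auto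
        then show "\<mu> \<le> ip_norm ip s" using False y0 \<beta>' \<beta>(2) s by (intro slope) auto
      qed (use \<mu> t T in auto)
      moreover have "c * \<mu>\<^sup>2 * (T / 2) \<le> c * \<mu>\<^sup>2 * t" using c t by (intro mult_left_mono) auto
      ultimately show ?thesis using \<beta>(3) \<beta>'(2) by auto
    qed auto
  qed
  then show ?thesis using \<beta>(1) by blast
qed

lemma block_uniform:
  assumes "finite J" and c: "c > 0" and T: "T > 0"
    and nc: "\<And>p q v. (p, q) \<in> J \<Longrightarrow> p \<le> v \<Longrightarrow> v \<le> q \<Longrightarrow> \<not> critical_value ip f v"
  shows "\<exists>\<beta>>0. \<forall>j\<in>J. block c T j \<beta>"
proof -
  have "\<exists>\<beta>>0. \<forall>j\<in>J. \<forall>\<beta>'. 0 < \<beta>' \<and> \<beta>' \<le> \<beta> \<longrightarrow> block c T j \<beta>'"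
    using assms(1) nc
  proof (induction J rule: finite_induct)
    case (insert j J)
    then obtain \<beta>1 where \<beta>1: "\<beta>1 > 0" "\<forall>j\<in>J. \<forall>\<beta>'. 0 < \<beta>' \<and> \<beta>' \<le> \<beta>1 \<longrightarrow> block c T j \<beta>'" by blast
    obtain p q where j: "j = (p, q)" by (cases j)
    obtain \<beta>2 where \<beta>2: "\<beta>2 > 0" "\<forall>\<beta>'. 0 < \<beta>' \<and> \<beta>' \<le> \<beta>2 \<longrightarrow> block c T j \<beta>'"
      using block_exists[OF c T, of p q] insert.prems[of p q] unfolding j by blast
    show ?case using \<beta>1 \<beta>2 by (intro exI[of _ "min \<beta>1 \<beta>2"]) auto
  qed (auto intro: exI[of _ 1])
  then show ?thesis by blast
qed

section \<open>Stability\<close>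
lemma f_uniform_near_sublevel:
  assumes \<rho>: "\<rho> > 0"
  shows "\<exists>e>0. \<forall>y z. f y \<le> v \<longrightarrow> ip_norm ip (z - y) \<le> e \<longrightarrow> \<bar>f z - f y\<bar> \<le> \<rho>"
proof -
  obtain R0 where R0: "\<And>x. f x \<le> v \<Longrightarrow> norm x \<le> R0" using bounded_sublevel[of v] unfolding bounded_iff by auto
  obtain L where L: "L > 0" "\<And>x y. x \<in> cball 0 (R0 + 1) \<Longrightarrow> y \<in> cball 0 (R0 + 1) \<Longrightarrow> \<bar>f x - f y\<bar> \<le> L * norm (x - y)"
    using f_lipschitz_on_cball by blast
  obtain l where l: "l > 0" "\<And>x. l * norm x \<le> ip_norm ip x" using ip_norm_lower by blast
  define d where "d = min 1 (\<rho> / L)"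
  have d: "d > 0" "d \<le> 1" "d \<le> \<rho> / L" using \<rho> L by (auto simp: d_def)
  have "\<bar>f z - f y\<bar> \<le> \<rho>" if y: "f y \<le> v" and z: "ip_norm ip (z - y) \<le> l * d" for y z
  proof -
    have "l * norm (z - y) \<le> l * d" using l(2)[of "z - y"] z by linarith
    then have n: "norm (z - y) \<le> d" using l(1) by simp
    have ny: "norm y \<le> R0" using R0[OF y] .
    moreover have "norm z \<le> norm y + norm (z - y)" using norm_triangle_ineq[of y "z - y"] by simp
    ultimately have "norm z \<le> R0 + 1" using n d(2) by linarith
    then have "\<bar>f z - f y\<bar> \<le> L * norm (z - y)" using ny by (intro L(2)) auto
    also have "\<dots> \<le> L * (\<rho> / L)" using n d(3) L(1) by (intro mult_left_mono) auto
    finally show ?thesis using L(1) by simp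
  qed
  moreover have "l * d > 0" using l(1) d(1) by simp
  ultimately show ?thesis by blast
qed

theorem stability:
  assumes im: "iterative_method M" and ap: "approximated_by_subgradient_trajectories ip M f"
    and X0: "bounded X\<^sub>0" and \<epsilon>: "\<epsilon> > 0"
  shows "\<exists>\<alpha>'>0. \<exists>\<Delta>>0. \<forall>\<alpha>\<in>{0<..\<alpha>'}. \<forall>x\<in>M f \<alpha> X\<^sub>0 0.
    (\<forall>k. f (x k) \<le> \<Delta>) \<and>
    (\<exists>v k\<^sub>0. critical_value ip f v \<and> (\<forall>k\<ge>k\<^sub>0. \<bar>f (x k) - v\<bar> \<le> \<epsilon>))"
proof -
  obtain c where c: "c > 0" and apc: "\<forall>X\<^sub>0 X\<^sub>1. compact X\<^sub>0 \<and> compact X\<^sub>1 \<longrightarrow>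
        (\<exists>T>0. \<forall>\<epsilon>>0. \<exists>\<alpha>'>0. \<forall>\<alpha>\<in>{0<..\<alpha>'}. \<forall>k'. \<forall>x\<in>M f \<alpha> X\<^sub>0 k'.
           (\<forall>k\<le>k'. x k \<in> X\<^sub>1) \<longrightarrow>
           (\<exists>y. subgradient_trajectory ip f c T y \<and> y 0 \<in> X\<^sub>0 \<and>
              (\<forall>k\<in>{k'..k' + nat \<lfloor>T / \<alpha>\<rfloor>}.
                 ip_norm ip (x k - y ((real k - real k') * \<alpha>)) \<le> \<epsilon>)))"
    using ap unfolding approximated_by_subgradient_trajectories_def by (elim exE conjE)
  obtain m where m: "\<And>x. m \<le> f x" using f_bounded_below by blast
  obtain R where R: "\<And>x. x \<in> X\<^sub>0 \<Longrightarrow> norm x \<le> R" using X0 unfolding bounded_iff by blast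
  have "bounded (f ` cball 0 R)"
    by (rule compact_imp_bounded[OF compact_continuous_image[OF
          continuous_on_subset[OF continuous_f subset_UNIV] compact_cball]])
  then obtain B0 where "\<And>t. t \<in> f ` cball 0 R \<Longrightarrow> norm t \<le> B0" unfolding bounded_iff by blast
  then have B0: "f x \<le> B0" if "x \<in> X\<^sub>0" for x
    using R[OF that] abs_le_D1[of "f x" B0] by simp
  \<comment> \<open>A grid of mesh \<epsilon> / 4. Each cell contains a noncritical level a i, so
    neighbouring levels differ by less than \<epsilon> / 2; the offset puts a 0 below the lower
    bound m of f.\<close>
  define b where "b i = m - 1 - \<epsilon> + real i * (\<epsilon> / 4)" for i
  have b_Suc: "b (Suc i) = b i + \<epsilon> / 4" for i by (simp add: b_def algebra_simps)
  have "\<exists>v. b i < v \<and> v < b (Suc i) \<and> \<not> critical_value ip f v" for i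
    using \<epsilon> b_Suc[of i] by (intro noncritical_dense) simp
  then obtain a where a: "\<And>i. b i < a i \<and> a i < b (Suc i) \<and> \<not> critical_value ip f (a i)" by metis
  have gap: "a (Suc i) - a i < \<epsilon> / 2" for i
    using a[of i] a[of "Suc i"] b_Suc[of i] b_Suc[of "Suc i"] by linarith
  have a0: "a 0 < m" using a[of 0] b_Suc[of 0] \<epsilon> by (simp add: b_def)
  obtain r :: nat where "(B0 - (m - 1 - \<epsilon>)) / (\<epsilon> / 4) < real r" using reals_Archimedean2 by blast
  then have "B0 - (m - 1 - \<epsilon>) < real r * (\<epsilon> / 4)"
    using \<epsilon> by (subst (asm) pos_divide_less_eq) auto
  then have "B0 < b r" by (simp add: b_def)
  then have ar: "B0 < a r" using a[of r] by linarith
  \<comment> \<open>The degenerate pairs guard the single levels; the others are the gaps free of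
    critical values.\<close>
  define J where "J = (\<lambda>i. (a i, a i)) ` {..r} \<union>
    (\<lambda>i. (a i, a (Suc i))) ` {i. i < r \<and> (\<forall>v. a i \<le> v \<and> v \<le> a (Suc i) \<longrightarrow> \<not> critical_value ip f v)}"
  have finJ: "finite J" unfolding J_def by auto
  have ncJ: "\<not> critical_value ip f v" if "(p, q) \<in> J" "p \<le> v" "v \<le> q" for p q v
    using that a unfolding J_def by (auto simp: order_antisym)
  \<comment> \<open>The approximation is invoked anew at the start of every block, so its initial
    set is the sublevel set of a r, which block starts never leave, instead of the given bounded
    set. Within a block the values stay below a r + 1.\<close>
  obtain T where T: "T > 0" and apT: "\<forall>\<epsilon>>0. \<exists>\<alpha>'>0. \<forall>\<alpha>\<in>{0<..\<alpha>'}. \<forall>k'. \<forall>x\<in>M f \<alpha> {x. f x \<le> a r} k'.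
           (\<forall>k\<le>k'. x k \<in> {x. f x \<le> a r + 1}) \<longrightarrow>
           (\<exists>y. subgradient_trajectory ip f c T y \<and> y 0 \<in> {x. f x \<le> a r} \<and>
              (\<forall>k\<in>{k'..k' + nat \<lfloor>T / \<alpha>\<rfloor>}.
                 ip_norm ip (x k - y ((real k - real k') * \<alpha>)) \<le> \<epsilon>))"
    using mp[OF spec[OF spec[OF apc]] conjI[OF compact_sublevel[of "a r"] compact_sublevel[of "a r + 1"]]]
    by (elim exE conjE)
  have "\<exists>\<beta>>0. \<forall>j\<in>J. block c T j \<beta>"
    by (rule block_uniform[OF finJ c T]) (rule ncJ)
  then obtain \<beta> where \<beta>: "\<beta> > 0" "\<And>j. j \<in> J \<Longrightarrow> block c T j \<beta>" by blast
  \<comment> \<open>Iterate and trajectory differ in value by at most \<rho> at either end of a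
    block, so a drop of \<beta> leaves \<beta> - 2 * \<rho> \<ge> \<rho>. Moreover \<rho> \<le> 1
    keeps values below a r + 1, and 2 * \<rho> \<le> \<epsilon> / 2 is what the gap leaves of
    \<epsilon>.\<close>
  define \<rho> where "\<rho> = min (\<beta> / 3) (min 1 (\<epsilon> / 4))"
  have \<rho>: "\<rho> > 0" "3 * \<rho> \<le> \<beta>" "\<rho> \<le> 1" "\<rho> \<le> \<epsilon> / 4"
    using \<beta>(1) \<epsilon> by (auto simp: \<rho>_def min_def)
  obtain e where e: "e > 0" "\<And>y z. f y \<le> a r \<Longrightarrow> ip_norm ip (z - y) \<le> e \<Longrightarrow> \<bar>f z - f y\<bar> \<le> \<rho>"
    using f_uniform_near_sublevel[OF \<rho>(1)] by blast
  obtain \<alpha>0 where \<alpha>0: "\<alpha>0 > 0" and ape: "\<forall>\<alpha>\<in>{0<..\<alpha>0}. \<forall>k'. \<forall>x\<in>M f \<alpha> {x. f x \<le> a r} k'.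
           (\<forall>k\<le>k'. x k \<in> {x. f x \<le> a r + 1}) \<longrightarrow>
           (\<exists>y. subgradient_trajectory ip f c T y \<and> y 0 \<in> {x. f x \<le> a r} \<and>
              (\<forall>k\<in>{k'..k' + nat \<lfloor>T / \<alpha>\<rfloor>}.
                 ip_norm ip (x k - y ((real k - real k') * \<alpha>)) \<le> e))"
    using mp[OF spec[OF apT] e(1)] by (elim exE conjE)
  have main: "(\<forall>k. f (x k) \<le> \<bar>a r\<bar> + 1) \<and>
      (\<exists>v k\<^sub>0. critical_value ip f v \<and> (\<forall>k\<ge>k\<^sub>0. \<bar>f (x k) - v\<bar> \<le> \<epsilon>))"
    if \<alpha>: "0 < \<alpha>" "\<alpha> \<le> \<alpha>0" "\<alpha> \<le> T / 2" and x: "x \<in> M f \<alpha> X\<^sub>0 0" for \<alpha> x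
  proof -
    \<comment> \<open>The number of iterations in a block; \<alpha> \<le> T / 2 puts N * \<alpha>
      between T / 2 and T, the range in \<open>block\<close>.\<close>
    define N where "N = nat \<lfloor>T / \<alpha>\<rfloor>"
    have TA: "T / \<alpha> \<ge> 2" using \<alpha> by (simp add: le_divide_eq)
    have rN: "real N \<le> T / \<alpha>" "T / \<alpha> < real N + 1" using TA unfolding N_def by linarith+
    have N1: "N \<ge> 1" using rN(2) TA by linarith
    have NT: "real N * \<alpha> \<le> T" "T / 2 \<le> real N * \<alpha>"
    proof -
      show "real N * \<alpha> \<le> T" using rN(1) \<alpha>(1) by (simp add: le_divide_eq)
      have "T < (real N + 1) * \<alpha>" using rN(2) \<alpha>(1) by (simp add: divide_less_eq)
      then show "T / 2 \<le> real N * \<alpha>" using \<alpha>(3) by (simp add: distrib_right)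
    qed
    \<comment> \<open>A generated sequence may be relocalized at any later index, which is what
      allows restarting the approximation at each block.\<close>
    have x0: "x 0 \<in> X\<^sub>0" and xM: "\<And>X k. x k \<in> X \<Longrightarrow> x \<in> M f \<alpha> X k"
      using im \<alpha>(1) x unfolding iterative_method_def by blast+
    define ok where "ok k' \<longleftrightarrow> f (x k') \<le> a r \<and> (\<forall>k\<le>k'. f (x k) \<le> a r + 1)" for k'
    have blk: "(\<forall>k\<in>{k'..k' + N}. f (x k) \<le> f (x k') + 2 * \<rho> \<and> f (x k) \<le> a r + 1 \<and> f (x (k' + N)) - 2 * \<rho> \<le> f (x k)) \<and>
        (\<forall>p q. (p, q) \<in> J \<longrightarrow> f (x k') \<le> q \<longrightarrow> f (x (k' + N)) \<le> max (p - \<rho>) (f (x k') - \<rho>))"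
      if ok: "ok k'" for k'
    proof -
      have "x \<in> M f \<alpha> {x. f x \<le> a r} k'" using ok by (intro xM) (simp add: ok_def)
      moreover have ball: "\<forall>k\<le>k'. x k \<in> {x. f x \<le> a r + 1}" using ok by (simp add: ok_def)
      moreover have "\<alpha> \<in> {0<..\<alpha>0}" using \<alpha> by simp
      ultimately have "\<exists>y. subgradient_trajectory ip f c T y \<and> y 0 \<in> {x. f x \<le> a r} \<and>
          (\<forall>k\<in>{k'..k' + N}. ip_norm ip (x k - y ((real k - real k') * \<alpha>)) \<le> e)"
        unfolding N_def using mp[OF bspec[OF spec[OF bspec[OF ape]]] ball] by simp
      then obtain y where y0: "subgradient_trajectory ip f c T y \<and> y 0 \<in> {x. f x \<le> a r} \<and>
          (\<forall>k\<in>{k'..k' + N}. ip_norm ip (x k - y ((real k - real k') * \<alpha>)) \<le> e)" by (rule exE)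
      then have y: "subgradient_trajectory ip f c T y" "f (y 0) \<le> a r"
        and near: "\<And>k. k \<in> {k'..k' + N} \<Longrightarrow> ip_norm ip (x k - y ((real k - real k') * \<alpha>)) \<le> e"
        by simp_all
      have mono: "f (y v) \<le> f (y u)" if "0 \<le> u" "u \<le> v" "v \<le> T" for u v
        using trajectory_decrease[OF y(1) c that, of 0] ip_norm_nonneg by simp
      have tk: "0 \<le> (real k - real k') * \<alpha>" "(real k - real k') * \<alpha> \<le> real N * \<alpha>" if "k \<in> {k'..k' + N}" for k
        using that \<alpha>(1) by (auto intro!: mult_right_mono)
      have fy: "\<bar>f (x k) - f (y ((real k - real k') * \<alpha>))\<bar> \<le> \<rho>" if k: "k \<in> {k'..k' + N}" for k
      proof (rule e(2)[OF _ near[OF k]])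
        show "f (y ((real k - real k') * \<alpha>)) \<le> a r"
          using mono[of 0 "(real k - real k') * \<alpha>"] tk[OF k] NT(1) y(2) by linarith
      qed
      have f0: "\<bar>f (x k') - f (y 0)\<bar> \<le> \<rho>" using fy[of k'] by simp
      have fN: "\<bar>f (x (k' + N)) - f (y (real N * \<alpha>))\<bar> \<le> \<rho>" using fy[of "k' + N"] by simp
      have 1: "f (x k) \<le> f (x k') + 2 * \<rho> \<and> f (x k) \<le> a r + 1 \<and> f (x (k' + N)) - 2 * \<rho> \<le> f (x k)"
        if k: "k \<in> {k'..k' + N}" for k
      proof -
        have "f (y ((real k - real k') * \<alpha>)) \<le> f (y 0)" "f (y (real N * \<alpha>)) \<le> f (y ((real k - real k') * \<alpha>))"
          using tk[OF k] NT(1) by (auto intro!: mono)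
        then show ?thesis using fy[OF k] f0 fN y(2) \<rho>(3) by linarith
      qed
      have 2: "f (x (k' + N)) \<le> max (p - \<rho>) (f (x k') - \<rho>)" if pq: "(p, q) \<in> J" "f (x k') \<le> q" for p q
      proof -
        have "f (y 0) \<le> q + \<beta>" using pq(2) f0 \<rho>(1,2) by linarith
        then have "f (y (real N * \<alpha>)) \<le> max (p - \<beta>) (f (y 0) - \<beta>)"
          using \<beta>(2)[OF pq(1)] y(1) NT unfolding block_def prod.case by blast
        then have "f (y (real N * \<alpha>)) \<le> p - \<beta> \<or> f (y (real N * \<alpha>)) \<le> f (y 0) - \<beta>" by (simp add: le_max_iff_disj)
        then have "f (x (k' + N)) \<le> p - \<rho> \<or> f (x (k' + N)) \<le> f (x k') - \<rho>"
          using fN f0 \<rho>(1,2) by linarith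
        then show ?thesis by (simp add: le_max_iff_disj)
      qed
      show ?thesis using 1 2 by blast
    qed
    have blk1: "f (x k) \<le> f (x k') + 2 * \<rho>" "f (x k) \<le> a r + 1" "f (x (k' + N)) - 2 * \<rho> \<le> f (x k)"
      if "ok k'" "k' \<le> k" "k \<le> k' + N" for k k'
      using blk[OF that(1)] that(2,3) by auto
    have blk2: "f (x (k' + N)) \<le> max (p - \<rho>) (f (x k') - \<rho>)" if "ok k'" "(p, q) \<in> J" "f (x k') \<le> q" for k' p q
      using blk[OF that(1)] that(2,3) by blast
    have Ja: "(a i, a i) \<in> J" if "i \<le> r" for i using that by (simp add: J_def)
    \<comment> \<open>The pair (a r, a r) keeps the block starts below a r, and within a block the
      values stay below a r + 1; this restores the hypotheses of the approximation for the next
      block.\<close>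
    have ok: "ok (j * N)" for j
    proof (induction j)
      case 0
      then show ?case using B0[OF x0] ar by (simp add: ok_def)
    next
      case (Suc j)
      have "f (x (j * N + N)) \<le> max (a r - \<rho>) (f (x (j * N)) - \<rho>)"
        using Suc by (intro blk2[OF Suc Ja[OF order_refl]]) (simp add: ok_def)
      then have "f (x (Suc j * N)) \<le> a r" using Suc \<rho>(1) by (auto simp: ok_def add.commute)
      moreover have "f (x k) \<le> a r + 1" if "k \<le> Suc j * N" for k
      proof (cases "k \<le> j * N")
        case True
        then show ?thesis using Suc by (simp add: ok_def)
      next
        case False
        then show ?thesis using that by (intro blk1(2)[OF Suc]) auto
      qed
      ultimately show ?case by (simp add: ok_def)
    qed
    have block_index: "k div N * N \<le> k" "k \<le> k div N * N + N" for k
    proof -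
      show "k div N * N \<le> k" by (rule div_times_less_eq_dividend)
      have "k = k div N * N + k mod N" by simp
      moreover have "k mod N < N" using N1 by simp
      ultimately show "k \<le> k div N * N + N" by linarith
    qed
    define F where "F j = f (x (j * N))" for j
    have next_block: "F (Suc j) \<le> max (p - \<rho>) (F j - \<rho>)" if "(p, q) \<in> J" "F j \<le> q" for j p q
      using blk2[OF ok[of j] that(1)] that(2) by (simp add: F_def add.commute)
    have bound: "f (x k) \<le> \<bar>a r\<bar> + 1" for k
      using blk1(2)[OF ok block_index[of k]] by linarith
    \<comment> \<open>The lowest level reached by any block start. It is not 0, as a 0 lies below
      all values; so block starts always stay above the preceding level a h, and, by the degenerate
      pair at a i, eventually below a i.\<close>
    define i where "i = (LEAST i. \<exists>j. F j \<le> a i)"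
    have "F 0 \<le> a r" using ok[of 0] by (simp add: F_def ok_def)
    then have ir: "\<exists>j. F j \<le> a r" by blast
    have i: "\<exists>j. F j \<le> a i" unfolding i_def by (rule LeastI[of _ r]) (rule ir)
    have "i \<le> r" unfolding i_def by (rule Least_le) (rule ir)
    have "i \<noteq> 0"
    proof
      assume "i = 0"
      then obtain j where "F j \<le> a 0" using i by auto
      then show False using a0 m[of "x (j * N)"] by (simp add: F_def)
    qed
    then obtain h where h: "i = Suc h" by (cases i) auto
    have low: "a h < F j" for j
    proof (rule ccontr)
      assume "\<not> a h < F j"
      then have "\<exists>j. F j \<le> a h" by (meson not_less)
      then have "i \<le> h" unfolding i_def by (rule Least_le)
      then show False using h by simp
    qed
    obtain j0 where j0: "F j0 \<le> a i" using i by blast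
    have up: "F j \<le> a i" if "j0 \<le> j" for j
      using that
    proof (induction j rule: dec_induct)
      case (step j)
      then show ?case using next_block[OF Ja[OF \<open>i \<le> r\<close>], of j] \<rho>(1) by auto
    qed (rule j0)
    have "\<exists>v. a h \<le> v \<and> v \<le> a i \<and> critical_value ip f v"
    proof (rule ccontr)
      assume "\<not> ?thesis"
      \<comment> \<open>In a gap without critical values every block would lower F by \<rho>, the
        alternative of falling below a h being excluded by \<open>low\<close>; this cannot go on
        forever.\<close>
      then have hJ: "(a h, a i) \<in> J" using \<open>i \<le> r\<close> unfolding J_def h by auto
      have dec: "F (Suc j) \<le> F j - \<rho>" if "j0 \<le> j" for j
        using next_block[OF hJ up[OF that]] low[of "Suc j"] \<rho>(1) by (auto simp: le_max_iff_disj)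
      have lin: "F (j0 + n) \<le> F j0 - real n * \<rho>" for n
      proof (induction n)
        case (Suc n)
        then show ?case using dec[of "j0 + n"] by (simp add: algebra_simps)
      qed simp
      obtain n :: nat where "(F j0 - a h) / \<rho> < real n" using reals_Archimedean2 by blast
      then have "F j0 - a h < real n * \<rho>" using \<rho>(1) by (simp add: divide_less_eq)
      then show False using lin[of n] low[of "j0 + n"] by linarith
    qed
    then obtain v where v: "a h \<le> v" "v \<le> a i" "critical_value ip f v" by blast
    \<comment> \<open>Inside a block the value exceeds that at the start by at most 2 * \<rho> and
      lies at most 2 * \<rho> below that at the next start. Together with the gap below \<epsilon> /
      2 this gives \<epsilon>.\<close>
    have "\<bar>f (x k) - v\<bar> \<le> \<epsilon>" if k: "k \<ge> j0 * N" for k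
    proof -
      let ?j = "k div N"
      have "j0 \<le> ?j" using k N1 by (simp add: less_eq_div_iff_mult_less_eq)
      then have "F ?j \<le> a i" by (rule up)
      moreover have "f (x k) \<le> F ?j + 2 * \<rho>" "F (Suc ?j) - 2 * \<rho> \<le> f (x k)"
        using blk1(1,3)[OF ok block_index[of k]] by (auto simp: F_def add.commute)
      moreover have "a h < F (Suc ?j)" by (rule low)
      moreover have "a i - a h < \<epsilon> / 2" using gap[of h] h by simp
      ultimately show ?thesis using v(1,2) \<rho>(4) by linarith
    qed
    then show ?thesis using bound v(3) by blast
  qed
  show ?thesis
  proof (rule exI[of _ "min \<alpha>0 (T / 2)"], rule conjI)
    show "\<exists>\<Delta>>0. \<forall>\<alpha>\<in>{0<..min \<alpha>0 (T / 2)}. \<forall>x\<in>M f \<alpha> X\<^sub>0 0. (\<forall>k. f (x k) \<le> \<Delta>) \<and>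
      (\<exists>v k\<^sub>0. critical_value ip f v \<and> (\<forall>k\<ge>k\<^sub>0. \<bar>f (x k) - v\<bar> \<le> \<epsilon>))"
    proof (rule exI[of _ "\<bar>a r\<bar> + 1"], rule conjI, simp, intro ballI)
      fix \<alpha> x assume "\<alpha> \<in> {0<..min \<alpha>0 (T / 2)}" and x: "x \<in> M f \<alpha> X\<^sub>0 0"
      then have "0 < \<alpha>" "\<alpha> \<le> \<alpha>0" "\<alpha> \<le> T / 2" by auto
      then show "(\<forall>k. f (x k) \<le> \<bar>a r\<bar> + 1) \<and>
          (\<exists>v k\<^sub>0. critical_value ip f v \<and> (\<forall>k\<ge>k\<^sub>0. \<bar>f (x k) - v\<bar> \<le> \<epsilon>))"
        using x by (rule main)
    qed
  qed (use \<alpha>0 T in simp)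
qed

end

theorem theorem1:
  fixes S :: "nat \<Rightarrow> real list set set"
    and js :: "'n::finite list"
    and ip :: "real ^ 'n \<Rightarrow> real ^ 'n \<Rightarrow> real"
    and f :: "real ^ 'n \<Rightarrow> real"
    and M :: "'n iteration"
    and X\<^sub>0 :: "(real ^ 'n) set"
    and \<epsilon> :: real
  assumes "o_minimal_structure S"
    and "distinct js" and "set js = UNIV"
    and "inner_product ip"
    and "locally_Lipschitz ip f" and "coercive ip f" and "tame_function S js ip f"
    and "iterative_method M" and "approximated_by_subgradient_trajectories ip M f"
    and "bounded X\<^sub>0" and "\<epsilon> > 0"
  shows "\<exists>\<alpha>'>0. \<exists>\<Delta>>0. \<forall>\<alpha>\<in>{0<..\<alpha>'}. \<forall>x\<in>M f \<alpha> X\<^sub>0 0.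
    (\<forall>k. f (x k) \<le> \<Delta>) \<and>
    (\<exists>v k\<^sub>0. critical_value ip f v \<and> (\<forall>k\<ge>k\<^sub>0. \<bar>f (x k) - v\<bar> \<le> \<epsilon>))"
proof -
  interpret tame_problem S js ip f
    using assms(1-7) by unfold_locales
  show ?thesis by (rule stability[OF assms(8-11)])
qed

end
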